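(* Assume that, for each $m\in\{1,2,\dots\}$, the independent-cluster model $Y_i=X_i\beta+Z_iU_i+E_i$, $i\in\{1,\dots,m\}$, holds with true parameters $\beta=\beta_m\in\mathbb{R}^{p_m}$ and $\psi=\psi_m\in\mathbb{P}_m\subseteq\mathbb{R}^{r_m}$, and let $\theta_m=(\beta_m,\psi_m)$. Suppose there are constants $c_1>1$ and $c_2\in(1,\infty)$ not depending on $m$ such that for every $m$: (i) $\bar n/q_1\geq c_1$; (ii) $c_2^{-1}\leq\gamma_{\min}(Z_i^{\mathsf T}Z_i)\leq\gamma_{\max}(Z_i^{\mathsf T}Z_i)\leq c_2$ for every $i\in\{1,\dots,m\}$; and that (iv) $X\in\mathbb{R}^{n\times p_m}$ has full column rank for every $m$; (v) $\|\psi_m\|/\psi_{mr}=o(m^{1/2})$ as $m\to\infty$, where $\psi_{mr}$ is the last ($r_m$-th) element of $\psi_m$. Then, for any $u_m\in\mathbb{S}^{r_m+p_m-1}$, $u_m^{\mathsf T}W_m^S(\theta_m)\to\mathrm{N}(0,1)$ in distribution as $m\to\infty$. Moreover, if in addition (iii') $p_m/m\to0$, then for any $v_m\in\mathbb{S}^{r_m-1}$, $v_m^{\mathsf T}\tilde W_m^S(\psi_m)\to\mathrm{N}(0,1)$ in distribution as $m\to\infty$.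
   Context: Model (all quantities, e.g. $n_i$, $q_1$, $X_i$, $Z_i$, may depend on $m$ in any way consistent with the model and assumptions; the index is often suppressed): independently for $i\in\{1,\dots,m\}$, $Y_i=X_i\beta+Z_iU_i+E_i$, where $X_i\in\mathbb{R}^{n_i\times p}$ and $Z_i\in\mathbb{R}^{n_i\times q_1}$ are non-stochastic, $E_i\sim\mathrm{N}(0,\psi_rI_{n_i})$ and $U_i\sim\mathrm{N}(0,\Psi_1)$ are independent. Let $n=\sum_{i=1}^mn_i=m\bar n$. Stack $Y=[Y_1^{\mathsf T},\dots,Y_m^{\mathsf T}]^{\mathsf T}$, $X=[X_1^{\mathsf T},\dots,X_m^{\mathsf T}]^{\mathsf T}$, and let $Z$ be block-diagonal with blocks $Z_1,\dots,Z_m$. Let $\psi\in\mathbb{R}^r$, $r=q_1(q_1+1)/2+1$, with first $r-1$ elements $\mathrm{vech}(\Psi_1)$ (half-vectorization, stacking the lower triangular part). $\Psi_1(\psi)$ is the symmetric $q_1\times q_1$ matrix with half-vectorization $[\psi_1,\dots,\psi_{r-1}]^{\mathsf T}$, $\Psi(\psi)=I_m\otimes\Psi_1(\psi)$, $\Sigma(\psi)=Z\Psi(\psi)Z^{\mathsf T}+\psi_rI_n$, so $Y\sim\mathrm{N}(X\beta,\Sigma(\psi))$. Let $H_j=\partial\Psi/\partial\psi_j$. The parameter set for $\psi$ is $\mathbb{P}=\mathbb{P}_m=\{\psi\in\mathbb{R}^{r}:\Psi_1(\psi)\geq0,\ \psi_r>0\}$. Score statistic: $A_j=\Sigma^{-1/2}ZH_jZ^{\mathsf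 T}\Sigma^{-1/2}$ for $j<r$, $A_r=\Sigma^{-1}$, $R=\Sigma^{-1/2}(Y-X\beta)$. The score $S(\theta)$ for $\theta=(\beta,\psi)$ stacks $X^{\mathsf T}\Sigma^{-1/2}R$ and the vector with elements $\frac12\{R^{\mathsf T}A_jR-\mathrm{tr}(A_j)\}$, $j=1,\dots,r$. The Fisher information $\mathcal{I}(\theta)$ is block-diagonal with blocks $X^{\mathsf T}\Sigma^{-1}X$ and $[\mathrm{tr}(A_iA_j)/2]_{i,j=1}^r$. $W^S(\theta)=\mathcal{I}(\theta)^{-1/2}S(\theta)$ when $\mathcal{I}(\theta)$ is invertible; $W^S_m$ denotes this for given $m$. Restricted score statistic: with $X$ of full column rank $p<n$, let $V\in\mathbb{R}^{n\times(n-p)}$ be semi-orthogonal ($V^{\mathsf T}V=I_{n-p}$) with $V^{\mathsf T}X=0$; $\tilde Y=V^{\mathsf T}Y$, $\tilde Z=V^{\mathsf T}Z$, $\tilde\Sigma=V^{\mathsf T}\Sigma V$, $\tilde R=\tilde\Sigma^{-1/2}\tilde Y$, $\tilde A_j=\tilde\Sigma^{-1/2}\tilde ZH_j\tilde Z^{\mathsf T}\tilde\Sigma^{-1/2}$ for $j<r$, $\tilde A_r=\tilde\Sigma^{-1}$. $\tilde S(\psi)$ has elements $\frac12\{\tilde R^{\mathsf T}\tilde A_j\tilde R-\mathrm{tr}(\tilde A_j)\}$, $\tilde{\mathcal{I}}(\psi)=[\mathrm{tr}(\tilde A_i\tilde A_j)/2]_{i,j=1}^r$, and $\tilde W^S(\psi)=\tilde{\mathcal{I}}(\psi)^{-1/2}\tilde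 S(\psi)$; $\tilde W_m^S$ denotes this for given $m$. Notation: $\gamma_{\min},\gamma_{\max}$ are smallest and largest eigenvalues; $\|\cdot\|$ is the Euclidean norm; $\mathbb{S}^{d-1}$ is the unit sphere in $\mathbb{R}^d$. Matrix square roots are symmetric. Convergence in distribution is under the true parameters $\theta_m$. *)

theory Defs
  imports
    "HOL-Probability.Probability"
    "HOL-Library.Landau_Symbols"
    "Jordan_Normal_Form.Matrix"
    "Jordan_Normal_Form.Gauss_Jordan_Elimination"
    "Jordan_Normal_Form.Spectral_Radius"
    "Jordan_Normal_Form.DL_Rank"
begin

hide_type (open) Finite_Cartesian_Product.vec
hide_const (open) Finite_Cartesian_Product.vec Finite_Cartesian_Product.mat
unbundle no vec_syntax

text \<open>Vectors and matrices are those of \<^theory>\<open>Jordan_Normal_Form.Matrix\<close>, so all dimensions are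
  ordinary natural numbers and all indices start at 0: clusters are \<open>i < m\<close>, and the last entry of
  a parameter vector of length \<open>r\<close> is entry \<open>r - 1\<close>.\<close>

definition vec_norm :: "real vec \<Rightarrow> real" where
  "vec_norm x = sqrt (x \<bullet> x)"

definition unit_sphere :: "nat \<Rightarrow> real vec set" where
  "unit_sphere d = {x \<in> carrier_vec d. vec_norm x = 1}"

definition mat_trace :: "real mat \<Rightarrow> real" where
  "mat_trace A = (\<Sum>i<dim_row A. A $$ (i, i))"

definition psd_mat :: "real mat \<Rightarrow> bool" where
  "psd_mat A \<longleftrightarrow> square_mat A \<and> A\<^sup>T = A \<and> (\<forall>x \<in> carrier_vec (dim_row A). 0 \<le> x \<bullet> (A *\<^sub>v x))"

text \<open>A positive semidefinite matrix has exactly one positive semidefinite square root, so the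
  choice below is determined wherever it is used. \<open>mat_inv\<close> and \<open>inv_sqrt\<close> are meaningful for
  invertible (and, for \<open>inv_sqrt\<close>, positive definite) arguments only.\<close>

definition mat_sqrt :: "real mat \<Rightarrow> real mat" where
  "mat_sqrt A = (SOME B. B \<in> carrier_mat (dim_row A) (dim_row A) \<and> psd_mat B \<and> B * B = A)"

definition mat_inv :: "real mat \<Rightarrow> real mat" where
  "mat_inv A = the (mat_inverse A)"

definition inv_sqrt :: "real mat \<Rightarrow> real mat" where
  "inv_sqrt A = mat_sqrt (mat_inv A)"

definition eig_min :: "real mat \<Rightarrow> real" where
  "eig_min A = Min (spectrum A)"

definition eig_max :: "real mat \<Rightarrow> real" where
  "eig_max A = Max (spectrum A)"

definition kronecker :: "real mat \<Rightarrow> real mat \<Rightarrow> real mat" where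
  "kronecker A B = mat (dim_row A * dim_row B) (dim_col A * dim_col B)
     (\<lambda>(i, j). A $$ (i div dim_row B, j div dim_col B) * B $$ (i mod dim_row B, j mod dim_col B))"

definition stack_vec :: "nat \<Rightarrow> (nat \<Rightarrow> real vec) \<Rightarrow> real vec" where
  "stack_vec m y = vec_of_list (concat (map (\<lambda>i. list_of_vec (y i)) [0..<m]))"

definition stack_mat :: "nat \<Rightarrow> nat \<Rightarrow> (nat \<Rightarrow> real mat) \<Rightarrow> real mat" where
  "stack_mat p m X = mat_of_rows p (concat (map (\<lambda>i. rows (X i)) [0..<m]))"

definition block_diag :: "nat \<Rightarrow> (nat \<Rightarrow> real mat) \<Rightarrow> real mat" where
  "block_diag m Z = diag_block_mat (map Z [0..<m])"

definition partial_mat :: "(real vec \<Rightarrow> real mat) \<Rightarrow> nat \<Rightarrow> real vec \<Rightarrow> real mat" where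
  "partial_mat F j \<psi> = mat (dim_row (F \<psi>)) (dim_col (F \<psi>))
     (\<lambda>ab. deriv (\<lambda>t. F (\<psi> |\<^sub>v j \<mapsto> t) $$ ab) (\<psi> $ j))"

definition vech :: "real mat \<Rightarrow> real vec" where
  "vech A = vec_of_list (concat (map (\<lambda>j. map (\<lambda>i. A $$ (i, j)) [j..<dim_row A]) [0..<dim_col A]))"

text \<open>Position of entry \<open>(i, j)\<close>, \<open>j \<le> i < q\<close>, in the half-vectorization of a \<open>q \<times> q\<close> matrix.\<close>

definition vech_index :: "nat \<Rightarrow> nat \<Rightarrow> nat \<Rightarrow> nat" where
  "vech_index q i j = (\<Sum>k<j. q - k) + (i - j)"

definition n_param :: "nat \<Rightarrow> nat" where
  "n_param q = q * (q + 1) div 2 + 1"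

definition Psi1 :: "nat \<Rightarrow> real vec \<Rightarrow> real mat" where
  "Psi1 q \<psi> = mat q q (\<lambda>(i, j). \<psi> $ vech_index q (max i j) (min i j))"

definition last_param :: "nat \<Rightarrow> real vec \<Rightarrow> real" where
  "last_param q \<psi> = \<psi> $ (n_param q - 1)"

definition Psi :: "nat \<Rightarrow> nat \<Rightarrow> real vec \<Rightarrow> real mat" where
  "Psi m q \<psi> = kronecker (1\<^sub>m m) (Psi1 q \<psi>)"

definition param_set :: "nat \<Rightarrow> real vec set" where
  "param_set q = {\<psi> \<in> carrier_vec (n_param q). psd_mat (Psi1 q \<psi>) \<and> 0 < last_param q \<psi>}"

text \<open>\<open>Psi1 q \<psi>\<close> is the symmetric matrix whose half-vectorization is \<open>\<psi>\<close> without its last entry.\<close>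

lemma Psi1_symmetric: "(Psi1 q \<psi>)\<^sup>T = Psi1 q \<psi>"
  by (rule eq_matI) (auto simp: Psi1_def max.commute min.commute)

lemma length_concat_columns:
  assumes "k \<le> q"
  shows "length (concat (map (\<lambda>j. map (f j) [j..<q]) [0..<k])) = (\<Sum>j<k. q - j)"
  using assms by (induction k) auto

lemma sum_columns: "(\<Sum>k<q. q - k) = q * (q + 1) div (2 :: nat)"
proof -
  have "(\<Sum>k<q. q - k) = (\<Sum>k<q. Suc k)"
    by (rule sum.reindex_bij_witness[where i = "\<lambda>k. q - Suc k" and j = "\<lambda>k. q - Suc k"]) auto
  also have "\<dots> = q * (q + 1) div 2"
    by (induction q) auto
  finally show ?thesis .
qed

lemma concat_columns_Psi1:
  assumes "k \<le> q"
  shows "concat (map (\<lambda>j. map (\<lambda>i. Psi1 q \<psi> $$ (i, j)) [j..<q]) [0..<k])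
    = map (\<lambda>l. \<psi> $ l) [0..<(\<Sum>j<k. q - j)]"
  using assms
proof (induction k)
  case (Suc k)
  have "map (\<lambda>i. Psi1 q \<psi> $$ (i, k)) [k..<q]
      = map (\<lambda>l. \<psi> $ l) [(\<Sum>j<k. q - j)..<(\<Sum>j<k. q - j) + (q - k)]"
    using Suc.prems by (intro nth_equalityI) (auto simp: Psi1_def vech_index_def max_def min_def)
  moreover have "[0..<(\<Sum>j<Suc k. q - j)]
      = [0..<(\<Sum>j<k. q - j)] @ [(\<Sum>j<k. q - j)..<(\<Sum>j<k. q - j) + (q - k)]"
    by (metis sum.lessThan_Suc upt_add_eq_append zero_le)
  ultimately show ?case using Suc by simp
qed simp

lemma vech_Psi1:
  "vech (Psi1 q \<psi>) = vec_first \<psi> (n_param q - 1)"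
proof -
  have "vech (Psi1 q \<psi>) = vec_of_list (map (\<lambda>l. \<psi> $ l) [0..<(\<Sum>j<q. q - j)])"
    using concat_columns_Psi1[of q q \<psi>] by (simp add: vech_def Psi1_def)
  also have "\<dots> = vec_first \<psi> (n_param q - 1)"
    by (rule eq_vecI) (auto simp: vec_first_def n_param_def sum_columns vec_of_list_index)
  finally show ?thesis .
qed

definition Sigma_mat :: "nat \<Rightarrow> nat \<Rightarrow> real mat \<Rightarrow> real vec \<Rightarrow> real mat" where
  "Sigma_mat m q Z \<psi> = Z * Psi m q \<psi> * Z\<^sup>T + last_param q \<psi> \<cdot>\<^sub>m 1\<^sub>m (dim_row Z)"

text \<open>The arguments \<open>X\<close>, \<open>Z\<close>, \<open>y\<close> are the stacked design matrices and response. The restricted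
  statistic uses the same formulas as the \<open>\<psi>\<close>-part of the unrestricted one, with \<open>S\<close> (the
  covariance matrix), \<open>Z\<close> and the residual replaced by their transformed counterparts. The two
  standardized statistics are meaningful when the respective information matrix is invertible.\<close>

definition A_mat :: "nat \<Rightarrow> nat \<Rightarrow> real vec \<Rightarrow> real mat \<Rightarrow> real mat \<Rightarrow> nat \<Rightarrow> real mat" where
  "A_mat m q \<psi> S Z j =
     (if j < n_param q - 1
      then inv_sqrt S * Z * partial_mat (Psi m q) j \<psi> * Z\<^sup>T * inv_sqrt S
      else mat_inv S)"

definition var_score :: "nat \<Rightarrow> (nat \<Rightarrow> real mat) \<Rightarrow> real vec \<Rightarrow> real vec" where
  "var_score r A R = vec r (\<lambda>j. (R \<bullet> (A j *\<^sub>v R) - mat_trace (A j)) / 2)"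

definition var_info :: "nat \<Rightarrow> (nat \<Rightarrow> real mat) \<Rightarrow> real mat" where
  "var_info r A = mat r r (\<lambda>(i, j). mat_trace (A i * A j) / 2)"

definition score ::
  "nat \<Rightarrow> nat \<Rightarrow> real mat \<Rightarrow> real mat \<Rightarrow> real vec \<Rightarrow> real vec \<Rightarrow> real vec \<Rightarrow> real vec" where
  "score m q X Z \<beta> \<psi> y =
     (let S = Sigma_mat m q Z \<psi>; R = inv_sqrt S *\<^sub>v (y - X *\<^sub>v \<beta>)
      in (X\<^sup>T *\<^sub>v (inv_sqrt S *\<^sub>v R)) @\<^sub>v var_score (n_param q) (A_mat m q \<psi> S Z) R)"

definition fisher_info :: "nat \<Rightarrow> nat \<Rightarrow> real mat \<Rightarrow> real mat \<Rightarrow> real vec \<Rightarrow> real mat" where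
  "fisher_info m q X Z \<psi> =
     (let S = Sigma_mat m q Z \<psi>
      in diag_block_mat [X\<^sup>T * mat_inv S * X, var_info (n_param q) (A_mat m q \<psi> S Z)])"

definition std_score ::
  "nat \<Rightarrow> nat \<Rightarrow> real mat \<Rightarrow> real mat \<Rightarrow> real vec \<Rightarrow> real vec \<Rightarrow> real vec \<Rightarrow> real vec" where
  "std_score m q X Z \<beta> \<psi> y =
     inv_sqrt (fisher_info m q X Z \<psi>) *\<^sub>v score m q X Z \<beta> \<psi> y"

definition full_column_rank :: "real mat \<Rightarrow> bool" where
  "full_column_rank X \<longleftrightarrow> vec_space.rank (dim_row X) X = dim_col X"

definition null_basis :: "real mat \<Rightarrow> real mat \<Rightarrow> bool" where
  "null_basis X V \<longleftrightarrow> V \<in> carrier_mat (dim_row X) (dim_row X - dim_col X)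
     \<and> V\<^sup>T * V = 1\<^sub>m (dim_col V) \<and> V\<^sup>T * X = 0\<^sub>m (dim_col V) (dim_col X)"

definition restricted_score ::
  "nat \<Rightarrow> nat \<Rightarrow> real mat \<Rightarrow> real mat \<Rightarrow> real vec \<Rightarrow> real vec \<Rightarrow> real vec" where
  "restricted_score m q V Z \<psi> y =
     (let S = V\<^sup>T * Sigma_mat m q Z \<psi> * V
      in var_score (n_param q) (A_mat m q \<psi> S (V\<^sup>T * Z)) (inv_sqrt S *\<^sub>v (V\<^sup>T *\<^sub>v y)))"

definition restricted_info :: "nat \<Rightarrow> nat \<Rightarrow> real mat \<Rightarrow> real mat \<Rightarrow> real vec \<Rightarrow> real mat" where
  "restricted_info m q V Z \<psi> =
     (let S = V\<^sup>T * Sigma_mat m q Z \<psi> * V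
      in var_info (n_param q) (A_mat m q \<psi> S (V\<^sup>T * Z)))"

definition std_restricted_score ::
  "nat \<Rightarrow> nat \<Rightarrow> real mat \<Rightarrow> real mat \<Rightarrow> real vec \<Rightarrow> real vec \<Rightarrow> real vec" where
  "std_restricted_score m q V Z \<psi> y =
     inv_sqrt (restricted_info m q V Z \<psi>) *\<^sub>v restricted_score m q V Z \<psi> y"

definition vec_borel :: "nat \<Rightarrow> real vec measure" where
  "vec_borel d = vimage_algebra (carrier_vec d) (\<lambda>x. \<lambda>i\<in>{..<d}. x $ i) (Pi\<^sub>M {..<d} (\<lambda>_. borel))"

text \<open>The univariate normal distribution with the given mean and variance; variance \<open>0\<close> gives a
  point mass.\<close>

definition normal_law :: "real \<Rightarrow> real \<Rightarrow> real measure" where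
  "normal_law \<mu> v =
     (if v = 0 then return borel \<mu> else density lborel (normal_density \<mu> (sqrt v)))"

text \<open>A random vector is multivariate normal with mean \<open>\<mu>\<close> and (possibly singular) covariance \<open>S\<close>
  iff every linear form \<open>a \<bullet> x\<close> of it is univariate normal with mean \<open>a \<bullet> \<mu>\<close> and
  variance \<open>a \<bullet> S a\<close>.\<close>

definition multivariate_normal ::
  "'a measure \<Rightarrow> nat \<Rightarrow> ('a \<Rightarrow> real vec) \<Rightarrow> real vec \<Rightarrow> real mat \<Rightarrow> bool" where
  "multivariate_normal M d x \<mu> S \<longleftrightarrow>
     x \<in> measurable M (vec_borel d) \<and> \<mu> \<in> carrier_vec d \<and> S \<in> carrier_mat d d \<and> psd_mat S \<and>
     (\<forall>a \<in> carrier_vec d.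
        distr M borel (\<lambda>\<omega>. a \<bullet> x \<omega>) = normal_law (a \<bullet> \<mu>) (a \<bullet> (S *\<^sub>v a)))"

text \<open>The sum type indexes the joint family consisting of all \<open>U i\<close> and all \<open>E i\<close>.\<close>

definition cluster_model ::
  "'a measure \<Rightarrow> nat \<Rightarrow> (nat \<Rightarrow> nat) \<Rightarrow> nat \<Rightarrow> nat \<Rightarrow> (nat \<Rightarrow> real mat) \<Rightarrow> (nat \<Rightarrow> real mat) \<Rightarrow>
   real vec \<Rightarrow> real vec \<Rightarrow> (nat \<Rightarrow> 'a \<Rightarrow> real vec) \<Rightarrow> (nat \<Rightarrow> 'a \<Rightarrow> real vec) \<Rightarrow>
   (nat \<Rightarrow> 'a \<Rightarrow> real vec) \<Rightarrow> bool" where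
  "cluster_model M m ns p q X Z \<beta> \<psi> U E Y \<longleftrightarrow>
     prob_space M \<and> 0 < q \<and> \<beta> \<in> carrier_vec p \<and> \<psi> \<in> param_set q \<and>
     (\<forall>i<m. X i \<in> carrier_mat (ns i) p \<and> Z i \<in> carrier_mat (ns i) q) \<and>
     (\<forall>i<m. multivariate_normal M q (U i) (0\<^sub>v q) (Psi1 q \<psi>)) \<and>
     (\<forall>i<m. multivariate_normal M (ns i) (E i) (0\<^sub>v (ns i)) (last_param q \<psi> \<cdot>\<^sub>m 1\<^sub>m (ns i))) \<and>
     prob_space.indep_vars M (case_sum (\<lambda>i. vec_borel q) (\<lambda>i. vec_borel (ns i)))
       (case_sum U E) ({..<m} <+> {..<m}) \<and>
     (\<forall>i<m. \<forall>\<omega> \<in> space M. Y i \<omega> = X i *\<^sub>v \<beta> + Z i *\<^sub>v U i \<omega> + E i \<omega>)"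

end

theory Submission
  imports Defs "HOL-Real_Asymp.Real_Asymp"
begin

text \<open>A unit direction of the standardized score is a quadratic polynomial
  \<open>l \<bullet> R + (R \<bullet> B R - tr B) / 2\<close> in a standard normal vector \<open>R\<close>, where \<open>|l|\<^sup>2 + |B|\<^sup>2 / 2 = 1\<close> in
  Frobenius norm, so after diagonalizing \<open>B\<close> it is asymptotically normal as soon as the operator
  norm of \<open>B\<close> tends to 0. Up to the factor \<open>\<Sigma>\<^sup>-\<^sup>1\<^sup>/\<^sup>2\<close> on both sides, \<open>B\<close> is
  \<open>M = Z (I\<^sub>m \<otimes> K) Z\<^sup>T + \<kappa> I\<close> for some symmetric \<open>K\<close> that is the same in all clusters. As the number of
  observations exceeds \<open>m q\<close> by a constant factor, \<open>|M|\<^sup>2\<close> dominates \<open>m (|K|\<^sup>2 + q \<kappa>\<^sup>2)\<close>, while the squared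
  operator norm of \<open>M\<close> is at most a constant times \<open>|K|\<^sup>2 + \<kappa>\<^sup>2\<close>. The condition number of \<open>\<Sigma>\<close> is
  \<open>o(m\<^sup>1\<^sup>/\<^sup>2)\<close>, hence the operator norm of \<open>B\<close> vanishes. The restricted statistic compresses \<open>M\<close> to a
  space of codimension \<open>p = o(m)\<close>, which costs at most \<open>2 p\<close> times the squared operator norm of \<open>M\<close>.\<close>

text \<open>The growth condition matches the gain from the block structure. At unit variance the
  squared operator norm of \<open>B\<close> is at most a constant times the squared condition number
  of the covariance bounds divided by \<open>m\<close>, because \<open>m\<close> equal blocks
  multiply the squared Frobenius norm by \<open>m\<close> and leave the operator norm alone.
  Normality is given only through univariate linear forms, so the independence of the rotated
  coordinates has to be recovered from the characteristic function of all linear forms. Their number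
  grows with \<open>m\<close>, and a linear coefficient may be as large as 1. Hence the error of
  each coordinate must be a small multiple of its share of the variance and must vanish with the
  quadratic coefficient; this dictates the form of \<open>quadratic_char_constant\<close>. All
  estimates hold at one fixed \<open>m\<close>, so that spaces, dimensions and directions may vary
  freely with \<open>m\<close>. The lower bound on the Frobenius norm also makes the information
  invertible, for the restricted statistic as soon as \<open>p\<close> is small relative to
  \<open>m\<close>.\<close>

unbundle no inner_syntax

subsection \<open>Spectral theory of real symmetric matrices\<close>

text \<open>Premises that equate dimensions make this and the following \<open>_dim\<close> rules
  usable as conditional rewrite rules. With membership in \<open>carrier_mat\<close> the dimensions
  would be variables that the left-hand side does not determine.\<close>

lemma mult_mat_assoc_dim:
  "dim_col A = dim_row B \<Longrightarrow> dim_col B = dim_row C \<Longrightarrow> A * B * C = A * (B * (C :: 'a :: semiring_0 mat))"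
  by (rule assoc_mult_mat) auto

lemma mult_mat_vec_assoc_dim:
  "dim_col A = dim_row B \<Longrightarrow> dim_col B = dim_vec x \<Longrightarrow>
    (A * B) *\<^sub>v x = A *\<^sub>v (B *\<^sub>v (x :: 'a :: semiring_0 vec))"
  by (rule assoc_mult_mat_vec) auto

lemma minus_mult_dim:
  "dim_row A = dim_row B \<Longrightarrow> dim_col A = dim_col B \<Longrightarrow> dim_col A = dim_row C \<Longrightarrow>
    (A - B) * C = A * C - B * (C :: 'a :: ring mat)"
  by (rule minus_mult_distrib_mat) auto

lemma mult_minus_dim:
  "dim_row B = dim_row C \<Longrightarrow> dim_col B = dim_col C \<Longrightarrow> dim_col A = dim_row C \<Longrightarrow>
    A * (B - C) = A * B - A * (C :: 'a :: ring mat)"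
  by (rule mult_minus_distrib_mat) auto

lemma transpose_mult_dim:
  "dim_col A = dim_row B \<Longrightarrow> (A * B)\<^sup>T = B\<^sup>T * (A :: 'a :: comm_semiring_0 mat)\<^sup>T"
  by (rule transpose_mult) auto

lemma col_mult_dim:
  "dim_col A = dim_row B \<Longrightarrow> j < dim_col B \<Longrightarrow> col (A * B) j = A *\<^sub>v col B j"
  by (rule col_mult2) auto

lemma scalar_prod_transpose_dim:
  "dim_vec x = dim_row A \<Longrightarrow> dim_vec y = dim_col A \<Longrightarrow>
    x \<bullet> (A *\<^sub>v y) = (A\<^sup>T *\<^sub>v x) \<bullet> (y :: 'a :: comm_semiring_0 vec)"
  by (rule transpose_vec_mult_scalar[symmetric]) (auto intro: carrier_vecI)

lemma scalar_prod_real_nonneg: "0 \<le> (x :: real vec) \<bullet> x"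
  by (simp add: scalar_prod_def sum_nonneg)

lemma scalar_prod_real_eq_0_iff:
  fixes x :: "real vec"
  assumes "x \<in> carrier_vec n"
  shows "x \<bullet> x = 0 \<longleftrightarrow> x = 0\<^sub>v n"
proof
  assume "x \<bullet> x = 0"
  hence "\<forall>i<dim_vec x. x $ i = 0"
    by (simp add: scalar_prod_def sum_nonneg_eq_0_iff)
  thus "x = 0\<^sub>v n" using assms by (intro eq_vecI) auto
qed (use assms in auto)

lemma scalar_prod_real_pos:
  fixes x :: "real vec"
  assumes "x \<in> carrier_vec n" "x \<noteq> 0\<^sub>v n"
  shows "0 < x \<bullet> x"
  using scalar_prod_real_eq_0_iff[OF assms(1)] scalar_prod_real_nonneg[of x] assms(2)
  by linarith

lemma scalar_prod_Cauchy_Schwarz: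
  fixes x y :: "real vec"
  assumes "x \<in> carrier_vec n" "y \<in> carrier_vec n"
  shows "(x \<bullet> y)\<^sup>2 \<le> (x \<bullet> x) * (y \<bullet> y)"
  using Cauchy_Schwarz_ineq_sum[of "\<lambda>i. x $ i" "\<lambda>i. y $ i" "{0..<n}"] assms
  by (simp add: scalar_prod_def power2_eq_square)

lemma scalar_prod_mult_mat_vec:
  fixes A :: "real mat"
  assumes "A \<in> carrier_mat nr nc" "x \<in> carrier_vec nr" "y \<in> carrier_vec nc"
  shows "x \<bullet> (A *\<^sub>v y) = (\<Sum>i<nr. \<Sum>j<nc. x $ i * A $$ (i, j) * y $ j)"
  using assms
  by (simp add: scalar_prod_def sum_distrib_left lessThan_atLeast0 mult.assoc)

text \<open>Over the complex numbers an eigenvector always exists. By symmetry the Hermitian form of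
  \<open>A\<close> at this vector is real, and it equals the eigenvalue times a positive number, so
  the eigenvalue is real. The real and imaginary parts of the eigenvector then satisfy the same
  equation, and one of them is nonzero.\<close>

lemma real_symmetric_eigenvector_exists:
  fixes A :: "real mat"
  assumes A: "A \<in> carrier_mat n n" and sym: "A\<^sup>T = A" and n: "0 < n"
  obtains e v where "v \<in> carrier_vec n" "v \<noteq> 0\<^sub>v n" "A *\<^sub>v v = e \<cdot>\<^sub>v v"
proof -
  let ?C = "map_mat complex_of_real A"
  have C: "?C \<in> carrier_mat n n" using A by simp
  obtain e where "e \<in> spectrum ?C" using spectrum_non_empty[OF C] n by auto
  then obtain v where v: "v \<in> carrier_vec n" "v \<noteq> 0\<^sub>v n" and ev: "?C *\<^sub>v v = e \<cdot>\<^sub>v v"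
    using C by (auto simp: spectrum_def eigenvalue_def eigenvector_def)
  have ent: "(\<Sum>j<n. of_real (A $$ (i, j)) * v $ j) = e * v $ i" if "i < n" for i
  proof -
    have "(?C *\<^sub>v v) $ i = (e \<cdot>\<^sub>v v) $ i" using ev by simp
    thus ?thesis using that v A
      by (simp add: scalar_prod_def lessThan_atLeast0)
  qed
  have symA: "A $$ (i, j) = A $$ (j, i)" if "i < n" "j < n" for i j
    using that A sym by (metis carrier_matD index_transpose_mat(1))
  define S where "S = (\<Sum>i<n. \<Sum>j<n. of_real (A $$ (i, j)) * v $ j * cnj (v $ i))"
  define s where "s = (\<Sum>i<n. (cmod (v $ i))\<^sup>2)"
  have "cnj S = (\<Sum>i<n. \<Sum>j<n. of_real (A $$ (i, j)) * cnj (v $ j) * v $ i)"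
    by (simp add: S_def)
  also have "\<dots> = (\<Sum>j<n. \<Sum>i<n. of_real (A $$ (i, j)) * cnj (v $ j) * v $ i)"
    by (rule sum.swap)
  also have "\<dots> = S"
    unfolding S_def by (intro sum.cong refl) (simp add: symA)
  finally have "Im S = 0" by (simp add: complex_eq_iff)
  moreover have "S = e * of_real s"
  proof -
    have "S = (\<Sum>i<n. (\<Sum>j<n. of_real (A $$ (i, j)) * v $ j) * cnj (v $ i))"
      by (simp add: S_def sum_distrib_right)
    also have "\<dots> = (\<Sum>i<n. e * v $ i * cnj (v $ i))"
      by (intro sum.cong refl) (simp add: ent)
    also have "\<dots> = e * of_real s"
      by (simp add: s_def sum_distrib_left mult.assoc complex_norm_square[symmetric])
    finally show ?thesis .
  qed
  moreover have "s \<noteq> 0"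
  proof
    assume "s = 0"
    hence "\<forall>i<n. v $ i = 0" by (simp add: s_def sum_nonneg_eq_0_iff)
    hence "v = 0\<^sub>v n" using v(1) by (intro eq_vecI) auto
    thus False using v by simp
  qed
  ultimately have "Im e = 0" by simp
  define x where "x = map_vec Re v"
  define y where "y = map_vec Im v"
  have "A *\<^sub>v x = Re e \<cdot>\<^sub>v x"
  proof (rule eq_vecI)
    fix i assume i: "i < dim_vec (Re e \<cdot>\<^sub>v x)"
    hence i: "i < n" using v by (simp add: x_def)
    have "Re (\<Sum>j<n. of_real (A $$ (i, j)) * v $ j) = Re (e * v $ i)" using ent[OF i] by simp
    thus "(A *\<^sub>v x) $ i = (Re e \<cdot>\<^sub>v x) $ i"
      using i A v \<open>Im e = 0\<close> by (simp add: x_def scalar_prod_def lessThan_atLeast0)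
  qed (use A v in \<open>simp add: x_def\<close>)
  moreover have "A *\<^sub>v y = Re e \<cdot>\<^sub>v y"
  proof (rule eq_vecI)
    fix i assume i: "i < dim_vec (Re e \<cdot>\<^sub>v y)"
    hence i: "i < n" using v by (simp add: y_def)
    have "Im (\<Sum>j<n. of_real (A $$ (i, j)) * v $ j) = Im (e * v $ i)" using ent[OF i] by simp
    thus "(A *\<^sub>v y) $ i = (Re e \<cdot>\<^sub>v y) $ i"
      using i A v \<open>Im e = 0\<close> by (simp add: y_def scalar_prod_def lessThan_atLeast0)
  qed (use A v in \<open>simp add: y_def\<close>)
  moreover have "x \<noteq> 0\<^sub>v n \<or> y \<noteq> 0\<^sub>v n"
  proof (rule ccontr)
    assume "\<not> (x \<noteq> 0\<^sub>v n \<or> y \<noteq> 0\<^sub>v n)"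
    hence xy: "x = 0\<^sub>v n" "y = 0\<^sub>v n" by auto
    have "v $ i = 0" if "i < n" for i
    proof -
      have "Re (v $ i) = x $ i" "Im (v $ i) = y $ i" using that v by (auto simp: x_def y_def)
      thus ?thesis using xy that by (simp add: complex_eq_iff)
    qed
    hence "v = 0\<^sub>v n" using v(1) by (intro eq_vecI) auto
    thus False using v by simp
  qed
  moreover have "x \<in> carrier_vec n" "y \<in> carrier_vec n" using v by (auto simp: x_def y_def)
  ultimately show ?thesis using that by blast
qed

text \<open>Gram-Schmidt leaves the first vector of the completed basis unchanged, so normalizing
  its result keeps the first column parallel to \<open>v\<close>.\<close>

lemma orthogonal_mat_first_col:
  fixes v :: "real vec"
  assumes v: "v \<in> carrier_vec n" "v \<noteq> 0\<^sub>v n"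
  obtains W c where "W \<in> carrier_mat n n" "W\<^sup>T * W = 1\<^sub>m n" "col W 0 = c \<cdot>\<^sub>v v"
proof -
  interpret cof_vec_space n "TYPE(real)" .
  note bc = basis_completion[OF v]
  define us where "us = gram_schmidt n (basis_completion v)"
  note gs = gram_schmidt_result[OF bc(2,4,5) us_def]
  have n0: "0 < n"
  proof (rule ccontr)
    assume "\<not> 0 < n"
    hence "v = 0\<^sub>v n" using v by (intro eq_vecI) auto
    thus False using v by simp
  qed
  have hd: "us ! 0 = v"
  proof -
    obtain ws where "basis_completion v = v # ws"
      using bc(6,7) n0 by (cases "basis_completion v") auto
    hence "hd us = v" unfolding us_def using v gram_schmidt_hd by auto
    thus ?thesis using gs(4) bc(6) n0 by (cases us) auto
  qed
  have len: "length us = n" using gs bc by simp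
  have usc: "us ! i \<in> carrier_vec n" if "i < n" for i using gs(3) len that by auto
  have orth: "us ! i \<bullet> us ! j = 0 \<longleftrightarrow> i \<noteq> j" if "i < n" "j < n" for i j
    using corthogonalD[OF gs(2), of i j] that len by simp
  define c where "c i = 1 / sqrt (us ! i \<bullet> us ! i)" for i
  define W where "W = mat_of_cols n (map (\<lambda>i. c i \<cdot>\<^sub>v us ! i) [0..<n])"
  have W: "W \<in> carrier_mat n n" unfolding W_def by auto
  have col: "col W i = c i \<cdot>\<^sub>v us ! i" if "i < n" for i
    unfolding W_def using that usc by (subst col_mat_of_cols) auto
  have cc: "c i * (c i * (us ! i \<bullet> us ! i)) = 1" if "i < n" for i
  proof -
    have "us ! i \<bullet> us ! i \<noteq> 0" using orth[OF that that] by simp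
    hence "0 < us ! i \<bullet> us ! i" using scalar_prod_real_nonneg[of "us ! i"] by linarith
    thus ?thesis by (simp add: c_def)
  qed
  have "W\<^sup>T * W = 1\<^sub>m n"
  proof (rule eq_matI)
    fix i j assume "i < dim_row (1\<^sub>m n :: real mat)" "j < dim_col (1\<^sub>m n :: real mat)"
    hence ij: "i < n" "j < n" by auto
    have "(W\<^sup>T * W) $$ (i, j) = col W i \<bullet> col W j" using ij W by simp
    also have "\<dots> = c i * (c j * (us ! i \<bullet> us ! j))"
      using ij usc[OF ij(1)] usc[OF ij(2)]
      by (simp add: col smult_scalar_prod_distrib[of _ n] scalar_prod_smult_distrib[of _ n])
    also have "\<dots> = 1\<^sub>m n $$ (i, j)"
      using ij orth[OF ij] cc[of j] by (cases "i = j") auto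
    finally show "(W\<^sup>T * W) $$ (i, j) = 1\<^sub>m n $$ (i, j)" .
  qed (use W in auto)
  with W col[OF n0] hd that show ?thesis by auto
qed

text \<open>Deflation: rotating the first basis vector onto an eigenvector clears the first column
  of \<open>A'\<close> off the diagonal and, by symmetry, the first row. The induction hypothesis
  diagonalizes the remaining block.\<close>

lemma spectral_decomposition:
  fixes A :: "real mat"
  assumes "A \<in> carrier_mat n n" "A\<^sup>T = A"
  shows "\<exists>P d. P \<in> carrier_mat n n \<and> P\<^sup>T * P = 1\<^sub>m n \<and> P\<^sup>T * A * P = mat_diag n d"
  using assms
proof (induction n arbitrary: A)
  case 0
  have "(1\<^sub>m 0)\<^sup>T * A * 1\<^sub>m 0 = mat_diag 0 (\<lambda>_. 0)"
    by (rule eq_matI) (auto simp: mat_diag_def)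
  thus ?case by (intro exI[of _ "1\<^sub>m 0"] exI[of _ "\<lambda>_. 0"]) auto
next
  case (Suc n A)
  obtain e v where v: "v \<in> carrier_vec (Suc n)" "v \<noteq> 0\<^sub>v (Suc n)" and ev: "A *\<^sub>v v = e \<cdot>\<^sub>v v"
    using real_symmetric_eigenvector_exists[OF Suc.prems zero_less_Suc] by metis
  obtain W c where W: "W \<in> carrier_mat (Suc n) (Suc n)" and WW: "W\<^sup>T * W = 1\<^sub>m (Suc n)"
    and col: "col W 0 = c \<cdot>\<^sub>v v"
    using orthogonal_mat_first_col[OF v] by metis
  note A = Suc.prems(1)
  have WT: "W\<^sup>T \<in> carrier_mat (Suc n) (Suc n)" using W by simp
  define A' where "A' = W\<^sup>T * A * W"
  have A': "A' \<in> carrier_mat (Suc n) (Suc n)" using A W by (simp add: A'_def)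
  have symA': "A'\<^sup>T = A'"
    unfolding A'_def using A W Suc.prems(2)
    by (simp add: transpose_mult[of _ "Suc n" "Suc n" _ "Suc n"]
        assoc_mult_mat[of _ "Suc n" "Suc n" _ "Suc n" _ "Suc n"])
  have "A' $$ (i, 0) = (if i = 0 then e else 0)" if i: "i < Suc n" for i
  proof -
    have "A' $$ (i, 0) = (W\<^sup>T * (A * W)) $$ (i, 0)"
      unfolding A'_def using A W by (simp add: assoc_mult_mat[of _ "Suc n" "Suc n" _ "Suc n" _ "Suc n"])
    also have "\<dots> = col W i \<bullet> (A *\<^sub>v col W 0)"
      using A W i col_mult_dim[of A W 0] by simp
    also have "A *\<^sub>v col W 0 = e \<cdot>\<^sub>v col W 0"
      unfolding col using A v ev by (simp add: mult_mat_vec[of _ "Suc n" "Suc n"] smult_smult_assoc mult.commute)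
    also have "col W i \<bullet> (e \<cdot>\<^sub>v col W 0) = e * (col W i \<bullet> col W 0)"
      using W i by (intro scalar_prod_smult_distrib[of _ "Suc n"]) (auto intro!: carrier_vecI)
    also have "col W i \<bullet> col W 0 = (W\<^sup>T * W) $$ (i, 0)" using W i by simp
    finally show ?thesis using i by (simp add: WW)
  qed
  note A'0 = this
  have A'0': "A' $$ (0, i) = (if i = 0 then e else 0)" if "i < Suc n" for i
    using A'0[OF that] symA' A' that by (metis carrier_matD index_transpose_mat(1) zero_less_Suc)
  define A3 where "A3 = mat n n (\<lambda>(i, j). A' $$ (Suc i, Suc j))"
  have A3: "A3 \<in> carrier_mat n n" by (simp add: A3_def)
  have "A3\<^sup>T = A3"
  proof (rule eq_matI)
    fix i j assume "i < dim_row A3" "j < dim_col A3"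
    thus "A3\<^sup>T $$ (i, j) = A3 $$ (i, j)"
      using symA' A' unfolding A3_def
      by simp (metis (no_types, lifting) Suc_less_eq carrier_matD index_transpose_mat(1))
  qed (auto simp: A3_def)
  with Suc.IH[OF A3] obtain P d where P: "P \<in> carrier_mat n n" "P\<^sup>T * P = 1\<^sub>m n"
    and Pd: "P\<^sup>T * A3 * P = mat_diag n d" by blast
  \<comment> \<open>\<open>K a B\<close> is the direct sum of a scalar and a matrix. As it is
    multiplicative, the diagonalization of the lower block extends to \<open>Q\<close>.\<close>
  define K where "K a B = four_block_mat (mat 1 1 (\<lambda>_. a)) (0\<^sub>m 1 n) (0\<^sub>m n 1) B" for a and B :: "real mat"
  have K_mult: "K a B * K b C = K (a * b) (B * C)"
    if BC: "B \<in> carrier_mat n n" "C \<in> carrier_mat n n" for a b :: real and B C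
  proof -
    have c: "mat 1 1 (\<lambda>_. a) \<in> carrier_mat 1 1"
      "0\<^sub>m 1 n \<in> carrier_mat 1 n" "0\<^sub>m n 1 \<in> carrier_mat n 1" for a :: real
      by auto
    show ?thesis
      unfolding K_def mult_four_block_mat[OF c BC(1) c BC(2)] using BC
      by (intro cong_four_block_mat) (auto intro!: eq_matI simp: scalar_prod_def)
  qed
  have A'blk: "A' = K e A3"
    unfolding K_def using A' A'0 A'0' by (intro eq_matI) (auto simp: A3_def)
  define Q where "Q = K 1 P"
  have Q: "Q \<in> carrier_mat (Suc n) (Suc n)"
    using four_block_carrier_mat[of "mat 1 1 (\<lambda>_. 1)" 1 1 P n n] P(1) by (simp add: Q_def K_def)
  have PT: "P\<^sup>T \<in> carrier_mat n n" and PA: "P\<^sup>T * A3 \<in> carrier_mat n n" using P(1) A3 by auto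
  have QT: "Q\<^sup>T = K 1 (P\<^sup>T)"
    unfolding Q_def K_def using P(1) by (intro eq_matI) auto
  have QQ: "Q\<^sup>T * Q = 1\<^sub>m (Suc n)"
    unfolding QT unfolding Q_def K_mult[OF PT P(1)] P(2) unfolding K_def by (intro eq_matI) auto
  have QAQ: "Q\<^sup>T * A' * Q = mat_diag (Suc n) (\<lambda>i. if i = 0 then e else d (i - 1))"
    unfolding QT A'blk unfolding Q_def K_mult[OF PT A3] K_mult[OF PA P(1)] Pd unfolding K_def
    by (intro eq_matI) (auto simp: mat_diag_def)
  have QTc: "Q\<^sup>T \<in> carrier_mat (Suc n) (Suc n)" using Q by simp
  have tr: "(W * Q)\<^sup>T = Q\<^sup>T * W\<^sup>T" using W Q by (simp add: transpose_mult)
  show ?case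
  proof (intro exI conjI)
    show "W * Q \<in> carrier_mat (Suc n) (Suc n)" using W Q by simp
    have "(W * Q)\<^sup>T * (W * Q) = Q\<^sup>T * (W\<^sup>T * W) * Q"
      unfolding tr using W Q WT QTc by (simp add: assoc_mult_mat[of _ "Suc n" "Suc n" _ "Suc n" _ "Suc n"])
    thus "(W * Q)\<^sup>T * (W * Q) = 1\<^sub>m (Suc n)" using WW QQ QTc by simp
    have "(W * Q)\<^sup>T * A * (W * Q) = Q\<^sup>T * A' * Q"
      unfolding tr A'_def using A W Q WT QTc
      by (simp add: assoc_mult_mat[of _ "Suc n" "Suc n" _ "Suc n" _ "Suc n"])
    thus "(W * Q)\<^sup>T * A * (W * Q) = mat_diag (Suc n) (\<lambda>i. if i = 0 then e else d (i - 1))"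
      using QAQ by simp
  qed
qed

lemma scalar_prod_mat_diag:
  fixes x :: "real vec"
  assumes "x \<in> carrier_vec n"
  shows "x \<bullet> (mat_diag n d *\<^sub>v x) = (\<Sum>i<n. d i * (x $ i)\<^sup>2)"
proof -
  have "mat_diag n d *\<^sub>v x = vec n (\<lambda>i. d i * x $ i)"
    using assms
    by (intro eq_vecI) (auto simp: scalar_prod_def mat_diag_def if_distrib[of "\<lambda>c. c * _"] cong: if_cong)
  thus ?thesis using assms
    by (auto simp: scalar_prod_def lessThan_atLeast0 power2_eq_square intro!: sum.cong)
qed

lemma spectral_decomposition':
  fixes A :: "real mat"
  assumes A: "A \<in> carrier_mat n n" "A\<^sup>T = A"
  obtains P d where "P \<in> carrier_mat n n" "P\<^sup>T * P = 1\<^sub>m n" "P * P\<^sup>T = 1\<^sub>m n"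
    "A = P * mat_diag n d * P\<^sup>T"
proof -
  obtain P d where P: "P \<in> carrier_mat n n" "P\<^sup>T * P = 1\<^sub>m n"
    and d: "P\<^sup>T * A * P = mat_diag n d"
    using spectral_decomposition[OF A] by auto
  have PT: "P\<^sup>T \<in> carrier_mat n n" using P by simp
  have PP: "P * P\<^sup>T = 1\<^sub>m n"
    using mat_mult_left_right_inverse[OF PT P(1) P(2)] .
  have "P * mat_diag n d * P\<^sup>T = (P * P\<^sup>T) * A * (P * P\<^sup>T)"
    unfolding d[symmetric] using A P(1) PT by (simp add: assoc_mult_mat[of _ n n _ n _ n])
  hence "A = P * mat_diag n d * P\<^sup>T" using A by (simp add: PP)
  with P PP that show ?thesis by blast
qed

lemma scalar_prod_spectral:
  fixes P :: "real mat"
  assumes "P \<in> carrier_mat n n" "x \<in> carrier_vec n"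
  shows "x \<bullet> ((P * mat_diag n d * P\<^sup>T) *\<^sub>v x) = (\<Sum>i<n. d i * ((P\<^sup>T *\<^sub>v x) $ i)\<^sup>2)"
proof -
  have "x \<bullet> ((P * mat_diag n d * P\<^sup>T) *\<^sub>v x) = x \<bullet> (P *\<^sub>v (mat_diag n d *\<^sub>v (P\<^sup>T *\<^sub>v x)))"
    using assms mat_diag_dim[of n d]
    by (simp add: assoc_mult_mat_vec[of _ n n _ n] del: mat_diag_dim)
  also have "\<dots> = (P\<^sup>T *\<^sub>v x) \<bullet> (mat_diag n d *\<^sub>v (P\<^sup>T *\<^sub>v x))"
    using assms mat_diag_dim[of n d]
    by (intro transpose_vec_mult_scalar[symmetric, of _ n n]) (auto intro!: mult_mat_vec_carrier)
  also have "\<dots> = (\<Sum>i<n. d i * ((P\<^sup>T *\<^sub>v x) $ i)\<^sup>2)"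
    using assms by (intro scalar_prod_mat_diag) (auto intro!: mult_mat_vec_carrier)
  finally show ?thesis .
qed

lemma spectral_eigenvector:
  fixes P :: "real mat"
  assumes P: "P \<in> carrier_mat n n" "P\<^sup>T * P = 1\<^sub>m n" and i: "i < n"
  shows "(P * mat_diag n d * P\<^sup>T) *\<^sub>v col P i = d i \<cdot>\<^sub>v col P i" and "col P i \<bullet> col P i = 1"
proof -
  have "(P * mat_diag n d * P\<^sup>T) * P = P * mat_diag n d * (P\<^sup>T * P)"
    using P(1) by (simp add: mult_mat_assoc_dim carrier_matD[OF mat_diag_dim])
  also have "\<dots> = P * mat_diag n d" using P by (simp add: right_mult_one_mat[of _ n n])
  finally have "col ((P * mat_diag n d * P\<^sup>T) * P) i = col (P * mat_diag n d) i" by simp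
  moreover have "col ((P * mat_diag n d * P\<^sup>T) * P) i = (P * mat_diag n d * P\<^sup>T) *\<^sub>v col P i"
    using P i by (intro col_mult2[of _ n n _ n]) auto
  moreover have "col (P * mat_diag n d) i = d i \<cdot>\<^sub>v col P i"
    using P i by (intro eq_vecI) (auto simp: mat_diag_mult_right[of _ n n] mult.commute)
  ultimately show "(P * mat_diag n d * P\<^sup>T) *\<^sub>v col P i = d i \<cdot>\<^sub>v col P i" by simp
  have "(P\<^sup>T * P) $$ (i, i) = 1" using P i by simp
  thus "col P i \<bullet> col P i = 1" using P(1) i by simp
qed

lemma psd_matD:
  assumes "psd_mat A"
  shows "A\<^sup>T = A" "x \<in> carrier_vec (dim_row A) \<Longrightarrow> 0 \<le> x \<bullet> (A *\<^sub>v x)"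
  using assms by (auto simp: psd_mat_def)

text \<open>Take roots of the eigenvalues, each of which is nonnegative as the value of the form at
  a unit eigenvector. Existence is what gives meaning to the choice in
  \<open>mat_sqrt\<close>.\<close>

lemma psd_mat_sqrt_exists:
  assumes A: "A \<in> carrier_mat n n" "psd_mat A"
  shows "\<exists>B. B \<in> carrier_mat n n \<and> psd_mat B \<and> B * B = A"
proof -
  obtain P d where P: "P \<in> carrier_mat n n" "P\<^sup>T * P = 1\<^sub>m n" "P * P\<^sup>T = 1\<^sub>m n"
    and AP: "A = P * mat_diag n d * P\<^sup>T"
    using spectral_decomposition'[OF A(1) psd_matD(1)[OF A(2)]] by metis
  have d: "0 \<le> d i" if "i < n" for i
  proof -
    have "0 \<le> col P i \<bullet> (A *\<^sub>v col P i)"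
      using psd_matD(2)[OF A(2)] P A that by (metis carrier_matD(1) col_carrier_vec carrier_matD(2))
    also have "\<dots> = col P i \<bullet> (d i \<cdot>\<^sub>v col P i)"
      using spectral_eigenvector(1)[OF P(1,2) that] AP by simp
    also have "\<dots> = d i" using spectral_eigenvector(2)[OF P(1,2) that] by simp
    finally show ?thesis .
  qed
  let ?B = "P * mat_diag n (\<lambda>i. sqrt (d i)) * P\<^sup>T"
  have B: "?B \<in> carrier_mat n n" using P(1) by auto
  have "?B * ?B = P * mat_diag n (\<lambda>i. sqrt (d i)) * (P\<^sup>T * P) * mat_diag n (\<lambda>i. sqrt (d i)) * P\<^sup>T"
    using P(1) by (simp add: mult_mat_assoc_dim carrier_matD[OF mat_diag_dim] del: mat_diag_diag)
  also have "\<dots> = P * (mat_diag n (\<lambda>i. sqrt (d i)) * mat_diag n (\<lambda>i. sqrt (d i))) * P\<^sup>T"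
    using P(1) by (simp add: P(2) mult_mat_assoc_dim carrier_matD[OF mat_diag_dim] right_mult_one_mat[of _ n n] del: mat_diag_diag)
  also have "mat_diag n (\<lambda>i. sqrt (d i)) * mat_diag n (\<lambda>i. sqrt (d i)) = mat_diag n d"
    unfolding mat_diag_diag using d by (auto simp: mat_diag_def intro!: eq_matI)
  finally have BB: "?B * ?B = A" using AP by simp
  have "(mat_diag n (\<lambda>i. sqrt (d i)))\<^sup>T = mat_diag n (\<lambda>i. sqrt (d i))"
    by (auto simp: mat_diag_def intro!: eq_matI)
  hence "?B\<^sup>T = ?B"
    using P(1) by (simp add: transpose_mult_dim mult_mat_assoc_dim carrier_matD[OF mat_diag_dim])
  moreover have "0 \<le> x \<bullet> (?B *\<^sub>v x)" if "x \<in> carrier_vec n" for x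
    using d by (auto simp: scalar_prod_spectral[OF P(1) that] intro!: sum_nonneg)
  ultimately have "psd_mat ?B" using B P(1) by (auto simp: psd_mat_def)
  with B BB show ?thesis by blast
qed

lemma mat_sqrt:
  assumes A: "A \<in> carrier_mat n n" "psd_mat A"
  shows "mat_sqrt A \<in> carrier_mat n n" "(mat_sqrt A)\<^sup>T = mat_sqrt A" "mat_sqrt A * mat_sqrt A = A"
proof -
  have "\<exists>B. B \<in> carrier_mat (dim_row A) (dim_row A) \<and> psd_mat B \<and> B * B = A"
    using psd_mat_sqrt_exists[OF A] A by auto
  from someI_ex[OF this]
  have "mat_sqrt A \<in> carrier_mat (dim_row A) (dim_row A) \<and> psd_mat (mat_sqrt A) \<and> mat_sqrt A * mat_sqrt A = A"
    by (simp add: mat_sqrt_def)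
  thus "mat_sqrt A \<in> carrier_mat n n" "(mat_sqrt A)\<^sup>T = mat_sqrt A" "mat_sqrt A * mat_sqrt A = A"
    using A by (auto dest: psd_matD)
qed

lemma mat_inv:
  fixes A :: "real mat"
  assumes A: "A \<in> carrier_mat n n"
    and pos: "\<And>x. x \<in> carrier_vec n \<Longrightarrow> x \<noteq> 0\<^sub>v n \<Longrightarrow> 0 < x \<bullet> (A *\<^sub>v x)"
  shows "mat_inv A \<in> carrier_mat n n" "A * mat_inv A = 1\<^sub>m n" "mat_inv A * A = 1\<^sub>m n"
proof -
  have "Determinant.det A \<noteq> 0"
  proof
    assume "Determinant.det A = 0"
    then obtain x where x: "x \<in> carrier_vec n" "x \<noteq> 0\<^sub>v n" "A *\<^sub>v x = 0\<^sub>v n"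
      using det_0_iff_vec_prod_zero[OF A] by auto
    with pos[OF x(1,2)] show False by simp
  qed
  from det_non_zero_imp_unit[OF A this, of "()"]
  obtain B where "mat_inverse A = Some B"
    using mat_inverse(1)[OF A, of "()"] by (cases "mat_inverse A") auto
  with mat_inverse(2)[OF A this]
  show "mat_inv A \<in> carrier_mat n n" "A * mat_inv A = 1\<^sub>m n" "mat_inv A * A = 1\<^sub>m n"
    by (auto simp: mat_inv_def)
qed

text \<open>In the last two equations \<open>A * inv_sqrt A\<close> plays the part of the square
  root of \<open>A\<close>, so that later arguments need only the inverse root that the score
  contains.\<close>

lemma inv_sqrt:
  fixes A :: "real mat"
  assumes A: "A \<in> carrier_mat n n" "A\<^sup>T = A"
    and pos: "\<And>x. x \<in> carrier_vec n \<Longrightarrow> x \<noteq> 0\<^sub>v n \<Longrightarrow> 0 < x \<bullet> (A *\<^sub>v x)"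
  shows "inv_sqrt A \<in> carrier_mat n n" "(inv_sqrt A)\<^sup>T = inv_sqrt A"
    "inv_sqrt A * inv_sqrt A = mat_inv A" "inv_sqrt A * (A * inv_sqrt A) = 1\<^sub>m n"
    "A * inv_sqrt A * inv_sqrt A = 1\<^sub>m n"
proof -
  note inv = mat_inv[OF A(1) pos]
  let ?I = "mat_inv A"
  have IT: "?I\<^sup>T = ?I"
  proof -
    have "?I\<^sup>T = ?I\<^sup>T * (A * ?I)" using inv by (simp add: right_mult_one_mat[of _ n n])
    also have "\<dots> = (?I\<^sup>T * A\<^sup>T) * ?I"
      using inv(1) A by (simp add: mult_mat_assoc_dim carrier_matD[OF inv(1)])
    also have "?I\<^sup>T * A\<^sup>T = (A * ?I)\<^sup>T" using inv(1) A(1) by (simp add: transpose_mult_dim)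
    finally show ?thesis using inv by simp
  qed
  have psd: "psd_mat ?I"
    unfolding psd_mat_def
  proof (intro conjI ballI)
    fix x :: "real vec" assume "x \<in> carrier_vec (dim_row ?I)"
    hence x: "x \<in> carrier_vec n" using inv(1) by auto
    hence Ix: "?I *\<^sub>v x \<in> carrier_vec n" using inv(1) by (auto intro!: mult_mat_vec_carrier)
    \<comment> \<open>With \<open>y = A^-1 x\<close>, the form of the inverse at \<open>x\<close> is
      the form of \<open>A\<close> at \<open>y\<close>.\<close>
    have "x \<bullet> (?I *\<^sub>v x) = (A *\<^sub>v (?I *\<^sub>v x)) \<bullet> (?I *\<^sub>v x)"
      using inv A x by (simp add: assoc_mult_mat_vec[of _ n n _ n, symmetric])
    also have "\<dots> = (?I *\<^sub>v x) \<bullet> (A *\<^sub>v (?I *\<^sub>v x))"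
      using Ix A by (intro comm_scalar_prod[of _ n]) (auto intro!: mult_mat_vec_carrier)
    also have "\<dots> \<ge> 0"
      using pos[OF Ix] A(1) by (cases "?I *\<^sub>v x = 0\<^sub>v n") auto
    finally show "0 \<le> x \<bullet> (?I *\<^sub>v x)" .
  qed (use inv(1) IT in auto)
  note sq = mat_sqrt[OF inv(1) psd, folded inv_sqrt_def]
  show "inv_sqrt A \<in> carrier_mat n n" "(inv_sqrt A)\<^sup>T = inv_sqrt A"
    "inv_sqrt A * inv_sqrt A = mat_inv A" using sq by auto
  show "A * inv_sqrt A * inv_sqrt A = 1\<^sub>m n"
    using sq A inv by (simp add: assoc_mult_mat[of _ n n _ n _ n])
  from mat_mult_left_right_inverse[OF _ sq(1) this] sq(1) A(1)
  show "inv_sqrt A * (A * inv_sqrt A) = 1\<^sub>m n" by simp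
qed

section \<open>Frobenius norm and trace\<close>

definition frob2 :: "real mat \<Rightarrow> real" where
  "frob2 A = (\<Sum>i<dim_row A. \<Sum>j<dim_col A. (A $$ (i, j))\<^sup>2)"

lemma frob2_nonneg: "0 \<le> frob2 A"
  by (simp add: frob2_def sum_nonneg)

lemma frob2_eq_0D:
  assumes "frob2 A = 0" "i < dim_row A" "j < dim_col A"
  shows "A $$ (i, j) = 0"
  using assms by (simp add: frob2_def sum_nonneg_eq_0_iff sum_nonneg)

lemma frob2_cols: "frob2 A = (\<Sum>j<dim_col A. col A j \<bullet> col A j)"
proof -
  have "frob2 A = (\<Sum>j<dim_col A. \<Sum>i<dim_row A. (A $$ (i, j))\<^sup>2)"
    unfolding frob2_def by (rule sum.swap)
  thus ?thesis by (simp add: scalar_prod_def lessThan_atLeast0 power2_eq_square)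
qed

lemma frob2_transpose: "frob2 (A\<^sup>T) = frob2 A"
proof -
  have "frob2 (A\<^sup>T) = (\<Sum>j<dim_col A. \<Sum>i<dim_row A. (A $$ (i, j))\<^sup>2)"
    by (simp add: frob2_def)
  also have "\<dots> = frob2 A" unfolding frob2_def by (rule sum.swap)
  finally show ?thesis .
qed

text \<open>Column by column. An operator norm bound is written throughout as an inequality between
  squared lengths, so \<open>s\<close> bounds the square of the operator norm.\<close>

lemma frob2_mult_le:
  assumes A: "A \<in> carrier_mat n k" and B: "B \<in> carrier_mat k l"
    and le: "\<And>x. x \<in> carrier_vec k \<Longrightarrow> (A *\<^sub>v x) \<bullet> (A *\<^sub>v x) \<le> s * (x \<bullet> x)"
  shows "frob2 (A * B) \<le> s * frob2 B"
proof -
  have "frob2 (A * B) = (\<Sum>j<l. (A *\<^sub>v col B j) \<bullet> (A *\<^sub>v col B j))"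
    using A B col_mult_dim[of A B] by (simp add: frob2_cols)
  also have "\<dots> \<le> (\<Sum>j<l. s * (col B j \<bullet> col B j))"
    using B by (intro sum_mono le) auto
  also have "\<dots> = s * frob2 B" using B by (simp add: frob2_cols sum_distrib_left)
  finally show ?thesis .
qed

lemma frob2_mult_ge:
  assumes A: "A \<in> carrier_mat n k" and B: "B \<in> carrier_mat k l"
    and le: "\<And>x. x \<in> carrier_vec k \<Longrightarrow> s * (x \<bullet> x) \<le> (A *\<^sub>v x) \<bullet> (A *\<^sub>v x)"
  shows "s * frob2 B \<le> frob2 (A * B)"
proof -
  have "frob2 (A * B) = (\<Sum>j<l. (A *\<^sub>v col B j) \<bullet> (A *\<^sub>v col B j))"
    using A B col_mult_dim[of A B] by (simp add: frob2_cols)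
  moreover have "\<dots> \<ge> (\<Sum>j<l. s * (col B j \<bullet> col B j))"
    using B by (intro sum_mono le) auto
  moreover have "(\<Sum>j<l. s * (col B j \<bullet> col B j)) = s * frob2 B"
    using B by (simp add: frob2_cols sum_distrib_left)
  ultimately show ?thesis by linarith
qed

lemma mult_vec_norm_le_frob2:
  assumes A: "A \<in> carrier_mat n k" and x: "x \<in> carrier_vec k"
  shows "(A *\<^sub>v x) \<bullet> (A *\<^sub>v x) \<le> frob2 A * (x \<bullet> x)"
proof -
  have "(A *\<^sub>v x) \<bullet> (A *\<^sub>v x) = (\<Sum>i<n. (row A i \<bullet> x)\<^sup>2)"
    using A by (simp add: scalar_prod_def lessThan_atLeast0 power2_eq_square)
  also have "\<dots> \<le> (\<Sum>i<n. (row A i \<bullet> row A i) * (x \<bullet> x))"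
    using A x by (intro sum_mono scalar_prod_Cauchy_Schwarz[of _ k]) auto
  also have "\<dots> = frob2 A * (x \<bullet> x)"
    using A by (simp add: frob2_def sum_distrib_right scalar_prod_def lessThan_atLeast0 power2_eq_square)
  finally show ?thesis .
qed

text \<open>The squared length of \<open>?y = A^T x\<close> is the scalar product of
  \<open>x\<close> with \<open>A ?y\<close>. Cauchy-Schwarz and the bound on \<open>A\<close> give
  an inequality for the square of that squared length, from which one factor cancels.\<close>

lemma transpose_mult_vec_norm_le:
  fixes A :: "real mat"
  assumes A: "A \<in> carrier_mat n k" and x: "x \<in> carrier_vec n" and s: "0 \<le> s"
    and le: "\<And>x. x \<in> carrier_vec k \<Longrightarrow> (A *\<^sub>v x) \<bullet> (A *\<^sub>v x) \<le> s * (x \<bullet> x)"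
  shows "(A\<^sup>T *\<^sub>v x) \<bullet> (A\<^sup>T *\<^sub>v x) \<le> s * (x \<bullet> x)"
proof -
  let ?y = "A\<^sup>T *\<^sub>v x"
  have y: "?y \<in> carrier_vec k" using A by (intro carrier_vecI) auto
  have Ay: "A *\<^sub>v ?y \<in> carrier_vec n" using A by (intro carrier_vecI) auto
  have "?y \<bullet> ?y = x \<bullet> (A *\<^sub>v ?y)" using A x y by (intro transpose_vec_mult_scalar) auto
  hence "(?y \<bullet> ?y)\<^sup>2 \<le> (x \<bullet> x) * ((A *\<^sub>v ?y) \<bullet> (A *\<^sub>v ?y))"
    using scalar_prod_Cauchy_Schwarz[OF x Ay] by simp
  also have "\<dots> \<le> (x \<bullet> x) * (s * (?y \<bullet> ?y))"
    by (intro mult_left_mono le y scalar_prod_real_nonneg)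
  finally have *: "(?y \<bullet> ?y) * (?y \<bullet> ?y) \<le> (s * (x \<bullet> x)) * (?y \<bullet> ?y)"
    by (simp add: power2_eq_square mult_ac)
  show ?thesis
  proof (cases "?y \<bullet> ?y = 0")
    case True
    have "0 \<le> s * (x \<bullet> x)" using s scalar_prod_real_nonneg by simp
    thus ?thesis using True by simp
  next
    case False
    hence "0 < ?y \<bullet> ?y" using scalar_prod_real_nonneg[of ?y] by linarith
    thus ?thesis using * by simp
  qed
qed

lemma mat_trace_mult: "A \<in> carrier_mat n k \<Longrightarrow> B \<in> carrier_mat k n \<Longrightarrow>
    mat_trace (A * B) = (\<Sum>i<n. \<Sum>j<k. A $$ (i, j) * B $$ (j, i))"
  by (simp add: mat_trace_def scalar_prod_def lessThan_atLeast0)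

lemma mat_trace_comm:
  assumes "A \<in> carrier_mat n k" "B \<in> carrier_mat k n"
  shows "mat_trace (A * B) = mat_trace (B * A)"
  unfolding mat_trace_mult[OF assms] mat_trace_mult[OF assms(2,1)]
  by (subst sum.swap) (simp add: mult.commute)

lemma mat_trace_transpose_mult:
  assumes "A \<in> carrier_mat n k"
  shows "mat_trace (A\<^sup>T * A) = frob2 A"
  using assms
  by (subst mat_trace_mult[of _ k n]) (auto simp: frob2_def power2_eq_square intro: sum.swap)

lemma mat_trace_square:
  assumes "A \<in> carrier_mat n n" "A\<^sup>T = A"
  shows "mat_trace (A * A) = frob2 A"
  using mat_trace_transpose_mult[OF assms(1)] assms(2) by simp

lemma mat_trace_square_le:
  assumes A: "A \<in> carrier_mat n n"
  shows "(mat_trace A)\<^sup>2 \<le> n * frob2 A"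
proof -
  have "(mat_trace A)\<^sup>2 \<le> (\<Sum>i<n. (1 :: real)\<^sup>2) * (\<Sum>i<n. (A $$ (i, i))\<^sup>2)"
    using Cauchy_Schwarz_ineq_sum[of "\<lambda>_. 1" "\<lambda>i. A $$ (i, i)" "{..<n}"] A
    by (simp add: mat_trace_def)
  also have "\<dots> \<le> n * frob2 A"
    using A by (auto simp: frob2_def intro!: mult_left_mono sum_mono member_le_sum)
  finally show ?thesis .
qed

subsection \<open>Bounds for compressed information matrices\<close>

text \<open>Young's inequality with the weight that leaves the same fraction \<open>(c - 1) / (c + 1)\<close> of both
  squares.\<close>

lemma quadratic_form_lower_bound:
  fixes a b c :: real
  assumes c: "1 < c"
  shows "(c - 1) / (c + 1) * (a\<^sup>2 + b\<^sup>2) \<le> a\<^sup>2 - 2 * a * b + c * b\<^sup>2"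
proof -
  let ?d = "(c - 1) / (c + 1)"
  have e: "1 - ?d = 2 / (c + 1)" using c by (simp add: field_simps)
  have f: "c - ?d = (c\<^sup>2 + 1) / (c + 1)" using c by (simp add: field_simps power2_eq_square)
  have "a\<^sup>2 - 2 * a * b + c * b\<^sup>2 - ?d * (a\<^sup>2 + b\<^sup>2) = (1 - ?d) * a\<^sup>2 - 2 * a * b + (c - ?d) * b\<^sup>2"
    by (simp add: algebra_simps)
  \<comment> \<open>Completing the square leaves a second square because
    \<open>2 * (c^2 + 1) - (c + 1)^2 = (c - 1)^2\<close>.\<close>
  also have "\<dots> = ((2 * a - (c + 1) * b)\<^sup>2 + (c - 1)\<^sup>2 * b\<^sup>2) / (2 * (c + 1))"
  proof -
    define h where "h = c + 1"
    have h: "h \<noteq> 0" "c = h - 1" using c by (auto simp: h_def)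
    have "2 / h * a\<^sup>2 - 2 * a * b + (c\<^sup>2 + 1) / h * b\<^sup>2
        = (4 * a\<^sup>2 - 4 * h * a * b + 2 * (c\<^sup>2 + 1) * b\<^sup>2) / (2 * h)"
      using h(1) by (simp add: field_simps)
    also have "4 * a\<^sup>2 - 4 * h * a * b + 2 * (c\<^sup>2 + 1) * b\<^sup>2 = (2 * a - h * b)\<^sup>2 + (c - 1)\<^sup>2 * b\<^sup>2"
      unfolding h(2) by (simp add: power2_eq_square algebra_simps)
    finally show ?thesis unfolding e f by (simp add: h_def)
  qed
  also have "\<dots> \<ge> 0" using c by (intro divide_nonneg_nonneg add_nonneg_nonneg mult_nonneg_nonneg) auto
  finally show ?thesis by simp
qed

lemma sum_squares_le_twice:
  fixes a b :: real
  shows "(a + b)\<^sup>2 \<le> 2 * a\<^sup>2 + 2 * b\<^sup>2"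
  using zero_le_power2[of "a - b"] by (simp add: power2_eq_square algebra_simps)

lemma smult_one_mult_mat_vec:
  fixes x :: "real vec"
  assumes "x \<in> carrier_vec n"
  shows "(k \<cdot>\<^sub>m 1\<^sub>m n) *\<^sub>v x = k \<cdot>\<^sub>v x"
  using assms by (intro eq_vecI) (auto simp: smult_scalar_prod_distrib[of _ n] scalar_prod_left_unit[of _ n])

lemma add_mult_vec_norm_le:
  fixes A :: "real mat"
  assumes A: "A \<in> carrier_mat n n" and x: "x \<in> carrier_vec n"
  shows "((A + k \<cdot>\<^sub>m 1\<^sub>m n) *\<^sub>v x) \<bullet> ((A + k \<cdot>\<^sub>m 1\<^sub>m n) *\<^sub>v x)
    \<le> 2 * ((A *\<^sub>v x) \<bullet> (A *\<^sub>v x)) + 2 * k\<^sup>2 * (x \<bullet> x)"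
proof -
  have "(A + k \<cdot>\<^sub>m 1\<^sub>m n) *\<^sub>v x = A *\<^sub>v x + k \<cdot>\<^sub>v x"
    using A x by (simp add: add_mult_distrib_mat_vec[of _ n n] smult_one_mult_mat_vec)
  moreover have "(A *\<^sub>v x + k \<cdot>\<^sub>v x) \<bullet> (A *\<^sub>v x + k \<cdot>\<^sub>v x) = (\<Sum>i<n. ((A *\<^sub>v x) $ i + k * x $ i)\<^sup>2)"
    using A x by (auto simp: scalar_prod_def lessThan_atLeast0 power2_eq_square)
  moreover have "\<dots> \<le> (\<Sum>i<n. 2 * ((A *\<^sub>v x) $ i)\<^sup>2 + 2 * k\<^sup>2 * (x $ i)\<^sup>2)"
    using sum_squares_le_twice by (intro sum_mono) (metis mult.assoc power_mult_distrib)
  moreover have "\<dots> = 2 * ((A *\<^sub>v x) \<bullet> (A *\<^sub>v x)) + 2 * k\<^sup>2 * (x \<bullet> x)"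
    using A x by (simp add: scalar_prod_def lessThan_atLeast0 power2_eq_square sum.distrib sum_distrib_left mult.assoc)
  ultimately show ?thesis by simp
qed

lemma transpose_congruence:
  fixes A :: "real mat"
  assumes "dim_row A = dim_col Z" "dim_col A = dim_col Z" "A\<^sup>T = A"
  shows "(Z * A * Z\<^sup>T)\<^sup>T = Z * A * Z\<^sup>T"
  using assms by (simp add: transpose_mult_dim mult_mat_assoc_dim)

text \<open>The first bound applies the lower singular value bound of \<open>Z\<close> from the left
  and, after transposition, from the right. For the second, let \<open>C\<close> be the root of
  \<open>Z^T Z\<close>: moving factors cyclically under the trace shows that \<open>Z K Z^T\<close>
  has the same trace and Frobenius norm as the smaller matrix \<open>C K C\<close>, so the trace
  inequality holds with \<open>N\<close> in place of \<open>n\<close>.\<close>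

lemma frob2_congruence_bounds:
  fixes Z K :: "real mat"
  assumes Z: "Z \<in> carrier_mat n N" and K: "K \<in> carrier_mat N N" "K\<^sup>T = K" and c: "0 < c"
    and lo: "\<And>x. x \<in> carrier_vec N \<Longrightarrow> inverse c * (x \<bullet> x) \<le> (Z *\<^sub>v x) \<bullet> (Z *\<^sub>v x)"
  shows "frob2 K \<le> c\<^sup>2 * frob2 (Z * K * Z\<^sup>T)"
    and "(mat_trace (Z * K * Z\<^sup>T))\<^sup>2 \<le> N * frob2 (Z * K * Z\<^sup>T)"
proof -
  have "inverse c * frob2 K \<le> frob2 (Z * K)" by (rule frob2_mult_ge[OF Z K(1) lo])
  also have "frob2 (Z * K) = frob2 (K * Z\<^sup>T)"
    using Z K frob2_transpose[of "Z * K"] by (simp add: transpose_mult_dim)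
  also have "inverse c * \<dots> \<le> frob2 (Z * (K * Z\<^sup>T))"
    by (rule frob2_mult_ge[OF Z _ lo]) (use Z K in auto)
  finally have "inverse c * (inverse c * frob2 K) \<le> frob2 (Z * (K * Z\<^sup>T))" using c
    by (metis mult_left_mono inverse_nonnegative_iff_nonnegative less_imp_le order_trans
        \<open>inverse c * frob2 K \<le> frob2 (Z * K)\<close> \<open>frob2 (Z * K) = frob2 (K * Z\<^sup>T)\<close>
        \<open>inverse c * frob2 (K * Z\<^sup>T) \<le> frob2 (Z * (K * Z\<^sup>T))\<close>)
  thus "frob2 K \<le> c\<^sup>2 * frob2 (Z * K * Z\<^sup>T)"
    using c Z K by (simp add: mult_mat_assoc_dim field_simps power2_eq_square)
  define W where "W = Z\<^sup>T * Z"
  have W: "W \<in> carrier_mat N N" using Z by (simp add: W_def)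
  have WT: "W\<^sup>T = W" using Z by (simp add: W_def transpose_mult_dim)
  have "psd_mat W" unfolding psd_mat_def
  proof (intro conjI ballI)
    fix x :: "real vec" assume "x \<in> carrier_vec (dim_row W)"
    hence x: "x \<in> carrier_vec N" using W by simp
    have "x \<bullet> (W *\<^sub>v x) = (Z *\<^sub>v x) \<bullet> (Z *\<^sub>v x)"
      using Z x by (simp add: W_def mult_mat_vec_assoc_dim scalar_prod_transpose_dim)
    thus "0 \<le> x \<bullet> (W *\<^sub>v x)" by (simp add: scalar_prod_real_nonneg)
  qed (use W WT in auto)
  note C = mat_sqrt[OF W this]
  define C where "C = mat_sqrt W"
  note C = C[folded C_def]
  have CKC: "C * K * C \<in> carrier_mat N N" using C(1) K(1) by auto
  have "mat_trace (Z * K * Z\<^sup>T) = mat_trace (K * W)"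
    using Z K mat_trace_comm[of Z n N "K * Z\<^sup>T"] by (simp add: W_def mult_mat_assoc_dim)
  also have "\<dots> = mat_trace (C * K * C)"
    using K C mat_trace_comm[of "K * C" N N C]
    by (simp add: mult_mat_assoc_dim carrier_matD[OF C(1)] flip: C(3))
  finally have tr: "mat_trace (Z * K * Z\<^sup>T) = mat_trace (C * K * C)" .
  have "frob2 (Z * K * Z\<^sup>T) = mat_trace (Z * K * Z\<^sup>T * (Z * K * Z\<^sup>T))"
    using Z K by (intro mat_trace_square[symmetric, of _ n] transpose_congruence) auto
  also have "\<dots> = mat_trace (Z * (K * W * K * Z\<^sup>T))"
    using Z K by (simp add: mult_mat_assoc_dim W_def)
  also have "\<dots> = mat_trace (K * W * K * Z\<^sup>T * Z)"
    using Z K W by (intro mat_trace_comm[of _ n N]) auto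
  also have "\<dots> = mat_trace (K * C * C * K * C * C)"
    using Z K C by (simp add: mult_mat_assoc_dim W_def carrier_matD[OF C(1)])
  also have "\<dots> = mat_trace (C * (K * C * C * K * C))"
    using K C by (subst mat_trace_comm[of C N N]) auto
  also have "\<dots> = mat_trace (C * K * C * (C * K * C))"
    using K C(1) by (simp add: mult_mat_assoc_dim carrier_matD[OF C(1)])
  also have "\<dots> = frob2 (C * K * C)"
    using transpose_congruence[of K C] K C by (intro mat_trace_square[OF CKC]) auto
  finally have fr: "frob2 (Z * K * Z\<^sup>T) = frob2 (C * K * C)" .
  show "(mat_trace (Z * K * Z\<^sup>T))\<^sup>2 \<le> N * frob2 (Z * K * Z\<^sup>T)"
    unfolding tr fr by (rule mat_trace_square_le[OF CKC])
qed

lemma frob2_add_smult_one: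
  assumes A: "A \<in> carrier_mat n n"
  shows "frob2 (A + k \<cdot>\<^sub>m 1\<^sub>m n) = frob2 A + 2 * k * mat_trace A + n * k\<^sup>2"
proof -
  have "frob2 (A + k \<cdot>\<^sub>m 1\<^sub>m n)
      = (\<Sum>i<n. \<Sum>j<n. (A $$ (i, j))\<^sup>2 + (if i = j then 2 * k * A $$ (i, i) + k\<^sup>2 else 0))"
    (is "_ = ?R")
  proof -
    have "frob2 (A + k \<cdot>\<^sub>m 1\<^sub>m n) = (\<Sum>i<n. \<Sum>j<n. (A $$ (i, j) + k * (if i = j then 1 else 0))\<^sup>2)"
      using A by (simp add: frob2_def)
    also have "\<dots> = ?R"
      by (intro sum.cong refl) (simp add: power2_sum)
    finally show ?thesis .
  qed
  also have "\<dots> = frob2 A + 2 * k * mat_trace A + n * k\<^sup>2"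
    using A by (simp add: frob2_def mat_trace_def sum.distrib sum_distrib_left)
  finally show ?thesis .
qed

text \<open>Since \<open>n\<close> exceeds the number of columns of \<open>Z\<close> by a constant factor, the two summands of
  \<open>Z K Z\<^sup>T + k I\<close> cannot cancel.\<close>

lemma frob2_information_lower_bound:
  fixes Z K :: "real mat"
  assumes Z: "Z \<in> carrier_mat n N" and K: "K \<in> carrier_mat N N" "K\<^sup>T = K" and c: "1 < c"
    and lo: "\<And>x. x \<in> carrier_vec N \<Longrightarrow> inverse c * (x \<bullet> x) \<le> (Z *\<^sub>v x) \<bullet> (Z *\<^sub>v x)"
    and c1: "1 < c1" "c1 * N \<le> n"
  shows "(c1 - 1) / (c1 + 1) * (frob2 K + N * k\<^sup>2) \<le> c\<^sup>2 * frob2 (Z * K * Z\<^sup>T + k \<cdot>\<^sub>m 1\<^sub>m n)"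
proof -
  let ?S = "Z * K * Z\<^sup>T" and ?d = "(c1 - 1) / (c1 + 1)"
  have c0: "0 < c" using c by simp
  note b = frob2_congruence_bounds[OF Z K c0 lo]
  have S: "?S \<in> carrier_mat n n" using Z K by auto
  \<comment> \<open>\<open>a\<close> is the norm of the first summand and \<open>t\<close> that of
    the second as if it had only \<open>N\<close> diagonal entries. The trace is at most
    \<open>sqrt N * a\<close> in absolute value, so the cross term is at least
    \<open>-2 * a * t\<close>, whereas the multiple of the identity contributes
    \<open>n * k^2\<close>, at least \<open>c1 * t^2\<close>. The surplus factor \<open>c1\<close>
    excludes cancellation.\<close>
  define a where "a = sqrt (frob2 ?S)"
  define t where "t = \<bar>k\<bar> * sqrt N"
  have a2: "a\<^sup>2 = frob2 ?S" by (simp add: a_def frob2_nonneg)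
  have t2: "t\<^sup>2 = N * k\<^sup>2" by (simp add: t_def power_mult_distrib)
  have "\<bar>mat_trace ?S\<bar> \<le> sqrt N * a"
    using real_sqrt_le_mono[OF b(2)] by (simp add: a_def real_sqrt_mult)
  hence "\<bar>k\<bar> * \<bar>mat_trace ?S\<bar> \<le> \<bar>k\<bar> * (sqrt N * a)" by (intro mult_left_mono) auto
  hence "- (k * mat_trace ?S) \<le> a * t" unfolding t_def
    by (simp add: mult_ac) (metis abs_le_D2 abs_mult mult.commute)
  moreover have "c1 * t\<^sup>2 \<le> n * k\<^sup>2"
    using mult_right_mono[OF c1(2), of "k\<^sup>2"] by (simp add: t2 mult.assoc)
  ultimately have "a\<^sup>2 - 2 * a * t + c1 * t\<^sup>2 \<le> frob2 (?S + k \<cdot>\<^sub>m 1\<^sub>m n)"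
    unfolding frob2_add_smult_one[OF S] a2 by simp
  with quadratic_form_lower_bound[OF c1(1), of a t]
  have *: "?d * (frob2 ?S + N * k\<^sup>2) \<le> frob2 (?S + k \<cdot>\<^sub>m 1\<^sub>m n)" unfolding a2 t2 by simp
  have "1 \<le> c\<^sup>2" using c by simp
  hence "1 * (N * k\<^sup>2) \<le> c\<^sup>2 * (N * k\<^sup>2)" by (intro mult_right_mono) auto
  hence "frob2 K + N * k\<^sup>2 \<le> c\<^sup>2 * (frob2 ?S + N * k\<^sup>2)"
    using b(1) by (simp add: distrib_left)
  hence "?d * (frob2 K + N * k\<^sup>2) \<le> ?d * (c\<^sup>2 * (frob2 ?S + N * k\<^sup>2))"
    using c1 by (intro mult_left_mono) auto
  also have "\<dots> = c\<^sup>2 * (?d * (frob2 ?S + N * k\<^sup>2))" by simp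
  also have "\<dots> \<le> c\<^sup>2 * frob2 (?S + k \<cdot>\<^sub>m 1\<^sub>m n)" by (intro mult_left_mono *) auto
  finally show ?thesis .
qed

text \<open>Each of the two factors \<open>Z\<close> costs \<open>c\<close>; the leading 2 comes
  from squaring a sum of two vectors.\<close>

lemma information_op_bound:
  fixes Z K :: "real mat"
  assumes Z: "Z \<in> carrier_mat n N" and K: "K \<in> carrier_mat N N" and c: "0 < c" and s: "0 \<le> s"
    and hi: "\<And>x. x \<in> carrier_vec N \<Longrightarrow> (Z *\<^sub>v x) \<bullet> (Z *\<^sub>v x) \<le> c * (x \<bullet> x)"
    and Ks: "\<And>x. x \<in> carrier_vec N \<Longrightarrow> (K *\<^sub>v x) \<bullet> (K *\<^sub>v x) \<le> s * (x \<bullet> x)"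
    and x: "x \<in> carrier_vec n"
  shows "((Z * K * Z\<^sup>T + k \<cdot>\<^sub>m 1\<^sub>m n) *\<^sub>v x) \<bullet> ((Z * K * Z\<^sup>T + k \<cdot>\<^sub>m 1\<^sub>m n) *\<^sub>v x)
    \<le> 2 * (c\<^sup>2 * s + k\<^sup>2) * (x \<bullet> x)"
proof -
  let ?S = "Z * K * Z\<^sup>T"
  have S: "?S \<in> carrier_mat n n" using Z K by auto
  define y where "y = Z\<^sup>T *\<^sub>v x"
  have y: "y \<in> carrier_vec N" using Z by (intro carrier_vecI) (auto simp: y_def)
  have Ky: "K *\<^sub>v y \<in> carrier_vec N" using K by (intro carrier_vecI) auto
  have "?S *\<^sub>v x = Z *\<^sub>v (K *\<^sub>v y)" using Z K x by (simp add: y_def mult_mat_vec_assoc_dim)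
  hence "(?S *\<^sub>v x) \<bullet> (?S *\<^sub>v x) \<le> c * ((K *\<^sub>v y) \<bullet> (K *\<^sub>v y))" using hi[OF Ky] by simp
  also have "\<dots> \<le> c * (s * (y \<bullet> y))" using c by (intro mult_left_mono Ks y) auto
  also have "\<dots> \<le> c * (s * (c * (x \<bullet> x)))"
    unfolding y_def using c s by (intro mult_left_mono transpose_mult_vec_norm_le[OF Z x _ hi]) auto
  finally have "(?S *\<^sub>v x) \<bullet> (?S *\<^sub>v x) \<le> c\<^sup>2 * s * (x \<bullet> x)" by (simp add: power2_eq_square mult_ac)
  with add_mult_vec_norm_le[OF S x, of k] show ?thesis by (simp add: algebra_simps)
qed

text \<open>Put \<open>P = V V^T\<close> and let \<open>Q\<close> be the complementary projection.
  Expanding the trace of \<open>M P M P\<close> gives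
  \<open>frob2 M - 2 * frob2 (M * Q) + frob2 (Q * M * Q)\<close>. Here \<open>frob2 (M * Q)\<close>
  is at most \<open>s\<close> times \<open>frob2 Q\<close>, which for a projection is its trace
  \<open>n - k\<close>.\<close>

lemma frob2_compression:
  fixes M V :: "real mat"
  assumes M: "M \<in> carrier_mat n n" "M\<^sup>T = M" and V: "V \<in> carrier_mat n k" "V\<^sup>T * V = 1\<^sub>m k"
    and le: "\<And>x. x \<in> carrier_vec n \<Longrightarrow> (M *\<^sub>v x) \<bullet> (M *\<^sub>v x) \<le> s * (x \<bullet> x)"
  shows "frob2 M - 2 * (real n - real k) * s \<le> frob2 (V\<^sup>T * M * V)"
proof -
  define P where "P = V * V\<^sup>T"
  have P: "P \<in> carrier_mat n n" using V by (simp add: P_def)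
  have PT: "P\<^sup>T = P" using V by (simp add: P_def transpose_mult_dim)
  have "P * P = V * (V\<^sup>T * V) * V\<^sup>T" using V(1) by (simp add: P_def mult_mat_assoc_dim)
  hence PP: "P * P = P" using V by (simp add: P_def)
  define Q where "Q = 1\<^sub>m n - P"
  have Q: "Q \<in> carrier_mat n n" using P by (simp add: Q_def minus_carrier_mat)
  have QT: "Q\<^sup>T = Q" using P PT by (auto simp: Q_def transpose_minus[of _ n n])
  have PQ: "P = 1\<^sub>m n - Q" using P by (auto simp: Q_def intro!: eq_matI)
  have QQ: "Q * Q = Q"
    unfolding Q_def using P PP
    by (simp add: minus_mult_dim mult_minus_dim carrier_matD[OF P]) (auto intro!: eq_matI)
  have "mat_trace P = mat_trace (1\<^sub>m k)"
    unfolding P_def using V by (subst mat_trace_comm[of _ n k]) auto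
  hence trQ: "mat_trace Q = real n - real k"
    using P by (simp add: Q_def mat_trace_def sum_subtractf)
  have "frob2 Q = mat_trace (Q * Q)" by (rule mat_trace_square[OF Q QT, symmetric])
  hence fQ: "frob2 Q = real n - real k" using QQ trQ by simp
  have VMV: "V\<^sup>T * M * V \<in> carrier_mat k k" using V(1) M(1) by auto
  have "frob2 (V\<^sup>T * M * V) = mat_trace (V\<^sup>T * M * V * (V\<^sup>T * M * V))"
    using transpose_congruence[of M "V\<^sup>T"] V(1) M by (intro mat_trace_square[OF VMV, symmetric]) auto
  also have "\<dots> = mat_trace (V\<^sup>T * (M * P * M * V))"
    using V(1) M(1) by (simp add: P_def mult_mat_assoc_dim)
  also have "\<dots> = mat_trace (M * P * M * V * V\<^sup>T)"
    using V(1) M(1) P by (intro mat_trace_comm[of _ k n]) auto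
  also have "\<dots> = mat_trace (M * P * M * P)"
    using V(1) M(1) P by (simp add: P_def mult_mat_assoc_dim)
  also have "M * P * M * P = M * M - M * Q * M - M * M * Q + M * Q * M * Q"
    unfolding PQ using M(1) Q
    by (simp add: minus_mult_dim mult_minus_dim carrier_matD[OF Q]) (auto intro!: eq_matI)
  also have "mat_trace \<dots> = mat_trace (M * M) - mat_trace (M * Q * M) - mat_trace (M * M * Q)
      + mat_trace (M * Q * M * Q)"
    using M(1) Q by (simp add: mat_trace_def sum_subtractf sum.distrib)
  also have "mat_trace (M * Q * M) = mat_trace (M * M * Q)"
    using M(1) Q mat_trace_comm[of "M" n n "Q * M"] mat_trace_comm[of "Q" n n "M * M"]
    by (simp add: mult_mat_assoc_dim)
  also have "mat_trace (M * M * Q) = frob2 (M * Q)"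
  proof -
    have "frob2 (M * Q) = mat_trace ((M * Q)\<^sup>T * (M * Q))"
      by (rule mat_trace_transpose_mult[symmetric, of _ n n]) (use M Q in auto)
    also have "\<dots> = mat_trace (Q * (M * M * Q))"
      using M Q QT by (simp add: transpose_mult_dim mult_mat_assoc_dim)
    also have "\<dots> = mat_trace (M * M * Q * Q)"
      using M Q by (intro mat_trace_comm[of _ n n]) auto
    also have "M * M * Q * Q = M * M * Q" using M Q QQ by (simp add: mult_mat_assoc_dim)
    finally show ?thesis by simp
  qed
  also have "mat_trace (M * Q * M * Q) = frob2 (Q * M * Q)"
  proof -
    have "(Q * M * Q)\<^sup>T = Q * M * Q" using transpose_congruence[of M Q] M Q QT by simp
    hence "frob2 (Q * M * Q) = mat_trace (Q * M * Q * (Q * M * Q))"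
      using M Q by (intro mat_trace_square[symmetric, of _ n]) auto
    also have "\<dots> = mat_trace (Q * (M * (Q * Q) * M * Q))" using M Q by (simp add: mult_mat_assoc_dim)
    also have "\<dots> = mat_trace (M * Q * M * Q * Q)"
      unfolding QQ using M Q by (intro mat_trace_comm[of _ n n]) auto
    also have "\<dots> = mat_trace (M * Q * M * Q)" using M Q QQ by (simp add: mult_mat_assoc_dim)
    finally show ?thesis by simp
  qed
  also have "mat_trace (M * M) = frob2 M" by (rule mat_trace_square[OF M])
  finally have "frob2 (V\<^sup>T * M * V) = frob2 M - 2 * frob2 (M * Q) + frob2 (Q * M * Q)" by simp
  moreover have "frob2 (M * Q) \<le> s * (real n - real k)"
    using frob2_mult_le[OF M(1) Q le] fQ by simp
  ultimately show ?thesis using frob2_nonneg[of "Q * M * Q"] by (simp add: algebra_simps)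
qed

text \<open>The rank sees only the set of columns, so repeated columns have to be excluded first: a
  maximal independent subset of that set has \<open>p\<close> elements, which forces the
  \<open>p\<close> columns to be distinct.\<close>

lemma full_column_rank_inj:
  assumes X: "X \<in> carrier_mat n p" and rank: "full_column_rank X"
    and v: "v \<in> carrier_vec p" "X *\<^sub>v v = 0\<^sub>v n"
  shows "v = 0\<^sub>v p"
proof (rule ccontr)
  assume v0: "v \<noteq> 0\<^sub>v p"
  interpret vec_space "TYPE(real)" n .
  have rk: "rank X = p" using rank X by (auto simp: full_column_rank_def)
  obtain W where W: "maximal W (\<lambda>T. T \<subseteq> set (cols X) \<and> lin_indpt T)"
    using maximal_exists[of "\<lambda>T. T \<subseteq> set (cols X) \<and> lin_indpt T" "card (set (cols X))" "{}"]
    by (meson List.finite_set card_mono empty_iff empty_subsetI finite_lin_indpt2 rev_finite_subset)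
  have "length (cols X) \<le> card (set (cols X))"
    using rank_card_indpt[OF X W] rk X W by (simp add: card_mono maximal_def)
  hence d: "distinct (cols X)" by (intro card_distinct antisym card_length)
  show False
    using lin_depI[OF X v(1) v0 v(2) d] full_rank_lin_indpt[OF X rk d] by simp
qed

text \<open>\<open>M\<close> is \<open>B\<close> multiplied on both sides by the root of
  \<open>S\<close>, and \<open>B\<close> is \<open>M\<close> multiplied on both sides by the inverse
  root. In terms of squared norms each factor costs \<open>\<sigma>\<close> in the first case and
  \<open>1 / r\<close> in the second.\<close>

lemma inv_sqrt_congruence_bounds:
  fixes S :: "real mat"
  assumes S: "S \<in> carrier_mat k k" "S\<^sup>T = S" and r: "0 < r"
    and lo: "\<And>x. x \<in> carrier_vec k \<Longrightarrow> r * (x \<bullet> x) \<le> x \<bullet> (S *\<^sub>v x)"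
    and hi: "\<And>x. x \<in> carrier_vec k \<Longrightarrow> x \<bullet> (S *\<^sub>v x) \<le> \<sigma> * (x \<bullet> x)" and \<sigma>: "0 \<le> \<sigma>"
    and M: "M \<in> carrier_mat k k" and s: "0 \<le> s"
    and Ms: "\<And>x. x \<in> carrier_vec k \<Longrightarrow> (M *\<^sub>v x) \<bullet> (M *\<^sub>v x) \<le> s * (x \<bullet> x)"
  defines "B \<equiv> inv_sqrt S * M * inv_sqrt S"
  shows "frob2 M \<le> \<sigma>\<^sup>2 * frob2 B"
    and "\<And>x. x \<in> carrier_vec k \<Longrightarrow> (B *\<^sub>v x) \<bullet> (B *\<^sub>v x) \<le> s / r\<^sup>2 * (x \<bullet> x)"
proof -
  have pos: "0 < x \<bullet> (S *\<^sub>v x)" if x: "x \<in> carrier_vec k" "x \<noteq> 0\<^sub>v k" for x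
    using lo[OF x(1)] scalar_prod_real_pos[OF x] r by (smt (verit) mult_pos_pos)
  define C where "C = inv_sqrt S"
  note C = inv_sqrt[OF S pos, folded C_def]
  \<comment> \<open>The square root of \<open>S\<close>: it turns out to be symmetric with
    \<open>D * D = S\<close>, and it is inverse to \<open>C\<close>.\<close>
  define D where "D = S * C"
  have D: "D \<in> carrier_mat k k" using S C by (auto simp: D_def)
  have CD: "C * D = 1\<^sub>m k" and DC: "D * C = 1\<^sub>m k" using C(4,5) by (simp_all add: D_def)
  have DT: "D\<^sup>T = D"
  proof -
    have "D\<^sup>T = C * S" using S C by (simp add: D_def transpose_mult_dim)
    also have "\<dots> = C * S * (C * D)" using CD S C by (simp add: right_mult_one_mat[of _ k k])
    also have "\<dots> = C * D * D" using S C(1) D by (simp add: D_def mult_mat_assoc_dim carrier_matD[OF C(1)])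
    finally show ?thesis using CD D by simp
  qed
  have DD: "D * D = S"
  proof -
    have "D * D = S * (C * D)" using S C(1) by (simp add: D_def mult_mat_assoc_dim carrier_matD[OF C(1)])
    thus ?thesis using CD S by simp
  qed
  have Dn: "(D *\<^sub>v x) \<bullet> (D *\<^sub>v x) = x \<bullet> (S *\<^sub>v x)" if "x \<in> carrier_vec k" for x
    using D DT that
    by (simp add: scalar_prod_transpose_dim mult_mat_vec_assoc_dim flip: DD)
  have Dhi: "(D *\<^sub>v x) \<bullet> (D *\<^sub>v x) \<le> \<sigma> * (x \<bullet> x)" if "x \<in> carrier_vec k" for x
    using Dn hi that by simp
  have Bc: "B \<in> carrier_mat k k" using C(1) M by (auto simp: B_def C_def[symmetric])
  have "D * (B * D) = D * C * M * (C * D)"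
    using C(1) M D by (simp add: B_def C_def[symmetric] mult_mat_assoc_dim carrier_matD[OF C(1)] carrier_matD[OF D])
  hence DBD: "D * (B * D) = M" using CD DC M by simp
  have "frob2 M \<le> \<sigma> * frob2 (B * D)"
    using frob2_mult_le[OF D _ Dhi, of "B * D" k] Bc D DBD by auto
  also have "frob2 (B * D) = frob2 (D * B\<^sup>T)"
    using frob2_transpose[of "B * D"] Bc D DT by (simp add: transpose_mult_dim)
  also have "frob2 (D * B\<^sup>T) \<le> \<sigma> * frob2 (B\<^sup>T)"
    using Bc by (intro frob2_mult_le[OF D _ Dhi, of _ k]) auto
  finally show "frob2 M \<le> \<sigma>\<^sup>2 * frob2 B"
    using \<sigma> by (simp add: frob2_transpose power2_eq_square mult_left_mono)
  have Chi: "(C *\<^sub>v x) \<bullet> (C *\<^sub>v x) \<le> 1 / r * (x \<bullet> x)" if x: "x \<in> carrier_vec k" for x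
  proof -
    have Cx: "C *\<^sub>v x \<in> carrier_vec k" using C(1) by (intro carrier_vecI) auto
    have "D *\<^sub>v (C *\<^sub>v x) = (D * C) *\<^sub>v x" using C(1) D x by (simp add: mult_mat_vec_assoc_dim)
    hence "x \<bullet> x = (C *\<^sub>v x) \<bullet> (S *\<^sub>v (C *\<^sub>v x))" using Dn[OF Cx] DC x by simp
    thus ?thesis using lo[OF Cx] r by (simp add: field_simps)
  qed
  fix x :: "real vec" assume x: "x \<in> carrier_vec k"
  have Cx: "C *\<^sub>v x \<in> carrier_vec k" using C(1) by (intro carrier_vecI) auto
  have MCx: "M *\<^sub>v (C *\<^sub>v x) \<in> carrier_vec k" using M by (intro carrier_vecI) auto
  have "B *\<^sub>v x = C *\<^sub>v (M *\<^sub>v (C *\<^sub>v x))"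
    using C(1) M x by (simp add: B_def C_def[symmetric] mult_mat_vec_assoc_dim)
  hence "(B *\<^sub>v x) \<bullet> (B *\<^sub>v x) \<le> 1 / r * ((M *\<^sub>v (C *\<^sub>v x)) \<bullet> (M *\<^sub>v (C *\<^sub>v x)))"
    using Chi[OF MCx] by simp
  also have "\<dots> \<le> 1 / r * (s * ((C *\<^sub>v x) \<bullet> (C *\<^sub>v x)))"
    using r by (intro mult_left_mono Ms Cx) auto
  also have "\<dots> \<le> 1 / r * (s * (1 / r * (x \<bullet> x)))"
    using r s by (intro mult_left_mono Chi x) auto
  finally show "(B *\<^sub>v x) \<bullet> (B *\<^sub>v x) \<le> s / r\<^sup>2 * (x \<bullet> x)" by (simp add: power2_eq_square)
qed

lemma congruence_bounds:
  fixes S V :: "real mat"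
  assumes S: "S \<in> carrier_mat n n" "S\<^sup>T = S" and V: "V \<in> carrier_mat n k" "V\<^sup>T * V = 1\<^sub>m k"
    and x: "x \<in> carrier_vec k"
  shows "x \<bullet> ((V\<^sup>T * S * V) *\<^sub>v x) = (V *\<^sub>v x) \<bullet> (S *\<^sub>v (V *\<^sub>v x))"
    and "(V *\<^sub>v x) \<bullet> (V *\<^sub>v x) = x \<bullet> x"
proof -
  show "x \<bullet> ((V\<^sup>T * S * V) *\<^sub>v x) = (V *\<^sub>v x) \<bullet> (S *\<^sub>v (V *\<^sub>v x))"
    using S V(1) x by (simp add: mult_mat_vec_assoc_dim scalar_prod_transpose_dim)
  have "(V *\<^sub>v x) \<bullet> (V *\<^sub>v x) = ((V\<^sup>T * V) *\<^sub>v x) \<bullet> x"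
    using V(1) x by (simp add: mult_mat_vec_assoc_dim scalar_prod_transpose_dim)
  thus "(V *\<^sub>v x) \<bullet> (V *\<^sub>v x) = x \<bullet> x" using V x by simp
qed

text \<open>The deterministic core of both statistics; \<open>V\<close> is the identity in the
  unrestricted case. \<open>f\<close> is the squared Frobenius norm of a single block, so that
  \<open>K\<close> carries \<open>m * f\<close> in total while its squared operator norm stays below
  \<open>f\<close>. By the first bound \<open>B\<close> can vanish only if \<open>f\<close> and
  \<open>\<kappa>\<close> do, which yields invertibility of the information. The second makes the
  operator norm of \<open>B\<close> small relative to its Frobenius norm.\<close>

lemma compressed_information_bounds:
  fixes Z K S V :: "real mat" and m q N n k :: nat and f c c1 r \<sigma> \<kappa> :: real
  assumes Z: "Z \<in> carrier_mat n N" and K: "K \<in> carrier_mat N N" "K\<^sup>T = K" and c: "1 < c"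
    and Zlo: "\<And>x. x \<in> carrier_vec N \<Longrightarrow> inverse c * (x \<bullet> x) \<le> (Z *\<^sub>v x) \<bullet> (Z *\<^sub>v x)"
    and Zhi: "\<And>x. x \<in> carrier_vec N \<Longrightarrow> (Z *\<^sub>v x) \<bullet> (Z *\<^sub>v x) \<le> c * (x \<bullet> x)"
    and c1: "1 < c1" "c1 * N \<le> n"
    and N: "N = m * q" "0 < m" "0 < q"
    and f: "frob2 K = m * f" "0 \<le> f"
    and Kf: "\<And>x. x \<in> carrier_vec N \<Longrightarrow> (K *\<^sub>v x) \<bullet> (K *\<^sub>v x) \<le> f * (x \<bullet> x)"
    and S: "S \<in> carrier_mat n n" "S\<^sup>T = S" and r: "0 < r" and \<sigma>: "0 \<le> \<sigma>"
    and Slo: "\<And>x. x \<in> carrier_vec n \<Longrightarrow> r * (x \<bullet> x) \<le> x \<bullet> (S *\<^sub>v x)"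
    and Shi: "\<And>x. x \<in> carrier_vec n \<Longrightarrow> x \<bullet> (S *\<^sub>v x) \<le> \<sigma> * (x \<bullet> x)"
    and V: "V \<in> carrier_mat n k" "V\<^sup>T * V = 1\<^sub>m k"
    and nk: "8 * c^4 * (real n - real k) \<le> (c1 - 1) / (c1 + 1) * m"
  defines "T \<equiv> V\<^sup>T * S * V" and "L \<equiv> 4 * c^4 * (c1 + 1) / (c1 - 1)"
  defines "B \<equiv> inv_sqrt T * (V\<^sup>T * (Z * K * Z\<^sup>T + \<kappa> \<cdot>\<^sub>m 1\<^sub>m n) * V) * inv_sqrt T"
  shows "2 * (c\<^sup>2 * f + \<kappa>\<^sup>2) \<le> L * \<sigma>\<^sup>2 / m * frob2 B"
    and "\<And>x. x \<in> carrier_vec k \<Longrightarrow> (B *\<^sub>v x) \<bullet> (B *\<^sub>v x) \<le> L * (\<sigma> / r)\<^sup>2 / m * frob2 B * (x \<bullet> x)"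
proof -
  define d where "d = (c1 - 1) / (c1 + 1)"
  have d: "0 < d" using c1 by (simp add: d_def)
  define M where "M = Z * K * Z\<^sup>T + \<kappa> \<cdot>\<^sub>m 1\<^sub>m n"
  define s where "s = 2 * (c\<^sup>2 * f + \<kappa>\<^sup>2)"
  have c0: "0 < c" using c by simp
  have s: "0 \<le> s" using f by (simp add: s_def)
  have M: "M \<in> carrier_mat n n" using Z K by (auto simp: M_def)
  have MT: "M\<^sup>T = M"
  proof -
    have "M\<^sup>T = (Z * K * Z\<^sup>T)\<^sup>T + (\<kappa> \<cdot>\<^sub>m 1\<^sub>m n)\<^sup>T"
      unfolding M_def using Z K by (intro transpose_add[of _ n n]) auto
    also have "(Z * K * Z\<^sup>T)\<^sup>T = Z * K * Z\<^sup>T" using Z K by (intro transpose_congruence) auto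
    also have "(\<kappa> \<cdot>\<^sub>m 1\<^sub>m n)\<^sup>T = \<kappa> \<cdot>\<^sub>m 1\<^sub>m n" by (auto intro!: eq_matI)
    finally show ?thesis by (simp add: M_def)
  qed
  have Ms: "(M *\<^sub>v x) \<bullet> (M *\<^sub>v x) \<le> s * (x \<bullet> x)" if "x \<in> carrier_vec n" for x
    unfolding M_def s_def by (rule information_op_bound[OF Z K(1) c0 f(2) Zhi Kf that])
  have lb: "d * (m * f + N * \<kappa>\<^sup>2) \<le> c\<^sup>2 * frob2 M"
    using frob2_information_lower_bound[OF Z K c Zlo c1, of \<kappa>] f by (simp add: d_def M_def)
  have c2: "1 \<le> c\<^sup>2" using c by simp
  have "m * (f + \<kappa>\<^sup>2) \<le> m * f + N * \<kappa>\<^sup>2"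
  proof -
    have "real m * 1 * \<kappa>\<^sup>2 \<le> real m * real q * \<kappa>\<^sup>2"
      using N(3) by (intro mult_right_mono mult_left_mono) auto
    thus ?thesis by (simp add: N(1) algebra_simps)
  qed
  moreover have "s \<le> 2 * c\<^sup>2 * (f + \<kappa>\<^sup>2)"
    using mult_right_mono[OF c2, of "\<kappa>\<^sup>2"] by (simp add: s_def algebra_simps)
  ultimately have "m * s \<le> 2 * c\<^sup>2 * (m * f + N * \<kappa>\<^sup>2)"
    using mult_left_mono[of s "2 * c\<^sup>2 * (f + \<kappa>\<^sup>2)" "real m"]
      mult_left_mono[of "m * (f + \<kappa>\<^sup>2)" "m * f + N * \<kappa>\<^sup>2" "2 * c\<^sup>2"]
    by (simp add: algebra_simps)
  hence "d * (m * s) \<le> d * (2 * c\<^sup>2 * (m * f + N * \<kappa>\<^sup>2))" using d by (intro mult_left_mono) auto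
  also have "\<dots> = 2 * c\<^sup>2 * (d * (m * f + N * \<kappa>\<^sup>2))" by simp
  also have "\<dots> \<le> 2 * c\<^sup>2 * (c\<^sup>2 * frob2 M)" by (intro mult_left_mono lb) auto
  finally have sM: "d * m * s \<le> 2 * c^4 * frob2 M" by (simp add: power4_eq_xxxx power2_eq_square)
  \<comment> \<open>The hypothesis \<open>nk\<close> is calibrated for this point: with
    \<open>sM\<close> it makes the loss \<open>2 * (n - k) * s\<close> in
    \<open>frob2_compression\<close> at most half of \<open>frob2 M\<close>.\<close>
  have "8 * c^4 * (real n - real k) * s \<le> d * m * s"
    using nk s by (intro mult_right_mono) (auto simp: d_def)
  moreover have "2 * c^4 * (2 * (2 * (real n - real k) * s)) = 8 * c^4 * (real n - real k) * s" by simp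
  ultimately have "2 * c^4 * (2 * (2 * (real n - real k) * s)) \<le> 2 * c^4 * frob2 M" using sM by linarith
  hence "2 * (2 * (real n - real k) * s) \<le> frob2 M"
    using c0 by (subst (asm) mult_le_cancel_left_pos) auto
  hence half: "frob2 M \<le> 2 * frob2 (V\<^sup>T * M * V)"
    using frob2_compression[OF M MT V Ms] by simp
  have T: "T \<in> carrier_mat k k" using S V by (auto simp: T_def)
  have TT: "T\<^sup>T = T" using S V transpose_congruence[of S "V\<^sup>T"] by (simp add: T_def)
  note cb = congruence_bounds[OF S V]
  have Vx: "V *\<^sub>v x \<in> carrier_vec n" for x using V by (intro carrier_vecI) auto
  have Tlo: "r * (x \<bullet> x) \<le> x \<bullet> (T *\<^sub>v x)" if "x \<in> carrier_vec k" for x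
    using Slo[OF Vx, of x] cb[OF that] by (simp add: T_def)
  have Thi: "x \<bullet> (T *\<^sub>v x) \<le> \<sigma> * (x \<bullet> x)" if "x \<in> carrier_vec k" for x
    using Shi[OF Vx, of x] cb[OF that] by (simp add: T_def)
  have VMV: "V\<^sup>T * M * V \<in> carrier_mat k k" using M V by auto
  have VMVs: "((V\<^sup>T * M * V) *\<^sub>v x) \<bullet> ((V\<^sup>T * M * V) *\<^sub>v x) \<le> s * (x \<bullet> x)"
    if x: "x \<in> carrier_vec k" for x
  proof -
    have MV: "M *\<^sub>v (V *\<^sub>v x) \<in> carrier_vec n" using M by (intro carrier_vecI) auto
    have "(V\<^sup>T * M * V) *\<^sub>v x = V\<^sup>T *\<^sub>v (M *\<^sub>v (V *\<^sub>v x))"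
      using M V(1) x by (simp add: mult_mat_vec_assoc_dim)
    hence "((V\<^sup>T * M * V) *\<^sub>v x) \<bullet> ((V\<^sup>T * M * V) *\<^sub>v x) \<le> 1 * ((M *\<^sub>v (V *\<^sub>v x)) \<bullet> (M *\<^sub>v (V *\<^sub>v x)))"
      using transpose_mult_vec_norm_le[OF V(1) MV, of 1] cb(2) by simp
    also have "\<dots> \<le> s * (x \<bullet> x)" using Ms[OF Vx, of x] cb(2)[OF x] by simp
    finally show ?thesis .
  qed
  have ic1: "frob2 (V\<^sup>T * M * V) \<le> \<sigma>\<^sup>2 * frob2 B"
    unfolding B_def M_def[symmetric]
    by (rule inv_sqrt_congruence_bounds(1)[where r = r and s = s])
      (use T TT r Tlo Thi \<sigma> VMV s VMVs in auto)
  \<comment> \<open>\<open>L\<close> collects the losses: \<open>2 * c^4 / d\<close> from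
    \<open>sM\<close> and a factor 2 from the compression.\<close>
  have L: "L = 4 * c^4 / d" using c1 by (simp add: L_def d_def)
  have "d * m * s \<le> 4 * c^4 * (\<sigma>\<^sup>2 * frob2 B)"
  proof -
    have "frob2 M \<le> 2 * (\<sigma>\<^sup>2 * frob2 B)" using half ic1 by linarith
    hence "2 * c^4 * frob2 M \<le> 2 * c^4 * (2 * (\<sigma>\<^sup>2 * frob2 B))"
      using c0 by (intro mult_left_mono) auto
    thus ?thesis using sM by linarith
  qed
  hence s_le: "s \<le> L * \<sigma>\<^sup>2 / m * frob2 B"
    unfolding L using d N(2) by (simp add: field_simps)
  thus "2 * (c\<^sup>2 * f + \<kappa>\<^sup>2) \<le> L * \<sigma>\<^sup>2 / m * frob2 B" by (simp add: s_def)
  fix x :: "real vec" assume x: "x \<in> carrier_vec k"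
  have "(B *\<^sub>v x) \<bullet> (B *\<^sub>v x) \<le> s / r\<^sup>2 * (x \<bullet> x)" 
    unfolding B_def M_def[symmetric]
    by (rule inv_sqrt_congruence_bounds(2)[where \<sigma> = \<sigma> and s = s])
      (use T TT r Tlo Thi \<sigma> VMV s VMVs x in auto)
  also have "\<dots> \<le> L * \<sigma>\<^sup>2 / m * frob2 B / r\<^sup>2 * (x \<bullet> x)"
    using s_le by (intro mult_right_mono divide_right_mono) (auto simp: scalar_prod_real_nonneg)
  finally show "(B *\<^sub>v x) \<bullet> (B *\<^sub>v x) \<le> L * (\<sigma> / r)\<^sup>2 / m * frob2 B * (x \<bullet> x)"
    by (simp add: power_divide mult_ac)
qed

subsection \<open>Gaussian quadratic forms\<close>

text \<open>Under the measure with density \<open>h / expectation h\<close> the variable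
  \<open>x\<close> has characteristic function \<open>char D\<close>, hence law \<open>D\<close>; if
  \<open>expectation h\<close> is 0, both sides vanish. Only univariate uniqueness enters, yet the
  conclusion is a factorization, that is, a form of independence of \<open>x\<close> from the
  weight.\<close>

lemma (in prob_space) weighted_char_determines_expectation:
  fixes h x :: "'a \<Rightarrow> real" and f :: "real \<Rightarrow> complex"
  assumes h[measurable]: "h \<in> borel_measurable M" and x[measurable]: "x \<in> borel_measurable M"
    and h0: "\<And>\<omega>. \<omega> \<in> space M \<Longrightarrow> 0 \<le> h \<omega>" and hb: "\<And>\<omega>. \<omega> \<in> space M \<Longrightarrow> h \<omega> \<le> b"
    and D: "real_distribution D"
    and char: "\<And>a. (\<integral>\<omega>. h \<omega> *\<^sub>R iexp (a * x \<omega>) \<partial>M) = expectation h * char D a"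
    and f[measurable]: "f \<in> borel_measurable borel"
  shows "(\<integral>\<omega>. h \<omega> *\<^sub>R f (x \<omega>) \<partial>M) = expectation h * (\<integral>t. f t \<partial>D)"
proof -
  have int: "integrable M h"
    by (rule integrable_const_bound[of _ b]) (use h0 hb in auto)
  show ?thesis
  proof (cases "expectation h = 0")
    case True
    hence "AE \<omega> in M. h \<omega> = 0"
      using integral_nonneg_eq_0_iff_AE[OF int] h0 by auto
    hence "(\<integral>\<omega>. h \<omega> *\<^sub>R f (x \<omega>) \<partial>M) = (\<integral>\<omega>. 0 \<partial>M)"
      by (intro integral_cong_AE) auto
    thus ?thesis using True by simp
  next
    case False
    define e where "e = expectation h"
    have e: "0 < e"
    proof -
      have "0 \<le> expectation h" using h0 by (intro integral_nonneg_AE) auto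
      thus ?thesis using False by (simp add: e_def less_le)
    qed
    define g where "g \<omega> = (if \<omega> \<in> space M then h \<omega> / e else 0)" for \<omega>
    have g0: "0 \<le> g \<omega>" for \<omega> using h0 e by (simp add: g_def)
    have g[measurable]: "g \<in> borel_measurable M"
      unfolding g_def by measurable
    have geq: "g \<omega> = h \<omega> / e" if "\<omega> \<in> space M" for \<omega> using that by (simp add: g_def)
    have gint: "(\<integral>\<omega>. g \<omega> *\<^sub>R F \<omega> \<partial>M) = (\<integral>\<omega>. h \<omega> *\<^sub>R F \<omega> \<partial>M) / e" for F :: "'a \<Rightarrow> complex"
    proof -
      have "(\<integral>\<omega>. g \<omega> *\<^sub>R F \<omega> \<partial>M) = (\<integral>\<omega>. (1 / e) *\<^sub>R (h \<omega> *\<^sub>R F \<omega>) \<partial>M)"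
        by (intro Bochner_Integration.integral_cong) (auto simp: geq)
      thus ?thesis by (simp add: scaleR_conv_of_real)
    qed
    define P where "P = distr (density M (\<lambda>\<omega>. ennreal (g \<omega>))) borel x"
    have "emeasure (density M (\<lambda>\<omega>. ennreal (g \<omega>))) (space M) = (\<integral>\<^sup>+ \<omega>. ennreal (g \<omega>) \<partial>M)"
      by (subst emeasure_density) (auto intro!: nn_integral_cong)
    also have "\<dots> = ennreal (\<integral>\<omega>. g \<omega> \<partial>M)"
      using int e g0 by (intro nn_integral_eq_integral) (auto cong: Bochner_Integration.integrable_cong simp: geq h0)
    also have "(\<integral>\<omega>. g \<omega> \<partial>M) = (\<integral>\<omega>. h \<omega> / e \<partial>M)"
      by (intro Bochner_Integration.integral_cong) (auto simp: geq)
    also have "\<dots> = 1" using e by (simp add: e_def)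
    finally have "prob_space (density M (\<lambda>\<omega>. ennreal (g \<omega>)))" by (intro prob_spaceI) simp
    hence P: "real_distribution P"
      unfolding P_def real_distribution_def real_distribution_axioms_def
      by (auto intro!: prob_space.prob_space_distr)
    have Pint: "(\<integral>t. F t \<partial>P) = (\<integral>\<omega>. h \<omega> *\<^sub>R F (x \<omega>) \<partial>M) / e"
      if [measurable]: "F \<in> borel_measurable borel" for F :: "real \<Rightarrow> complex"
      unfolding P_def gint[symmetric] using g0
      by (subst integral_distr, measurable) (subst integral_density, auto)
    have "char P = char D"
    proof
      fix a
      have "char P a = (\<integral>\<omega>. h \<omega> *\<^sub>R iexp (a * x \<omega>) \<partial>M) / e"
        unfolding char_def by (rule Pint) measurable
      thus "char P a = char D a" using e unfolding char by (simp add: e_def)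
    qed
    from Levy_uniqueness[OF P D this] have "P = D" .
    with Pint[OF f] e show ?thesis by (simp add: e_def)
  qed
qed

text \<open>The weights needed later are products of complex numbers, whereas a density has to be
  nonnegative. The conjugate of \<open>g\<close> factorizes in the same way as \<open>g\<close>,
  hence so do its real and imaginary parts, and adding 1 moves each of these into the interval from
  0 to 2.\<close>

lemma (in prob_space) weighted_char_determines_expectation_complex:
  fixes g :: "'a \<Rightarrow> complex" and x :: "'a \<Rightarrow> real" and f :: "real \<Rightarrow> complex"
  assumes g[measurable]: "g \<in> borel_measurable M" and x[measurable]: "x \<in> borel_measurable M"
    and gb: "\<And>\<omega>. \<omega> \<in> space M \<Longrightarrow> cmod (g \<omega>) \<le> 1"
    and D: "real_distribution D" and real: "\<And>a. cnj (char D (- a)) = char D a"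
    and charx: "\<And>a. (\<integral>\<omega>. iexp (a * x \<omega>) \<partial>M) = char D a"
    and char: "\<And>a. (\<integral>\<omega>. g \<omega> * iexp (a * x \<omega>) \<partial>M) = (\<integral>\<omega>. g \<omega> \<partial>M) * char D a"
    and f[measurable]: "f \<in> borel_measurable borel" and fb: "\<And>t. cmod (f t) \<le> 1"
  shows "(\<integral>\<omega>. g \<omega> * f (x \<omega>) \<partial>M) = (\<integral>\<omega>. g \<omega> \<partial>M) * (\<integral>t. f t \<partial>D)"
proof -
  have bnd: "integrable M F" if "F \<in> borel_measurable M" "\<And>\<omega>. \<omega> \<in> space M \<Longrightarrow> norm (F \<omega>) \<le> 1"
    for F :: "'a \<Rightarrow> 'b :: {banach, second_countable_topology}"
    using that by (intro integrable_const_bound[of _ 1]) auto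
  have reb: "\<bar>Re (g \<omega>)\<bar> \<le> 1" "\<bar>Im (g \<omega>)\<bar> \<le> 1" if "\<omega> \<in> space M" for \<omega>
    using gb[OF that] abs_Re_le_cmod[of "g \<omega>"] abs_Im_le_cmod[of "g \<omega>"] by linarith+
  have mult_b: "norm (u * v) \<le> 1" if "cmod u \<le> 1" "cmod v \<le> 1" for u v :: complex
    using mult_mono[OF that] by (simp add: norm_mult)
  have ig: "integrable M g" using gb by (intro bnd) auto
  have [measurable]: "(\<lambda>\<omega>. cnj (g \<omega>)) \<in> borel_measurable M"
    by (intro measurable_compose[OF g] borel_measurable_continuous_onI continuous_intros)
  have igF: "integrable M (\<lambda>\<omega>. g \<omega> * F (x \<omega>))" "integrable M (\<lambda>\<omega>. F (x \<omega>))"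
    "integrable M (\<lambda>\<omega>. cnj (g \<omega>) * F (x \<omega>))"
    "integrable M (\<lambda>\<omega>. Re (g \<omega>) *\<^sub>R F (x \<omega>))" "integrable M (\<lambda>\<omega>. Im (g \<omega>) *\<^sub>R F (x \<omega>))"
    if [measurable]: "F \<in> borel_measurable borel" and "\<And>t. cmod (F t) \<le> 1" for F :: "real \<Rightarrow> complex"
    using that gb reb
    by (auto intro!: bnd mult_b simp: scaleR_conv_of_real)
  have ire: "integrable M (\<lambda>\<omega>. Re (g \<omega>))" "integrable M (\<lambda>\<omega>. Im (g \<omega>))"
    using ig by (auto intro!: integrable_Re integrable_Im)
  define E where "E a t = iexp (a * t)" for a t :: real
  have E[measurable]: "E a \<in> borel_measurable borel" for a unfolding E_def by measurable
  have Eb: "cmod (E a t) \<le> 1" for a t by (simp add: E_def)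
  have cnj_char: "(\<integral>\<omega>. cnj (g \<omega>) * E a (x \<omega>) \<partial>M) = cnj (\<integral>\<omega>. g \<omega> \<partial>M) * char D a" for a
  proof -
    have "(\<integral>\<omega>. cnj (g \<omega>) * E a (x \<omega>) \<partial>M) = (\<integral>\<omega>. cnj (g \<omega> * iexp (- a * x \<omega>)) \<partial>M)"
      by (intro Bochner_Integration.integral_cong) (auto simp: E_def exp_cnj)
    also have "\<dots> = cnj (\<integral>\<omega>. g \<omega> * iexp (- a * x \<omega>) \<partial>M)" by (rule Bochner_Integration.integral_cnj)
    also have "\<dots> = cnj (\<integral>\<omega>. g \<omega> \<partial>M) * char D a" unfolding char by (simp add: real)
    finally show ?thesis .
  qed
  have re_split: "Re (g \<omega>) *\<^sub>R z = (g \<omega> * z + cnj (g \<omega>) * z) / 2"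
    and im_split: "Im (g \<omega>) *\<^sub>R z = (g \<omega> * z - cnj (g \<omega>) * z) / (2 * \<i>)" for \<omega> z
    by (auto simp: complex_eq_iff Re_divide Im_divide power2_eq_square field_simps)
  have re_char: "(\<integral>\<omega>. Re (g \<omega>) *\<^sub>R E a (x \<omega>) \<partial>M) = of_real (\<integral>\<omega>. Re (g \<omega>) \<partial>M) * char D a" for a
  proof -
    have "(\<integral>\<omega>. Re (g \<omega>) *\<^sub>R E a (x \<omega>) \<partial>M)
        = ((\<integral>\<omega>. g \<omega> \<partial>M) * char D a + cnj (\<integral>\<omega>. g \<omega> \<partial>M) * char D a) / 2"
      unfolding re_split using igF[OF E Eb, of a]
      by (simp add: cnj_char char[folded E_def])
    also have "\<dots> = of_real (Re (\<integral>\<omega>. g \<omega> \<partial>M)) * char D a"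
      by (simp add: complex_eq_iff)
    finally show ?thesis using ig by (simp add: integral_Re)
  qed
  have im_char: "(\<integral>\<omega>. Im (g \<omega>) *\<^sub>R E a (x \<omega>) \<partial>M) = of_real (\<integral>\<omega>. Im (g \<omega>) \<partial>M) * char D a" for a
  proof -
    have "(\<integral>\<omega>. Im (g \<omega>) *\<^sub>R E a (x \<omega>) \<partial>M)
        = ((\<integral>\<omega>. g \<omega> \<partial>M) * char D a - cnj (\<integral>\<omega>. g \<omega> \<partial>M) * char D a) / (2 * \<i>)"
      unfolding im_split using igF[OF E Eb, of a]
      by (simp add: cnj_char char[folded E_def])
    also have "\<dots> = of_real (Im (\<integral>\<omega>. g \<omega> \<partial>M)) * char D a"
      by (simp add: complex_eq_iff Re_divide Im_divide power2_eq_square field_simps)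
    finally show ?thesis using ig by (simp add: integral_Im)
  qed
  have one: "(\<integral>\<omega>. f (x \<omega>) \<partial>M) = (\<integral>t. f t \<partial>D)"
    using weighted_char_determines_expectation[of "\<lambda>_. 1" x 1 D f] charx D prob_space by simp
  have part: "(\<integral>\<omega>. u \<omega> *\<^sub>R f (x \<omega>) \<partial>M) = of_real (\<integral>\<omega>. u \<omega> \<partial>M) * (\<integral>t. f t \<partial>D)"
    if [measurable]: "u \<in> borel_measurable M" and ub: "\<And>\<omega>. \<omega> \<in> space M \<Longrightarrow> \<bar>u \<omega>\<bar> \<le> 1"
      and iu: "integrable M u"
      and iuF: "\<And>F :: real \<Rightarrow> complex. F \<in> borel_measurable borel \<Longrightarrow> (\<And>t. cmod (F t) \<le> 1) \<Longrightarrow> integrable M (\<lambda>\<omega>. u \<omega> *\<^sub>R F (x \<omega>))"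
      and uc: "\<And>a. (\<integral>\<omega>. u \<omega> *\<^sub>R E a (x \<omega>) \<partial>M) = of_real (\<integral>\<omega>. u \<omega> \<partial>M) * char D a"
    for u
  proof -
    \<comment> \<open>The constant weight 1 may be added because \<open>x\<close> itself has
      characteristic function \<open>char D\<close>.\<close>
    have "(\<integral>\<omega>. (1 + u \<omega>) *\<^sub>R E a (x \<omega>) \<partial>M) = expectation (\<lambda>\<omega>. 1 + u \<omega>) * char D a" for a
      using iuF[OF E Eb, of a] igF(2)[OF E Eb, of a] iu uc[of a] charx[of a, folded E_def] prob_space
      by (simp add: scaleR_add_left distrib_right)
    hence "(\<integral>\<omega>. (1 + u \<omega>) *\<^sub>R f (x \<omega>) \<partial>M) = expectation (\<lambda>\<omega>. 1 + u \<omega>) * (\<integral>t. f t \<partial>D)"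
    proof (intro weighted_char_determines_expectation[where b = 2] D)
      show "0 \<le> 1 + u \<omega>" "1 + u \<omega> \<le> 2" if "\<omega> \<in> space M" for \<omega>
        using ub[OF that] by linarith+
    qed (auto simp: E_def)
    thus ?thesis
      using iuF[OF f fb] igF(2)[OF f fb] iu prob_space one
      by (simp add: scaleR_add_left distrib_right)
  qed
  have "(\<integral>\<omega>. g \<omega> * f (x \<omega>) \<partial>M) = (\<integral>\<omega>. Re (g \<omega>) *\<^sub>R f (x \<omega>) + \<i> * (Im (g \<omega>) *\<^sub>R f (x \<omega>)) \<partial>M)"
    by (intro Bochner_Integration.integral_cong refl) (auto simp: complex_eq_iff)
  also have "\<dots> = (\<integral>\<omega>. Re (g \<omega>) *\<^sub>R f (x \<omega>) \<partial>M) + \<i> * (\<integral>\<omega>. Im (g \<omega>) *\<^sub>R f (x \<omega>) \<partial>M)"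
    using igF(4,5)[OF f fb] by (simp del: mult_scaleR_right)
  also have "\<dots> = (of_real (\<integral>\<omega>. Re (g \<omega>) \<partial>M) + \<i> * of_real (\<integral>\<omega>. Im (g \<omega>) \<partial>M)) * (\<integral>t. f t \<partial>D)"
    using part[of "\<lambda>\<omega>. Re (g \<omega>)"] part[of "\<lambda>\<omega>. Im (g \<omega>)"] reb ire igF(4,5) re_char im_char
    by (simp add: distrib_right)
  also have "of_real (\<integral>\<omega>. Re (g \<omega>) \<partial>M) + \<i> * of_real (\<integral>\<omega>. Im (g \<omega>) \<partial>M) = (\<integral>\<omega>. g \<omega> \<partial>M)"
    using ig by (simp add: complex_eq_iff)
  finally show ?thesis .
qed

text \<open>The coordinates are released from the exponential one at a time, each by uniqueness for
  univariate characteristic functions.\<close>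

lemma (in prob_space) std_normal_product_expectation:
  fixes x :: "nat \<Rightarrow> 'a \<Rightarrow> real" and f :: "nat \<Rightarrow> real \<Rightarrow> complex"
  assumes x[measurable]: "\<And>k. k < n \<Longrightarrow> x k \<in> borel_measurable M"
    and char: "\<And>a. (\<integral>\<omega>. iexp (\<Sum>k<n. a k * x k \<omega>) \<partial>M) = of_real (exp (- (\<Sum>k<n. (a k)\<^sup>2) / 2))"
    and f[measurable]: "\<And>k. f k \<in> borel_measurable borel" and fb: "\<And>k t. cmod (f k t) \<le> 1"
  shows "(\<integral>\<omega>. (\<Prod>k<n. f k (x k \<omega>)) \<partial>M) = (\<Prod>k<n. \<integral>t. f k t \<partial>std_normal_distribution)"
proof -
  let ?N = std_normal_distribution
  define \<phi> where "\<phi> a = complex_of_real (exp (- (a\<^sup>2) / 2))" for a :: real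
  have cN: "Characteristic_Functions.char ?N = \<phi>"
    by (auto simp: char_std_normal_distribution \<phi>_def)
  have char': "(\<integral>\<omega>. (\<Prod>k<n. iexp (a k * x k \<omega>)) \<partial>M) = (\<Prod>k<n. \<phi> (a k))" for a
  proof -
    have "(\<integral>\<omega>. (\<Prod>k<n. iexp (a k * x k \<omega>)) \<partial>M) = (\<integral>\<omega>. iexp (\<Sum>k<n. a k * x k \<omega>) \<partial>M)"
      by (intro Bochner_Integration.integral_cong refl) (simp add: sum_distrib_left exp_sum)
    also have "\<dots> = (\<Prod>k<n. \<phi> (a k))"
      unfolding char \<phi>_def
      by (simp add: sum_divide_distrib flip: exp_sum sum_negf of_real_prod)
    finally show ?thesis .
  qed
  have charx: "(\<integral>\<omega>. iexp (a * x j \<omega>) \<partial>M) = \<phi> a" if j: "j < n" for a j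
  proof -
    have "(\<Prod>k<n. iexp ((if k = j then a else 0) * x k \<omega>)) = iexp (a * x j \<omega>)" for \<omega>
      using j by (subst prod.remove[of _ j]) (auto intro!: prod.neutral)
    moreover have "(\<Prod>k<n. \<phi> (if k = j then a else 0)) = \<phi> a"
      using j by (subst prod.remove[of _ j]) (auto intro!: prod.neutral simp: \<phi>_def)
    ultimately show ?thesis using char'[of "\<lambda>k. if k = j then a else 0"] by simp
  qed
  have "(\<integral>\<omega>. (\<Prod>k<j. f k (x k \<omega>)) * (\<Prod>k=j..<n. iexp (a k * x k \<omega>)) \<partial>M)
      = (\<Prod>k<j. \<integral>t. f k t \<partial>?N) * (\<Prod>k=j..<n. \<phi> (a k))" if "j \<le> n" for j a
    using that
  proof (induction j arbitrary: a)
    case 0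
    thus ?case using char'[of a] by (simp add: lessThan_atLeast0)
  next
    case (Suc j)
    hence j: "j < n" by simp
    define g where "g \<omega> = (\<Prod>k<j. f k (x k \<omega>)) * (\<Prod>k=Suc j..<n. iexp (a k * x k \<omega>))" for \<omega>
    have [measurable]: "x j \<in> borel_measurable M" by (rule x[OF j])
    have g[measurable]: "g \<in> borel_measurable M"
    proof -
      have "(\<lambda>\<omega>. f k (x k \<omega>)) \<in> borel_measurable M" if "k < n" for k
        using x[OF that] by measurable
      moreover have "(\<lambda>\<omega>. iexp (a k * x k \<omega>)) \<in> borel_measurable M" if "k < n" for k
        using x[OF that] by measurable
      ultimately show ?thesis
        unfolding g_def using j by (intro borel_measurable_times borel_measurable_prod) auto
    qed
    have gb: "cmod (g \<omega>) \<le> 1" for \<omega>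
      unfolding g_def norm_mult prod_norm[symmetric] using fb
      by (intro mult_le_one prod_le_1 prod_nonneg) (auto intro!: prod_nonneg)
    have split: "(\<Prod>k=j..<n. iexp (b k * x k \<omega>)) = iexp (b j * x j \<omega>) * (\<Prod>k=Suc j..<n. iexp (b k * x k \<omega>))" for b \<omega>
      using j by (rule prod.atLeast_Suc_lessThan)
    \<comment> \<open>The induction hypothesis holds for all frequencies \<open>a\<close>. Varying
      only the one of coordinate \<open>j\<close> exhibits the dependence on \<open>b\<close> while
      \<open>g\<close> stays fixed, as the uniqueness lemma demands.\<close>
    have IH: "(\<integral>\<omega>. g \<omega> * iexp (b * x j \<omega>) \<partial>M)
        = (\<Prod>k<j. \<integral>t. f k t \<partial>?N) * (\<Prod>k=Suc j..<n. \<phi> (a k)) * \<phi> b" for b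
    proof -
      have "(\<integral>\<omega>. g \<omega> * iexp (b * x j \<omega>) \<partial>M)
          = (\<integral>\<omega>. (\<Prod>k<j. f k (x k \<omega>)) * (\<Prod>k=j..<n. iexp ((a(j := b)) k * x k \<omega>)) \<partial>M)"
        unfolding split g_def by (intro Bochner_Integration.integral_cong refl) (simp add: mult_ac)
      also have "\<dots> = (\<Prod>k<j. \<integral>t. f k t \<partial>?N) * (\<Prod>k=j..<n. \<phi> ((a(j := b)) k))"
        using Suc by simp
      also have "(\<Prod>k=j..<n. \<phi> ((a(j := b)) k)) = \<phi> b * (\<Prod>k=Suc j..<n. \<phi> (a k))"
        using j by (simp add: prod.atLeast_Suc_lessThan)
      finally show ?thesis by (simp add: mult_ac)
    qed
    have g0: "(\<integral>\<omega>. g \<omega> \<partial>M) = (\<Prod>k<j. \<integral>t. f k t \<partial>?N) * (\<Prod>k=Suc j..<n. \<phi> (a k))"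
      using IH[of 0] by (simp add: \<phi>_def)
    have "(\<integral>\<omega>. g \<omega> * f j (x j \<omega>) \<partial>M) = (\<integral>\<omega>. g \<omega> \<partial>M) * (\<integral>t. f j t \<partial>?N)"
    proof (rule weighted_char_determines_expectation_complex[OF g _ _ real_dist_normal_dist])
      show "x j \<in> borel_measurable M" by (rule x[OF j])
      show "cmod (g \<omega>) \<le> 1" for \<omega> by (rule gb)
      show "cnj (Characteristic_Functions.char ?N (- b)) = Characteristic_Functions.char ?N b" for b
        by (simp add: cN \<phi>_def)
      show "(\<integral>\<omega>. iexp (b * x j \<omega>) \<partial>M) = Characteristic_Functions.char ?N b" for b
        unfolding cN by (rule charx[OF j])
      show "(\<integral>\<omega>. g \<omega> * iexp (b * x j \<omega>) \<partial>M) = (\<integral>\<omega>. g \<omega> \<partial>M) * Characteristic_Functions.char ?N b" for b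
        unfolding cN IH g0 ..
      show "f j \<in> borel_measurable borel" "cmod (f j t) \<le> 1" for t by (rule f fb)+
    qed
    thus ?case unfolding g0 by (simp add: g_def mult_ac)
  qed
  from this[of n] show ?thesis by simp
qed

lemma abs_half_square_minus_one_le: "\<bar>(x\<^sup>2 - 1) / 2\<bar> \<le> (x\<^sup>2 + 1 :: real)"
  by (simp add: abs_le_iff)

text \<open>For standard normal \<open>x\<close>, the variables \<open>x\<close> and
  \<open>(x^2 - 1) / 2\<close> are uncorrelated with variances 1 and 1/2, so the comparison is with
  the centered normal law of the same variance \<open>s^2 + \<theta>^2 / 2\<close>. Each term of the
  error has one factor \<open>|\<theta>|\<close> more than a square of \<open>s\<close> or of
  \<open>\<theta>\<close>; the squares are summable by unit variance, and the extra factor makes the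
  sum small. As a predicate on \<open>C\<close>, the bound lets one constant serve all
  \<open>m\<close>.\<close>

definition quadratic_char_constant :: "real \<Rightarrow> bool" where
  "quadratic_char_constant C \<longleftrightarrow> 0 \<le> C \<and> (\<forall>s \<theta>. \<bar>\<theta>\<bar> \<le> 1 \<longrightarrow>
      cmod ((\<integral>x. iexp (s * x + \<theta> * ((x\<^sup>2 - 1) / 2)) \<partial>std_normal_distribution)
        - of_real (exp (- (s\<^sup>2) / 2 - \<theta>\<^sup>2 / 4))) \<le> C * (\<bar>\<theta>\<bar> * s\<^sup>2 + \<bar>\<theta>\<bar> ^ 3))"

text \<open>Second-order expansion in \<open>\<theta>\<close> only: the linear coefficient \<open>s\<close> need not be small, since the
  part \<open>exp (i s x)\<close> is integrated exactly.\<close>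

lemma std_normal_quadratic_char_bound:
  obtains C where "quadratic_char_constant C"
proof
  let ?N = std_normal_distribution
  interpret real_distribution ?N by (rule real_dist_normal_dist)
  define w where "w x = (x\<^sup>2 - 1) / 2" for x :: real
  \<comment> \<open>Dominates the remainder of the expansion; written in monomials so that
    integrability follows from the moments.\<close>
  define G where "G x = 3 * x ^ 6 + 9 * x ^ 4 + 9 * x\<^sup>2 + (3 :: real)" for x
  have G3: "G x = 3 * (x\<^sup>2 + 1) ^ 3" for x
    by (simp add: G_def power2_eq_square power3_eq_cube power4_eq_xxxx algebra_simps eval_nat_numeral)
  have mom: "integrable ?N (\<lambda>x. x ^ k)" for k by (rule integrable_std_normal_distribution_moment)
  have mom1: "integrable ?N (\<lambda>x. x)" using mom[of 1] by simp
  have iG: "integrable ?N G"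
    unfolding G_def by (intro Bochner_Integration.integrable_add integrable_mult_right mom) auto
  have G0: "0 \<le> G x" for x by (simp add: G3)
  define A where "A = (\<integral>x. G x \<partial>?N)"
  have A0: "0 \<le> A" unfolding A_def by (intro integral_nonneg_AE) (simp add: G0)
  have E2: "(\<integral>x. x\<^sup>2 \<partial>?N) = 1" and E4: "(\<integral>x. x ^ 4 \<partial>?N) = 3"
    using std_normal_distribution_even_moments(1)[of 1] std_normal_distribution_even_moments(1)[of 2]
    by (simp_all add: fact_numeral)
  have E1: "(\<integral>x. x \<partial>?N) = 0" and E3: "(\<integral>x. x ^ 3 \<partial>?N) = 0" and E5: "(\<integral>x. x ^ 5 \<partial>?N) = 0"
    using integral_std_normal_distribution_moment_odd[of 1]
      integral_std_normal_distribution_moment_odd[of 3] integral_std_normal_distribution_moment_odd[of 5]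
    by simp_all
  \<comment> \<open>The expansion needs only polynomials of degree at most five. The odd moments
    vanish, and the second and fourth are 1 and 3.\<close>
  define P where "P a b c d e g x = a * x ^ 5 + b * x ^ 4 + c * x ^ 3 + d * x\<^sup>2 + e * x + (g :: real)"
    for a b c d e g x
  have iP: "integrable ?N (P a b c d e g)" for a b c d e g
    unfolding P_def
    by (intro Bochner_Integration.integrable_add integrable_mult_right mom mom1) auto
  have EP: "(\<integral>x. P a b c d e g x \<partial>?N) = 3 * b + d + g" for a b c d e g
    unfolding P_def using mom mom1 prob_space by (simp add: E1 E2 E3 E4 E5)
  have w: "w = P 0 0 0 (1 / 2) 0 (- 1 / 2)" "(\<lambda>x. (w x)\<^sup>2) = P 0 (1 / 4) 0 (- 1 / 2) 0 (1 / 4)"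
    "(\<lambda>x. x * w x) = P 0 0 (1 / 2) 0 (- 1 / 2) 0" "(\<lambda>x. x * (w x)\<^sup>2) = P (1 / 4) 0 (- 1 / 2) 0 (1 / 4) 0"
    by (auto simp: w_def P_def power2_eq_square power3_eq_cube field_simps eval_nat_numeral)
  have iw: "integrable ?N w" "integrable ?N (\<lambda>x. (w x)\<^sup>2)" "integrable ?N (\<lambda>x. x * w x)" "integrable ?N (\<lambda>x. x * (w x)\<^sup>2)"
    unfolding w(2,3,4) by (simp_all only: w(1) iP)
  have Ew: "integral\<^sup>L ?N w = 0" "(\<integral>x. (w x)\<^sup>2 \<partial>?N) = 1 / 2" "(\<integral>x. x * w x \<partial>?N) = 0" "(\<integral>x. x * (w x)\<^sup>2 \<partial>?N) = 0"
    unfolding w(2,3,4) unfolding w(1) by (simp_all add: EP)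
  have "cmod ((\<integral>x. iexp (s * x + \<theta> * ((x\<^sup>2 - 1) / 2)) \<partial>?N)
      - of_real (exp (- (s\<^sup>2) / 2 - \<theta>\<^sup>2 / 4))) \<le> (A + 1) * (\<bar>\<theta>\<bar> * s\<^sup>2 + \<bar>\<theta>\<bar> ^ 3)"
    if \<theta>: "\<bar>\<theta>\<bar> \<le> 1" for s \<theta> :: real
  proof -
    \<comment> \<open>In the second-order expansion of \<open>exp (i * \<theta> * w)\<close>, only
      the constant term keeps the full factor \<open>exp (i * s * x)\<close>; in the other two it is
      replaced by \<open>1 + i * s * x\<close>, with an error of order \<open>s^2\<close>. Thus the
      mean of \<open>Q\<close> consists of one exact characteristic function and polynomial
      moments.\<close>
    define Q where "Q x = iexp (s * x) + \<i> * \<theta> * (w x + \<i> * s * (x * w x))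
        - of_real (\<theta>\<^sup>2 / 2) * ((w x)\<^sup>2 + \<i> * s * (x * (w x)\<^sup>2))" for x
    have ie: "integrable ?N (\<lambda>x. iexp (f x))" if [measurable]: "f \<in> borel_measurable borel" for f
      by (rule integrable_const_bound[of _ 1]) auto
    have iwc: "integrable ?N (\<lambda>x. complex_of_real (w x))" "integrable ?N (\<lambda>x. (complex_of_real (w x))\<^sup>2)"
        "integrable ?N (\<lambda>x. complex_of_real x * complex_of_real (w x))"
        "integrable ?N (\<lambda>x. complex_of_real x * (complex_of_real (w x))\<^sup>2)"
      using iw[THEN integrable_of_real[where 'a = complex]] by simp_all
    have Ewc: "(\<integral>x. complex_of_real (w x) \<partial>?N) = 0" "(\<integral>x. (complex_of_real (w x))\<^sup>2 \<partial>?N) = 1 / 2"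
        "(\<integral>x. complex_of_real x * complex_of_real (w x) \<partial>?N) = 0"
        "(\<integral>x. complex_of_real x * (complex_of_real (w x))\<^sup>2 \<partial>?N) = 0"
      using Ew[THEN arg_cong[where f = complex_of_real]] by (simp_all flip: integral_complex_of_real)
    have ies: "integrable ?N (\<lambda>x. exp (\<i> * (complex_of_real s * complex_of_real x)))"
      using ie[of "\<lambda>x. s * x"] by simp
    have iQ: "integrable ?N Q"
      unfolding Q_def using ies iwc
      by (intro Bochner_Integration.integrable_diff Bochner_Integration.integrable_add integrable_mult_right) auto
    have "(\<integral>x. Q x \<partial>?N) = char ?N s - of_real (\<theta>\<^sup>2 / 4)"
      unfolding Q_def char_def using ies iwc by (simp add: Ew Ewc)
    hence EQ: "(\<integral>x. Q x \<partial>?N) = of_real (exp (- (s\<^sup>2) / 2) - \<theta>\<^sup>2 / 4)"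
      by (simp add: char_std_normal_distribution)
    have pt: "cmod (iexp (s * x + \<theta> * w x) - Q x) \<le> (\<bar>\<theta>\<bar> * s\<^sup>2 + \<bar>\<theta>\<bar> ^ 3) * G x" for x
    proof -
      define y where "y = \<theta> * w x"
      define e where "e = iexp (s * x)"
      define a where "a = iexp y - (1 + \<i> * y - of_real (y\<^sup>2 / 2))"
      define b where "b = e - (1 + \<i> * (s * x))"
      have a: "cmod a \<le> \<bar>y\<bar> ^ 3 / 6"
        using iexp_approx1[of y 2] by (simp add: a_def eval_nat_numeral power_mult_distrib)
      have b: "cmod b \<le> (s * x)\<^sup>2 / 2"
        using iexp_approx1[of "s * x" 1] by (simp add: b_def e_def eval_nat_numeral power2_eq_square abs_mult)
      have "iexp (s * x + y) - Q x = e * a + \<i> * y * b - of_real (y\<^sup>2 / 2) * b"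
        by (simp add: Q_def a_def b_def e_def y_def exp_add distrib_left power2_eq_square algebra_simps)
      hence "cmod (iexp (s * x + y) - Q x) \<le> cmod (e * a) + cmod (\<i> * y * b) + cmod (of_real (y\<^sup>2 / 2) * b)"
        by (metis add_right_mono norm_triangle_ineq norm_triangle_ineq4 order_trans)
      also have "\<dots> = cmod a + (\<bar>y\<bar> + y\<^sup>2 / 2) * cmod b"
        unfolding norm_mult e_def norm_of_real by (simp add: algebra_simps)
      also have "\<dots> \<le> \<bar>y\<bar> ^ 3 / 6 + (\<bar>y\<bar> + y\<^sup>2 / 2) * ((s * x)\<^sup>2 / 2)"
        by (intro add_mono a mult_left_mono b) auto
      also have "\<dots> \<le> (\<bar>\<theta>\<bar> * s\<^sup>2 + \<bar>\<theta>\<bar> ^ 3) * G x"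
      proof -
        \<comment> \<open>Since \<open>x^2\<close> and \<open>|w x|\<close> are at most
          \<open>p\<close>, and \<open>p\<close> is at least 1, every term is bounded by the same
          power \<open>p^3\<close>; hence the degree of \<open>G\<close>.\<close>
        define p where "p = x\<^sup>2 + 1"
        have p: "1 \<le> p" "x\<^sup>2 \<le> p" "\<bar>w x\<bar> \<le> p"
          using abs_half_square_minus_one_le[of x] by (auto simp: p_def w_def)
        have pp: "p \<le> p\<^sup>2" "p\<^sup>2 \<le> p ^ 3" using p by (auto simp: power2_eq_square power3_eq_cube)
        have y: "\<bar>y\<bar> \<le> \<bar>\<theta>\<bar> * p" unfolding y_def abs_mult using p by (intro mult_left_mono) auto
        have "\<bar>y\<bar> ^ 3 \<le> (\<bar>\<theta>\<bar> * p) ^ 3" by (intro power_mono y) auto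
        hence 1: "\<bar>y\<bar> ^ 3 / 6 \<le> \<bar>\<theta>\<bar> ^ 3 * p ^ 3" 
        proof -
          have "0 \<le> \<bar>\<theta>\<bar> ^ 3 * p ^ 3" using p by simp
          with \<open>\<bar>y\<bar> ^ 3 \<le> (\<bar>\<theta>\<bar> * p) ^ 3\<close> show ?thesis unfolding power_mult_distrib by linarith
        qed
        have "y\<^sup>2 \<le> (\<bar>\<theta>\<bar> * p)\<^sup>2" using power_mono[OF y, of 2] by simp
        also have "\<dots> = \<bar>\<theta>\<bar> * (\<bar>\<theta>\<bar> * p\<^sup>2)" by (simp add: power2_eq_square)
        also have "\<dots> \<le> \<bar>\<theta>\<bar> * (1 * p\<^sup>2)" using \<theta> by (intro mult_left_mono mult_right_mono) auto
        finally have "\<bar>y\<bar> + y\<^sup>2 / 2 \<le> 2 * (\<bar>\<theta>\<bar> * p\<^sup>2)"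
          using y mult_left_mono[OF pp(1), of "\<bar>\<theta>\<bar>"] by simp
        hence "(\<bar>y\<bar> + y\<^sup>2 / 2) * ((s * x)\<^sup>2 / 2) \<le> 2 * (\<bar>\<theta>\<bar> * p\<^sup>2) * (s\<^sup>2 * p / 2)"
          unfolding power_mult_distrib using p by (intro mult_mono divide_right_mono mult_left_mono) auto
        also have "\<dots> = \<bar>\<theta>\<bar> * s\<^sup>2 * p ^ 3" by (simp add: power2_eq_square power3_eq_cube)
        finally have "\<bar>y\<bar> ^ 3 / 6 + (\<bar>y\<bar> + y\<^sup>2 / 2) * ((s * x)\<^sup>2 / 2) \<le> (\<bar>\<theta>\<bar> * s\<^sup>2 + \<bar>\<theta>\<bar> ^ 3) * p ^ 3"
          using 1 unfolding distrib_right by linarith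
        also have "\<dots> \<le> (\<bar>\<theta>\<bar> * s\<^sup>2 + \<bar>\<theta>\<bar> ^ 3) * G x"
          unfolding G3 p_def[symmetric] using p by (intro mult_left_mono) auto
        finally show ?thesis .
      qed
      finally show ?thesis by (simp add: y_def)
    qed
    have [measurable]: "w \<in> borel_measurable borel" unfolding w_def by measurable
    have ief: "integrable ?N (\<lambda>x. iexp (s * x + \<theta> * w x))" by (rule ie) measurable
    have "cmod ((\<integral>x. iexp (s * x + \<theta> * w x) \<partial>?N) - (\<integral>x. Q x \<partial>?N))
        = cmod (\<integral>x. iexp (s * x + \<theta> * w x) - Q x \<partial>?N)"
      using Bochner_Integration.integral_diff[OF ief iQ] by simp
    also have "\<dots> \<le> (\<integral>x. (\<bar>\<theta>\<bar> * s\<^sup>2 + \<bar>\<theta>\<bar> ^ 3) * G x \<partial>?N)"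
      using ief iQ iG pt
      by (intro order_trans[OF integral_norm_bound] integral_mono) auto
    finally have 1: "cmod ((\<integral>x. iexp (s * x + \<theta> * w x) \<partial>?N) - of_real (exp (- (s\<^sup>2) / 2) - \<theta>\<^sup>2 / 4))
        \<le> (\<bar>\<theta>\<bar> * s\<^sup>2 + \<bar>\<theta>\<bar> ^ 3) * A"
      unfolding EQ A_def by simp
    \<comment> \<open>By \<open>EQ\<close> the mean of \<open>Q\<close> is
      \<open>exp (- a) - b\<close> instead of \<open>exp (- a - b)\<close>. The two differ by at
      most \<open>a * b + b^2\<close>, which fits into the same error and accounts for the 1 in the
      constant \<open>A + 1\<close>.\<close>
    define a b where "a = s\<^sup>2 / 2" and "b = \<theta>\<^sup>2 / 4"
    have ab: "0 \<le> a" "0 \<le> b" by (auto simp: a_def b_def)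
    have "b \<le> 1" using \<theta> by (simp add: b_def abs_square_le_1[symmetric])
    have ea: "0 \<le> 1 - exp (- a)" "1 - exp (- a) \<le> a" and eb: "0 \<le> 1 - exp (- b)" "1 - exp (- b) \<le> b"
      using exp_ge_add_one_self[of "- a"] exp_ge_add_one_self[of "- b"] ab by auto
    have eb2: "b - (1 - exp (- b)) \<le> b\<^sup>2"
    proof -
      have "exp (- b) * (1 + b) \<le> exp (- b) * exp b" using exp_ge_add_one_self[of b] by (intro mult_left_mono) auto
      hence "exp (- b) \<le> 1 / (1 + b)" using ab by (simp add: field_simps flip: exp_add)
      also have "1 / (1 + b) \<le> 1 - b + b\<^sup>2"
        using ab by (simp add: field_simps power2_eq_square)
      finally show ?thesis by simp
    qed
    have "exp (- a) - b - exp (- a - b) = - ((1 - exp (- a)) * (1 - exp (- b))) - (b - (1 - exp (- b)))"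
      by (simp add: algebra_simps exp_diff exp_minus divide_inverse flip: exp_add)
    moreover have "(1 - exp (- a)) * (1 - exp (- b)) \<le> a * b" "0 \<le> (1 - exp (- a)) * (1 - exp (- b))"
      using ea eb ab by (auto intro!: mult_mono)
    ultimately have "\<bar>exp (- a) - b - exp (- a - b)\<bar> \<le> a * b + b\<^sup>2"
      using eb eb2 by (simp add: abs_le_iff)
    also have "a * b + b\<^sup>2 \<le> \<bar>\<theta>\<bar> * s\<^sup>2 + \<bar>\<theta>\<bar> ^ 3"
    proof (rule add_mono)
      have sq: "\<theta>\<^sup>2 \<le> \<bar>\<theta>\<bar>" using \<theta> mult_left_mono[OF \<theta>, of "\<bar>\<theta>\<bar>"] by (simp add: power2_eq_square)
      have "\<theta>\<^sup>2 * s\<^sup>2 \<le> \<bar>\<theta>\<bar> * s\<^sup>2" using sq by (intro mult_right_mono) auto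
      moreover have "a * b = \<theta>\<^sup>2 * s\<^sup>2 / 8" "0 \<le> \<theta>\<^sup>2 * s\<^sup>2" by (simp_all add: a_def b_def)
      ultimately show "a * b \<le> \<bar>\<theta>\<bar> * s\<^sup>2" by linarith
      have "b\<^sup>2 = \<theta>\<^sup>2 * \<theta>\<^sup>2 / 16" "0 \<le> \<theta>\<^sup>2 * \<theta>\<^sup>2" by (simp_all add: b_def power2_eq_square)
      hence "b\<^sup>2 \<le> \<theta>\<^sup>2 * \<theta>\<^sup>2" by linarith
      also have "\<dots> \<le> \<theta>\<^sup>2 * \<bar>\<theta>\<bar>" using sq by (intro mult_left_mono) auto
      finally show "b\<^sup>2 \<le> \<bar>\<theta>\<bar> ^ 3" by (simp add: power2_eq_square power3_eq_cube)
    qed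
    finally have 2: "cmod (of_real (exp (- (s\<^sup>2) / 2) - \<theta>\<^sup>2 / 4) - of_real (exp (- (s\<^sup>2) / 2 - \<theta>\<^sup>2 / 4)))
        \<le> \<bar>\<theta>\<bar> * s\<^sup>2 + \<bar>\<theta>\<bar> ^ 3"
      unfolding of_real_diff[symmetric] norm_of_real by (simp add: a_def b_def)
    show ?thesis
      using norm_diff_triangle_le[OF 1 2] by (simp add: w_def algebra_simps)
  qed
  thus "quadratic_char_constant (A + 1)" using A0 by (auto simp: quadratic_char_constant_def)
qed

text \<open>All factors lie in the closed unit disc, so two products differ by at most the sum of
  the differences of their factors. With \<open>s = t * l k\<close> and
  \<open>\<theta> = t * d k\<close>, the error of one factor is at most \<open>C * |t|^3 * e\<close>
  times \<open>(l k)^2 + (d k)^2\<close>, and by unit variance these weights add up to at most 2.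
  The number of factors does not enter the bound.\<close>

lemma (in prob_space) quadratic_form_char_bound:
  fixes x :: "nat \<Rightarrow> 'a \<Rightarrow> real" and l d :: "nat \<Rightarrow> real"
  assumes C: "quadratic_char_constant C"
    and x[measurable]: "\<And>k. k < n \<Longrightarrow> x k \<in> borel_measurable M"
    and char: "\<And>a. (\<integral>\<omega>. iexp (\<Sum>k<n. a k * x k \<omega>) \<partial>M) = of_real (exp (- (\<Sum>k<n. (a k)\<^sup>2) / 2))"
    and unit: "(\<Sum>k<n. (l k)\<^sup>2) + (\<Sum>k<n. (d k)\<^sup>2) / 2 = 1"
    and d: "\<And>k. k < n \<Longrightarrow> \<bar>d k\<bar> \<le> e" and e: "0 \<le> e" "\<bar>t\<bar> * e \<le> 1"
  shows "cmod ((\<integral>\<omega>. iexp (t * (\<Sum>k<n. l k * x k \<omega> + d k * (((x k \<omega>)\<^sup>2 - 1) / 2))) \<partial>M) - exp (- (t\<^sup>2) / 2))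
    \<le> 2 * C * \<bar>t\<bar> ^ 3 * e"
proof -
  let ?N = std_normal_distribution
  note C = C[unfolded quadratic_char_constant_def, THEN conjunct1]
    C[unfolded quadratic_char_constant_def, THEN conjunct2, rule_format]
  interpret N: real_distribution ?N by (rule real_dist_normal_dist)
  define f where "f k y = iexp ((t * l k) * y + (t * d k) * ((y\<^sup>2 - 1) / 2))" for k and y :: real
  have f[measurable]: "f k \<in> borel_measurable borel" for k unfolding f_def by measurable
  have fb: "cmod (f k y) \<le> 1" for k y by (simp add: f_def)
  have "(\<integral>\<omega>. iexp (t * (\<Sum>k<n. l k * x k \<omega> + d k * (((x k \<omega>)\<^sup>2 - 1) / 2))) \<partial>M) = (\<integral>\<omega>. (\<Prod>k<n. f k (x k \<omega>)) \<partial>M)"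
    unfolding f_def exp_sum[symmetric, OF finite_lessThan]
    by (intro Bochner_Integration.integral_cong refl arg_cong[where f = exp])
      (simp add: sum_distrib_left distrib_left mult_ac)
  also have "\<dots> = (\<Prod>k<n. \<integral>y. f k y \<partial>?N)"
    by (rule std_normal_product_expectation[OF x char f fb])
  finally have lhs: "(\<integral>\<omega>. iexp (t * (\<Sum>k<n. l k * x k \<omega> + d k * (((x k \<omega>)\<^sup>2 - 1) / 2))) \<partial>M) = (\<Prod>k<n. \<integral>y. f k y \<partial>?N)" .
  define z where "z k = complex_of_real (exp (- ((t * l k)\<^sup>2) / 2 - (t * d k)\<^sup>2 / 4))" for k
  have "(\<Prod>k<n. z k) = of_real (exp (\<Sum>k<n. - ((t * l k)\<^sup>2) / 2 - (t * d k)\<^sup>2 / 4))"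
    by (simp add: z_def exp_sum)
  also have "(\<Sum>k<n. - ((t * l k)\<^sup>2) / 2 - (t * d k)\<^sup>2 / 4)
      = - (t\<^sup>2 / 2) * ((\<Sum>k<n. (l k)\<^sup>2) + (\<Sum>k<n. (d k)\<^sup>2) / 2)"
    by (simp add: power_mult_distrib sum_subtractf sum_negf sum_distrib_left sum_divide_distrib algebra_simps)
  finally have z: "exp (- (t\<^sup>2) / 2) = (\<Prod>k<n. z k)" unfolding unit by simp
  have "cmod ((\<Prod>k<n. \<integral>y. f k y \<partial>?N) - (\<Prod>k<n. z k)) \<le> (\<Sum>k<n. cmod ((\<integral>y. f k y \<partial>?N) - z k))"
  proof (rule norm_prod_diff)
    show "cmod (\<integral>y. f k y \<partial>?N) \<le> 1" for k
    proof -
      have "cmod (\<integral>y. f k y \<partial>?N) \<le> (\<integral>y. cmod (f k y) \<partial>?N)" by (rule integral_norm_bound)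
      also have "\<dots> = 1" using N.prob_space by (simp add: f_def)
      finally show ?thesis .
    qed
    show "cmod (z k) \<le> 1" for k
    proof -
      have "- ((t * l k)\<^sup>2) / 2 - (t * d k)\<^sup>2 / 4 \<le> 0"
        using zero_le_power2[of "t * l k"] zero_le_power2[of "t * d k"] by linarith
      thus ?thesis unfolding z_def norm_of_real by (simp only: abs_exp_cancel exp_le_one_iff)
    qed
  qed
  also have "\<dots> \<le> (\<Sum>k<n. C * (\<bar>t\<bar> ^ 3 * e * ((l k)\<^sup>2 + (d k)\<^sup>2)))"
  proof (rule sum_mono)
    fix k assume "k \<in> {..<n}"
    hence dk: "\<bar>d k\<bar> \<le> e" using d by simp
    have td: "\<bar>t * d k\<bar> \<le> \<bar>t\<bar> * e" unfolding abs_mult by (intro mult_left_mono dk) auto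
    have "cmod ((\<integral>y. f k y \<partial>?N) - z k) \<le> C * (\<bar>t * d k\<bar> * (t * l k)\<^sup>2 + \<bar>t * d k\<bar> ^ 3)"
      unfolding f_def z_def by (rule C(2)) (use td e(2) in linarith)
    also have "\<bar>t * d k\<bar> ^ 3 = \<bar>t * d k\<bar> * (t * d k)\<^sup>2" by (simp add: power3_eq_cube power2_eq_square)
    also have "\<bar>t * d k\<bar> * (t * l k)\<^sup>2 + \<bar>t * d k\<bar> * (t * d k)\<^sup>2 = \<bar>t * d k\<bar> * (t\<^sup>2 * ((l k)\<^sup>2 + (d k)\<^sup>2))"
      by (simp add: power_mult_distrib algebra_simps)
    also have "\<dots> \<le> \<bar>t\<bar> * e * (t\<^sup>2 * ((l k)\<^sup>2 + (d k)\<^sup>2))"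
      by (intro mult_right_mono td) auto
    also have "\<dots> = \<bar>t\<bar> ^ 3 * e * ((l k)\<^sup>2 + (d k)\<^sup>2)"
      by (simp add: power3_eq_cube power2_eq_square algebra_simps)
    finally show "cmod ((\<integral>y. f k y \<partial>?N) - z k) \<le> C * (\<bar>t\<bar> ^ 3 * e * ((l k)\<^sup>2 + (d k)\<^sup>2))"
      using C(1) by (simp add: mult_left_mono)
  qed
  also have "\<dots> = C * \<bar>t\<bar> ^ 3 * e * ((\<Sum>k<n. (l k)\<^sup>2) + (\<Sum>k<n. (d k)\<^sup>2))"
    by (simp add: sum.distrib mult.assoc flip: sum_distrib_left)
  also have "\<dots> \<le> C * \<bar>t\<bar> ^ 3 * e * 2"
  proof (rule mult_left_mono)
    have "0 \<le> (\<Sum>k<n. (l k)\<^sup>2)" by (rule sum_nonneg) auto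
    thus "(\<Sum>k<n. (l k)\<^sup>2) + (\<Sum>k<n. (d k)\<^sup>2) \<le> 2" using unit by linarith
  qed (use C(1) e in auto)
  finally show ?thesis unfolding lhs z by (simp add: mult_ac)
qed

subsection \<open>Block structure of the cluster model\<close>

lemma stack_vec_0: "stack_vec 0 y = vNil"
  by (simp add: stack_vec_def)

lemma map_upt_Suc_Cons: "map f [0..<Suc m] = f 0 # map (\<lambda>i. f (Suc i)) [0..<m]"
  using map_upt_Suc[of f m] by simp

lemma vec_of_list_append: "vec_of_list (xs @ ys) = vec_of_list xs @\<^sub>v vec_of_list ys"
  by (rule eq_vecI) (auto simp: vec_of_list_index nth_append)

text \<open>Peeling off the front block follows the recursion of \<open>diag_block_mat\<close>; this
  is why the inductions on blocks shift the index by \<open>Suc\<close>.\<close>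

lemma stack_vec_Suc: "stack_vec (Suc m) y = y 0 @\<^sub>v stack_vec m (\<lambda>i. y (Suc i))"
  unfolding stack_vec_def map_upt_Suc_Cons by (simp add: vec_of_list_append vec_list)

lemma dim_stack_vec: "dim_vec (stack_vec m y) = (\<Sum>i<m. dim_vec (y i))"
  by (induction m arbitrary: y) (simp_all add: stack_vec_0 stack_vec_Suc sum.lessThan_Suc_shift del: sum.lessThan_Suc)

lemma stack_vec_carrier:
  assumes "\<And>i. i < m \<Longrightarrow> y i \<in> carrier_vec (d i)"
  shows "stack_vec m y \<in> carrier_vec (\<Sum>i<m. d i)"
  using assms by (intro carrier_vecI) (auto simp: dim_stack_vec dest!: carrier_vecD intro!: sum.cong)

lemma stack_vec_cong: "(\<And>i. i < m \<Longrightarrow> x i = y i) \<Longrightarrow> stack_vec m x = stack_vec m y"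
  by (auto simp: stack_vec_def intro!: arg_cong[where f = vec_of_list] arg_cong[where f = concat])

lemma stack_vec_scalar_prod:
  assumes "\<And>i. i < m \<Longrightarrow> dim_vec (x i) = dim_vec (y i)"
  shows "stack_vec m x \<bullet> stack_vec m y = (\<Sum>i<m. x i \<bullet> (y i :: real vec))"
  using assms
proof (induction m arbitrary: x y)
  case 0 thus ?case by (simp add: stack_vec_0 scalar_prod_def)
next
  case (Suc m)
  have "(x 0 @\<^sub>v stack_vec m (\<lambda>i. x (Suc i))) \<bullet> (y 0 @\<^sub>v stack_vec m (\<lambda>i. y (Suc i)))
      = x 0 \<bullet> y 0 + stack_vec m (\<lambda>i. x (Suc i)) \<bullet> stack_vec m (\<lambda>i. y (Suc i))"
    using Suc.prems by (intro scalar_prod_append) (auto intro!: carrier_vecI simp: dim_stack_vec)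
  also have "stack_vec m (\<lambda>i. x (Suc i)) \<bullet> stack_vec m (\<lambda>i. y (Suc i)) = (\<Sum>i<m. x (Suc i) \<bullet> y (Suc i))"
    using Suc.prems by (intro Suc.IH) auto
  finally show ?case by (simp add: stack_vec_Suc sum.lessThan_Suc_shift del: sum.lessThan_Suc)
qed

lemma stack_vec_add:
  assumes "\<And>i. i < m \<Longrightarrow> dim_vec (x i) = dim_vec (y i)"
  shows "stack_vec m x + stack_vec m y = stack_vec m (\<lambda>i. x i + y i)"
  using assms
proof (induction m arbitrary: x y)
  case 0 thus ?case by (auto simp: stack_vec_0)
next
  case (Suc m)
  have "stack_vec m (\<lambda>i. x (Suc i)) + stack_vec m (\<lambda>i. y (Suc i)) = stack_vec m (\<lambda>i. x (Suc i) + y (Suc i))"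
    using Suc.prems by (intro Suc.IH) auto
  moreover have "(x 0 @\<^sub>v stack_vec m (\<lambda>i. x (Suc i))) + (y 0 @\<^sub>v stack_vec m (\<lambda>i. y (Suc i)))
      = (x 0 + y 0) @\<^sub>v (stack_vec m (\<lambda>i. x (Suc i)) + stack_vec m (\<lambda>i. y (Suc i)))"
    using Suc.prems[of 0] by (intro eq_vecI) (auto simp: dim_stack_vec Suc.prems)
  ultimately show ?case by (simp add: stack_vec_Suc)
qed

lemma stack_vec_smult: "k \<cdot>\<^sub>v stack_vec m x = stack_vec m (\<lambda>i. k \<cdot>\<^sub>v x i)"
proof (induction m arbitrary: x)
  case 0 thus ?case by (auto simp: stack_vec_0)
next
  case (Suc m)
  have "k \<cdot>\<^sub>v (x 0 @\<^sub>v stack_vec m (\<lambda>i. x (Suc i))) = k \<cdot>\<^sub>v x 0 @\<^sub>v k \<cdot>\<^sub>v stack_vec m (\<lambda>i. x (Suc i))"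
    by (rule eq_vecI) auto
  thus ?case by (simp add: stack_vec_Suc Suc)
qed

text \<open>Allows a block matrix to be tested on an arbitrary vector, cluster by cluster.\<close>

lemma stack_vec_exists:
  assumes "v \<in> carrier_vec (\<Sum>i<m. d i)"
  obtains y where "v = stack_vec m y" "\<And>i. i < m \<Longrightarrow> y i \<in> carrier_vec (d i)"
  using assms
proof (induction m arbitrary: v d thesis)
  case 0
  have "v = vNil" using 0(2) by (intro eq_vecI) auto
  thus ?case using 0(1) by (simp add: stack_vec_0)
next
  case (Suc m)
  let ?s = "\<Sum>i<m. d (Suc i)"
  have v: "v \<in> carrier_vec (d 0 + ?s)"
    using Suc.prems(2) by (simp add: sum.lessThan_Suc_shift del: sum.lessThan_Suc)
  obtain y where y: "vec_last v ?s = stack_vec m y" "\<And>i. i < m \<Longrightarrow> y i \<in> carrier_vec (d (Suc i))"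
    by (rule Suc.IH[of "vec_last v ?s" "\<lambda>i. d (Suc i)"]) auto
  show ?case
  proof (rule Suc.prems(1)[of "\<lambda>i. case i of 0 \<Rightarrow> vec_first v (d 0) | Suc i \<Rightarrow> y i"])
    show "v = stack_vec (Suc m) (\<lambda>i. case i of 0 \<Rightarrow> vec_first v (d 0) | Suc i \<Rightarrow> y i)"
      using vec_first_last_append[OF v] y(1) by (simp add: stack_vec_Suc)
    show "(case i of 0 \<Rightarrow> vec_first v (d 0) | Suc i \<Rightarrow> y i) \<in> carrier_vec (d i)" if "i < Suc m" for i
      using that y(2) by (cases i) auto
  qed
qed

lemma block_diag_Suc:
  "block_diag (Suc m) Z = (let B = block_diag m (\<lambda>i. Z (Suc i))
    in four_block_mat (Z 0) (0\<^sub>m (dim_row (Z 0)) (dim_col B)) (0\<^sub>m (dim_row B) (dim_col (Z 0))) B)"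
  unfolding block_diag_def map_upt_Suc_Cons by simp

lemma dim_block_diag:
  "dim_row (block_diag m Z) = (\<Sum>i<m. dim_row (Z i))" "dim_col (block_diag m Z) = (\<Sum>i<m. dim_col (Z i))"
  by (simp_all add: block_diag_def dim_diag_block_mat sum_list_sum_nth atLeast0LessThan)

lemma block_diag_mult_stack_vec:
  fixes Z :: "nat \<Rightarrow> real mat"
  assumes "\<And>i. i < m \<Longrightarrow> dim_vec (x i) = dim_col (Z i)"
  shows "block_diag m Z *\<^sub>v stack_vec m x = stack_vec m (\<lambda>i. Z i *\<^sub>v x i)"
  using assms
proof (induction m arbitrary: Z x)
  case 0
  show ?case by (rule eq_vecI) (auto simp: stack_vec_0 block_diag_def)
next
  case (Suc m)
  let ?B = "block_diag m (\<lambda>i. Z (Suc i))" and ?s = "stack_vec m (\<lambda>i. x (Suc i))"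
  have s: "?s \<in> carrier_vec (dim_col ?B)" and x0: "x 0 \<in> carrier_vec (dim_col (Z 0))"
    using Suc.prems by (auto intro!: carrier_vecI simp: dim_stack_vec dim_block_diag)
  have "block_diag (Suc m) Z *\<^sub>v stack_vec (Suc m) x = (Z 0 *\<^sub>v x 0) @\<^sub>v (?B *\<^sub>v ?s)"
    unfolding block_diag_Suc Let_def stack_vec_Suc
    by (subst four_block_mat_mult_vec[of _ "dim_row (Z 0)" "dim_col (Z 0)" _ "dim_col ?B" _ "dim_row ?B"])
      (use s x0 in \<open>auto intro!: arg_cong2[where f = append_vec] eq_vecI\<close>)
  also have "?B *\<^sub>v ?s = stack_vec m (\<lambda>i. Z (Suc i) *\<^sub>v x (Suc i))"
    using Suc.prems by (intro Suc.IH) auto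
  finally show ?case by (simp add: stack_vec_Suc)
qed

lemma block_diag_transpose: "(block_diag m Z)\<^sup>T = block_diag m (\<lambda>i. (Z i)\<^sup>T)"
proof (induction m arbitrary: Z)
  case 0
  show ?case by (rule eq_matI) (auto simp: block_diag_def)
next
  case (Suc m)
  let ?B = "block_diag m (\<lambda>i. Z (Suc i))"
  have "(block_diag (Suc m) Z)\<^sup>T = four_block_mat (Z 0)\<^sup>T (0\<^sub>m (dim_row ?B) (dim_col (Z 0)))\<^sup>T
      (0\<^sub>m (dim_row (Z 0)) (dim_col ?B))\<^sup>T ?B\<^sup>T"
    unfolding block_diag_Suc Let_def
    by (rule transpose_four_block_mat) auto
  thus ?case by (simp add: block_diag_Suc Let_def flip: Suc)
qed

lemma stack_mat_mult_vec:
  assumes "\<And>i. i < m \<Longrightarrow> dim_col (X i) = p" "\<beta> \<in> carrier_vec p"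
  shows "stack_mat p m X *\<^sub>v \<beta> = stack_vec m (\<lambda>i. X i *\<^sub>v \<beta>)"
proof -
  have nth: "set is \<subseteq> {..<m} \<Longrightarrow> concat (map (\<lambda>i. list_of_vec (X i *\<^sub>v \<beta>)) is)
      = map (\<lambda>r. r \<bullet> \<beta>) (concat (map (\<lambda>i. rows (X i)) is))" for "is"
  proof (induction "is")
    case (Cons i "is")
    have "list_of_vec (X i *\<^sub>v \<beta>) = map (\<lambda>r. r \<bullet> \<beta>) (rows (X i))"
      by (intro nth_equalityI) (auto simp: list_of_vec_index)
    thus ?case using Cons by simp
  qed simp
  have row: "r \<in> carrier_vec p" if "r \<in> set (concat (map (\<lambda>i. rows (X i)) [0..<m]))" for r
    using that assms(1) by (auto simp: rows_def intro!: carrier_vecI)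
  show ?thesis
    unfolding stack_mat_def stack_vec_def
    by (rule eq_vecI) (auto simp: nth[of "[0..<m]"] vec_of_list_index atLeast0LessThan mat_of_rows_row[OF _ row[OF nth_mem]]
        simp del: set_concat)
qed

lemma kronecker_one_carrier:
  "kronecker (1\<^sub>m m) A \<in> carrier_mat (m * dim_row A) (m * dim_col A)"
  by (simp add: kronecker_def)

lemma kronecker_one_block_diag:
  assumes A: "A \<in> carrier_mat q q" and q: "0 < q"
  shows "kronecker (1\<^sub>m m) A = block_diag m (\<lambda>_. A)"
proof (induction m)
  case 0
  show ?case using A by (intro eq_matI) (auto simp: block_diag_def kronecker_def)
next
  case (Suc m)
  show ?case
  proof (rule eq_matI)
    fix i j assume "i < dim_row (block_diag (Suc m) (\<lambda>_. A))" "j < dim_col (block_diag (Suc m) (\<lambda>_. A))"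
    hence ij: "i < Suc m * q" "j < Suc m * q" using A by (auto simp: dim_block_diag)
    let ?K = "\<lambda>m. kronecker (1\<^sub>m m) A"
    have K: "?K m $$ (i, j) = (if i div q = j div q then A $$ (i mod q, j mod q) else 0)"
      if "i < m * q" "j < m * q" for m i j
      using that A q by (simp add: kronecker_def less_mult_imp_div_less)
    have blk: "block_diag (Suc m) (\<lambda>_. A) $$ (i, j) = (if i < q then if j < q then A $$ (i, j) else 0
        else if j < q then 0 else ?K m $$ (i - q, j - q))"
      using ij A by (simp add: block_diag_Suc Let_def dim_block_diag flip: Suc) (simp add: kronecker_def)
    \<comment> \<open>Removing the first block lowers the block number by one and keeps the position
      inside the block.\<close>
    have sh: "a div q = Suc ((a - q) div q)" "a mod q = (a - q) mod q" if "\<not> a < q" for a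
      using that q by (auto simp: le_div_geq le_mod_geq not_less)
    have "?K m $$ (i - q, j - q) = (if i div q = j div q then A $$ (i mod q, j mod q) else 0)" if "\<not> i < q" "\<not> j < q"
      using that ij sh[of i] sh[of j] by (subst K) auto
    thus "?K (Suc m) $$ (i, j) = block_diag (Suc m) (\<lambda>_. A) $$ (i, j)"
      unfolding K[OF ij] blk using sh[of i] sh[of j] by auto
  qed (use A in \<open>auto simp: kronecker_def dim_block_diag\<close>)
qed

lemma frob2_block_diag: "frob2 (block_diag m Z) = (\<Sum>i<m. frob2 (Z i))"
proof (induction m arbitrary: Z)
  case 0
  show ?case by (simp add: block_diag_def frob2_def)
next
  case (Suc m)
  let ?B = "block_diag m (\<lambda>i. Z (Suc i))"
  have split: "(\<Sum>i<a + b. h i) = (\<Sum>i<a. h i) + (\<Sum>i<b. h (a + i))" for h :: "nat \<Rightarrow> real" and a b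
    by (induction b) auto
  have "frob2 (block_diag (Suc m) Z) = frob2 (Z 0) + frob2 ?B"
    unfolding block_diag_Suc Let_def frob2_def by (simp add: split)
  thus ?case by (simp add: Suc sum.lessThan_Suc_shift del: sum.lessThan_Suc)
qed

lemma spectral_weights_sum:
  fixes P :: "real mat"
  assumes P: "P \<in> carrier_mat n n" "P * P\<^sup>T = 1\<^sub>m n" and x: "x \<in> carrier_vec n"
  shows "(\<Sum>i<n. ((P\<^sup>T *\<^sub>v x) $ i)\<^sup>2) = x \<bullet> x"
proof -
  have "(\<Sum>i<n. ((P\<^sup>T *\<^sub>v x) $ i)\<^sup>2) = (P\<^sup>T *\<^sub>v x) \<bullet> (P\<^sup>T *\<^sub>v x)"
    using P(1) by (simp add: scalar_prod_def lessThan_atLeast0 power2_eq_square)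
  also have "\<dots> = ((P * P\<^sup>T) *\<^sub>v x) \<bullet> x"
    using P(1) x by (simp add: mult_mat_vec_assoc_dim scalar_prod_transpose_dim)
  finally show ?thesis using P(2) x by simp
qed

text \<open>In an eigenbasis the form is a sum of eigenvalues with nonnegative weights that add up
  to the squared length of \<open>x\<close>. Finiteness of the spectrum turns \<open>Min\<close> and
  \<open>Max\<close> into actual bounds.\<close>

lemma eig_min_max_bounds:
  fixes A :: "real mat"
  assumes A: "A \<in> carrier_mat n n" "A\<^sup>T = A" and x: "x \<in> carrier_vec n"
  shows "eig_min A * (x \<bullet> x) \<le> x \<bullet> (A *\<^sub>v x)" "x \<bullet> (A *\<^sub>v x) \<le> eig_max A * (x \<bullet> x)"
proof -
  obtain P d where P: "P \<in> carrier_mat n n" "P\<^sup>T * P = 1\<^sub>m n" "P * P\<^sup>T = 1\<^sub>m n"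
    and AP: "A = P * mat_diag n d * P\<^sup>T"
    using spectral_decomposition'[OF A] by metis
  have d: "d i \<in> spectrum A" if "i < n" for i
  proof -
    have "col P i \<in> carrier_vec n" using P(1) by (intro carrier_vecI) auto
    moreover have "col P i \<noteq> 0\<^sub>v n" using spectral_eigenvector(2)[OF P(1,2) that] by auto
    moreover have "A *\<^sub>v col P i = d i \<cdot>\<^sub>v col P i"
      unfolding AP by (rule spectral_eigenvector(1)[OF P(1,2) that])
    ultimately show ?thesis
      using A(1) by (auto simp: spectrum_def eigenvalue_def eigenvector_def)
  qed
  have fin: "finite (spectrum A)" using card_finite_spectrum[OF A(1)] by simp
  have b: "eig_min A \<le> d i" "d i \<le> eig_max A" if "i < n" for i
    using d[OF that] fin by (auto simp: eig_min_def eig_max_def)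
  have xA: "x \<bullet> (A *\<^sub>v x) = (\<Sum>i<n. d i * ((P\<^sup>T *\<^sub>v x) $ i)\<^sup>2)"
    unfolding AP by (rule scalar_prod_spectral[OF P(1) x])
  show "eig_min A * (x \<bullet> x) \<le> x \<bullet> (A *\<^sub>v x)" "x \<bullet> (A *\<^sub>v x) \<le> eig_max A * (x \<bullet> x)"
    unfolding xA spectral_weights_sum[OF P(1,3) x, symmetric] sum_distrib_left
    using b by (auto intro!: sum_mono mult_right_mono)
qed

section \<open>The random-effects covariance as a linear function of the parameter\<close>

lemma Psi1_carrier: "Psi1 q \<psi> \<in> carrier_mat q q"
  by (simp add: Psi1_def)

lemma Psi_block_diag:
  assumes "0 < q"
  shows "Psi m q \<psi> = block_diag m (\<lambda>_. Psi1 q \<psi>)"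
  unfolding Psi_def by (rule kronecker_one_block_diag[OF Psi1_carrier assms])

lemma Psi_carrier: "Psi m q \<psi> \<in> carrier_mat (m * q) (m * q)"
  using kronecker_one_carrier[of m "Psi1 q \<psi>"] by (simp add: Psi_def Psi1_def)

lemma Psi_symmetric:
  assumes "0 < q"
  shows "(Psi m q \<psi>)\<^sup>T = Psi m q \<psi>"
  by (simp add: Psi_block_diag[OF assms] block_diag_transpose Psi1_symmetric)

lemma frob2_Psi:
  assumes "0 < q"
  shows "frob2 (Psi m q \<psi>) = m * frob2 (Psi1 q \<psi>)"
  by (simp add: Psi_block_diag[OF assms] frob2_block_diag)

lemma carrier_vec_mult_stack:
  assumes "x \<in> carrier_vec (m * q)"
  obtains y where "x = stack_vec m y" "\<And>i. i < m \<Longrightarrow> y i \<in> carrier_vec q"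
  using stack_vec_exists[where v = x and m = m and d = "\<lambda>_. q"] assms by auto

text \<open>The blocks are equal and act separately, so the bound of one block serves for all of
  them. The factor \<open>m\<close> by which \<open>frob2_Psi\<close> exceeds this bound is what
  finally makes the operator norm small.\<close>

lemma Psi_op_bound:
  assumes q: "0 < q" and x: "x \<in> carrier_vec (m * q)"
  shows "(Psi m q \<psi> *\<^sub>v x) \<bullet> (Psi m q \<psi> *\<^sub>v x) \<le> frob2 (Psi1 q \<psi>) * (x \<bullet> x)"
proof -
  obtain y where y: "x = stack_vec m y" "\<And>i. i < m \<Longrightarrow> y i \<in> carrier_vec q"
    using carrier_vec_mult_stack[OF x] by metis
  have dim: "dim_vec (y i) = q" if "i < m" for i using y(2)[OF that] by simp
  have "Psi m q \<psi> *\<^sub>v x = stack_vec m (\<lambda>i. Psi1 q \<psi> *\<^sub>v y i)"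
    unfolding Psi_block_diag[OF q] y(1) using dim
    by (intro block_diag_mult_stack_vec) (simp add: Psi1_def)
  hence "(Psi m q \<psi> *\<^sub>v x) \<bullet> (Psi m q \<psi> *\<^sub>v x) = (\<Sum>i<m. (Psi1 q \<psi> *\<^sub>v y i) \<bullet> (Psi1 q \<psi> *\<^sub>v y i))"
    by (simp add: stack_vec_scalar_prod)
  also have "\<dots> \<le> (\<Sum>i<m. frob2 (Psi1 q \<psi>) * (y i \<bullet> y i))"
    using y(2) by (intro sum_mono mult_vec_norm_le_frob2[OF Psi1_carrier]) auto
  also have "\<dots> = frob2 (Psi1 q \<psi>) * (x \<bullet> x)" by (simp add: y(1) stack_vec_scalar_prod sum_distrib_left)
  finally show ?thesis .
qed

lemma Psi_psd:
  assumes q: "0 < q" and psd: "psd_mat (Psi1 q \<psi>)" and x: "x \<in> carrier_vec (m * q)"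
  shows "0 \<le> x \<bullet> (Psi m q \<psi> *\<^sub>v x)"
proof -
  obtain y where y: "x = stack_vec m y" "\<And>i. i < m \<Longrightarrow> y i \<in> carrier_vec q"
    using carrier_vec_mult_stack[OF x] by metis
  have dim: "dim_vec (y i) = q" if "i < m" for i using y(2)[OF that] by simp
  have "Psi m q \<psi> *\<^sub>v x = stack_vec m (\<lambda>i. Psi1 q \<psi> *\<^sub>v y i)"
    unfolding Psi_block_diag[OF q] y(1) using dim
    by (intro block_diag_mult_stack_vec) (simp add: Psi1_def)
  hence "x \<bullet> (Psi m q \<psi> *\<^sub>v x) = (\<Sum>i<m. y i \<bullet> (Psi1 q \<psi> *\<^sub>v y i))"
    unfolding y(1) using dim by (simp add: stack_vec_scalar_prod Psi1_def)
  thus ?thesis using psd_matD(2)[OF psd] y(2) by (auto simp: Psi1_def intro!: sum_nonneg)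
qed

lemma sum_list_concat: "sum_list (concat xss) = sum_list (map sum_list xss)"
  by (induction xss) auto

text \<open>An off-diagonal entry occurs twice in the matrix but once in \<open>\<psi>\<close>,
  whence the factor 2. This connects the covariance with the parameter norm in the growth
  condition.\<close>

lemma frob2_Psi1_le:
  assumes "\<psi> \<in> carrier_vec (n_param q)"
  shows "frob2 (Psi1 q \<psi>) \<le> 2 * (\<psi> \<bullet> \<psi>)"
proof -
  let ?a = "\<lambda>i j. (Psi1 q \<psi> $$ (i, j))\<^sup>2"
  have sym: "?a i j = ?a j i" if "i < q" "j < q" for i j
    using that by (simp add: Psi1_def max.commute min.commute)
  have low: "(\<Sum>j<q. \<Sum>i\<in>{j..<q}. ?a i j) = (\<Sum>l<n_param q - 1. (\<psi> $ l)\<^sup>2)"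
  proof -
    have "(\<Sum>j<q. \<Sum>i\<in>{j..<q}. ?a i j)
        = sum_list (map (\<lambda>z. z\<^sup>2) (concat (map (\<lambda>j. map (\<lambda>i. Psi1 q \<psi> $$ (i, j)) [j..<q]) [0..<q])))"
      by (simp add: map_concat sum_list_concat comp_def interv_sum_list_conv_sum_set_nat atLeast0LessThan)
    also have "\<dots> = (\<Sum>l<n_param q - 1. (\<psi> $ l)\<^sup>2)"
      unfolding concat_columns_Psi1[OF order_refl]
      by (simp add: comp_def interv_sum_list_conv_sum_set_nat atLeast0LessThan sum_columns n_param_def)
    finally show ?thesis .
  qed
  have "frob2 (Psi1 q \<psi>) = (\<Sum>i<q. \<Sum>j<q. ?a i j)" by (simp add: frob2_def Psi1_def)
  also have "\<dots> \<le> (\<Sum>i<q. \<Sum>j<q. (if j \<le> i then ?a i j else 0) + (if i \<le> j then ?a i j else 0))"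
    by (intro sum_mono) auto
  also have "\<dots> = (\<Sum>i<q. \<Sum>j<q. if j \<le> i then ?a i j else 0) + (\<Sum>i<q. \<Sum>j<q. if i \<le> j then ?a i j else 0)"
    by (simp add: sum.distrib)
  also have "(\<Sum>i<q. \<Sum>j<q. if j \<le> i then ?a i j else 0) = (\<Sum>j<q. \<Sum>i<q. if j \<le> i then ?a i j else 0)"
    by (rule sum.swap)
  also have "(\<Sum>i<q. \<Sum>j<q. if i \<le> j then ?a i j else 0) = (\<Sum>j<q. \<Sum>i<q. if j \<le> i then ?a i j else 0)"
    by (intro sum.cong refl) (simp add: sym)
  also have "(\<Sum>j<q. \<Sum>i<q. if j \<le> i then ?a i j else 0) = (\<Sum>j<q. \<Sum>i\<in>{j..<q}. ?a i j)"
    by (rule sum.cong[OF refl], rule sum.mono_neutral_cong_right) auto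
  also have "\<dots> + \<dots> = 2 * (\<Sum>l<n_param q - 1. (\<psi> $ l)\<^sup>2)" unfolding low by simp
  also have "\<dots> \<le> 2 * (\<Sum>l<n_param q. (\<psi> $ l)\<^sup>2)" by (intro mult_left_mono sum_mono2) auto
  finally show ?thesis
    using assms by (simp add: scalar_prod_def lessThan_atLeast0 power2_eq_square)
qed

text \<open>Identifiability of the parameter: it excludes null directions of the information matrix.
  Reading the lower triangle column by column recovers all entries of \<open>w\<close> except the
  last.\<close>

lemma Psi1_eq_0D:
  assumes w: "w \<in> carrier_vec (n_param q)" and 0: "frob2 (Psi1 q w) = 0" "last_param q w = 0"
  shows "w = 0\<^sub>v (n_param q)"
proof -
  have "Psi1 q w = 0\<^sub>m q q"
    using frob2_eq_0D[OF 0(1)] by (intro eq_matI) (auto simp: Psi1_def)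
  hence "concat (map (\<lambda>j. map (\<lambda>i. Psi1 q w $$ (i, j)) [j..<q]) [0..<q]) = concat (map (\<lambda>j. map (\<lambda>i. 0) [j..<q]) [0..<q])"
    by (intro arg_cong[where f = concat]) auto
  hence "map (\<lambda>l. w $ l) [0..<n_param q - 1] = concat (map (\<lambda>j. map (\<lambda>i. 0) [j..<q]) [0..<q])"
    unfolding concat_columns_Psi1[OF order_refl] sum_columns by (simp add: n_param_def)
  hence "\<forall>z\<in>set (map (\<lambda>l. w $ l) [0..<n_param q - 1]). z = 0" by simp
  hence z: "w $ l = 0" if "l < n_param q - 1" for l using that by simp
  show ?thesis
  proof (rule eq_vecI)
    fix l assume "l < dim_vec (0\<^sub>v (n_param q) :: real vec)"
    hence "l < n_param q" by simp
    hence "l < n_param q - 1 \<or> l = n_param q - 1" by linarith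
    thus "w $ l = 0\<^sub>v (n_param q) $ l"
      using z 0(2) \<open>l < n_param q\<close> by (auto simp: last_param_def)
  qed (use w in simp)
qed

lemma vech_index_less:
  assumes "j \<le> i" "i < q"
  shows "vech_index q i j < n_param q - 1"
proof -
  have "vech_index q i j < (\<Sum>k<Suc j. q - k)" using assms by (simp add: vech_index_def)
  also have "\<dots> \<le> (\<Sum>k<q. q - k)" using assms by (intro sum_mono2) auto
  finally show ?thesis by (simp only: sum_columns n_param_def)
qed

lemma Psi_index:
  assumes "a < m * q" "b < m * q"
  shows "Psi m q w $$ (a, b) = (if a div q = b div q
    then w $ vech_index q (max (a mod q) (b mod q)) (min (a mod q) (b mod q)) else 0)"
proof -
  have "0 < q" using assms(1) by (cases q) auto
  thus ?thesis using assms
    by (simp add: Psi_def kronecker_def Psi1_def less_mult_imp_div_less)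
qed

text \<open>\<open>Psi\<close> is linear in the parameter. As a function of coordinate
  \<open>j\<close> each entry is either that coordinate or a constant, so the derivative is the
  value of \<open>Psi\<close> at a unit vector.\<close>

lemma partial_Psi:
  assumes \<psi>: "\<psi> \<in> carrier_vec (n_param q)" and j: "j < n_param q - 1"
  shows "partial_mat (Psi m q) j \<psi> = Psi m q (unit_vec (n_param q) j)"
proof (rule eq_matI)
  fix a b assume "a < dim_row (Psi m q (unit_vec (n_param q) j))" "b < dim_col (Psi m q (unit_vec (n_param q) j))"
  hence ab: "a < m * q" "b < m * q" using Psi_carrier[of m q "unit_vec (n_param q) j"] by auto
  have q: "0 < q" using ab(1) by (cases q) auto
  define l where "l = vech_index q (max (a mod q) (b mod q)) (min (a mod q) (b mod q))"
  have "l < n_param q - 1"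
    using vech_index_less[of "min (a mod q) (b mod q)" "max (a mod q) (b mod q)" q] q by (simp add: l_def)
  hence l: "l < n_param q" by simp
  have "(\<lambda>t. Psi m q (\<psi> |\<^sub>v j \<mapsto> t) $$ (a, b))
      = (\<lambda>t. if a div q = b div q \<and> l = j then t else if a div q = b div q then \<psi> $ l else 0)"
    using ab \<psi> l by (auto simp: Psi_index update_vec_def simp flip: l_def)
  moreover have "deriv (\<lambda>t. if c then t else d) (x :: real) = (if c then 1 else 0)" for c and d x :: real
    by (cases c) (auto intro!: DERIV_imp_deriv)
  ultimately show "partial_mat (Psi m q) j \<psi> $$ (a, b) = Psi m q (unit_vec (n_param q) j) $$ (a, b)"
    using ab l j Psi_carrier[of m q \<psi>] by (auto simp: partial_mat_def Psi_index simp flip: l_def)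
qed (use Psi_carrier[of m q \<psi>] Psi_carrier[of m q "unit_vec (n_param q) j"] in \<open>auto simp: partial_mat_def\<close>)

lemma Psi_linear_combination:
  assumes ab: "a < m * q" "b < m * q"
  shows "(\<Sum>j<n_param q - 1. w $ j * Psi m q (unit_vec (n_param q) j) $$ (a, b)) = Psi m q w $$ (a, b)"
proof -
  have q: "0 < q" using ab(1) by (cases q) auto
  define l where "l = vech_index q (max (a mod q) (b mod q)) (min (a mod q) (b mod q))"
  have l: "l < n_param q - 1"
    using vech_index_less[of "min (a mod q) (b mod q)" "max (a mod q) (b mod q)" q] q by (simp add: l_def)
  have "(\<Sum>j<n_param q - 1. w $ j * Psi m q (unit_vec (n_param q) j) $$ (a, b))
      = (\<Sum>j<n_param q - 1. if j = l then (if a div q = b div q then w $ l else 0) else 0)"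
    using ab l by (intro sum.cong refl) (auto simp: Psi_index simp flip: l_def)
  also have "\<dots> = Psi m q w $$ (a, b)"
    using ab l by (simp add: Psi_index flip: l_def)
  finally show ?thesis .
qed

text \<open>The score direction \<open>\<Sum>\<^sub>j w\<^sub>j A\<^sub>j\<close> in closed form.\<close>

definition score_mat :: "nat \<Rightarrow> nat \<Rightarrow> real mat \<Rightarrow> real mat \<Rightarrow> real vec \<Rightarrow> real mat" where
  "score_mat m q S Z w =
     inv_sqrt S * (Z * Psi m q w * Z\<^sup>T + last_param q w \<cdot>\<^sub>m 1\<^sub>m (dim_row Z)) * inv_sqrt S"

text \<open>Working entrywise avoids sums of matrices. With \<open>p\<close> and \<open>y\<close>
  the images of two unit vectors under \<open>Z^T C\<close>, an entry of \<open>C Z K Z^T C\<close>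
  is the bilinear form of \<open>K\<close> at \<open>p\<close> and \<open>y\<close>, hence linear in
  \<open>K\<close>, and \<open>Psi_linear_combination\<close> applies under the sum. The last
  parameter contributes a multiple of \<open>C * C\<close>.\<close>

lemma score_mat_index:
  assumes \<psi>: "\<psi> \<in> carrier_vec (n_param q)" and Z: "Z \<in> carrier_mat k (m * q)"
    and C: "inv_sqrt S \<in> carrier_mat k k" "(inv_sqrt S)\<^sup>T = inv_sqrt S" "inv_sqrt S * inv_sqrt S = mat_inv S"
    and ab: "a < k" "b < k"
  shows "(\<Sum>j<n_param q. w $ j * A_mat m q \<psi> S Z j $$ (a, b)) = score_mat m q S Z w $$ (a, b)"
proof -
  define C where "C = inv_sqrt S"
  note C = C[folded C_def]
  let ?E = "\<lambda>j. Psi m q (unit_vec (n_param q) j)"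
  let ?r = "n_param q - 1"
  define ea where "ea = (unit_vec k a :: real vec)"
  define eb where "eb = (unit_vec k b :: real vec)"
  have e: "ea \<in> carrier_vec k" "eb \<in> carrier_vec k" by (auto simp: ea_def eb_def)
  have ent: "M $$ (a, b) = ea \<bullet> (M *\<^sub>v eb)" if "M \<in> carrier_mat k k" for M
    using that ab by (simp add: ea_def eb_def scalar_prod_left_unit[of _ k] scalar_prod_right_unit)
  define p where "p = Z\<^sup>T *\<^sub>v (C *\<^sub>v ea)"
  define y where "y = Z\<^sup>T *\<^sub>v (C *\<^sub>v eb)"
  have py: "p \<in> carrier_vec (m * q)" "y \<in> carrier_vec (m * q)"
    using Z by (auto simp: p_def y_def intro!: carrier_vecI)
  have Kp: "ea \<bullet> ((C * Z * K * Z\<^sup>T * C) *\<^sub>v eb) = p \<bullet> (K *\<^sub>v y)" if "K \<in> carrier_mat (m * q) (m * q)" for K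
    using Z C that e
    by (simp add: mult_mat_vec_assoc_dim scalar_prod_transpose_dim transpose_mult_dim p_def y_def carrier_matD[OF C(1)])
  have A: "A_mat m q \<psi> S Z j $$ (a, b) = p \<bullet> (?E j *\<^sub>v y)" if "j < ?r" for j
  proof -
    have "A_mat m q \<psi> S Z j = C * Z * ?E j * Z\<^sup>T * C"
      using that \<psi> by (simp add: A_mat_def partial_Psi C_def)
    moreover have "C * Z * ?E j * Z\<^sup>T * C \<in> carrier_mat k k" using Z C(1) Psi_carrier by auto
    ultimately show ?thesis using ent Kp[OF Psi_carrier] by metis
  qed
  have "(\<Sum>j<?r. w $ j * A_mat m q \<psi> S Z j $$ (a, b)) = (\<Sum>j<?r. w $ j * (p \<bullet> (?E j *\<^sub>v y)))"
    by (intro sum.cong refl) (simp add: A)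
  also have "\<dots> = (\<Sum>j<?r. \<Sum>c<m * q. \<Sum>d<m * q. w $ j * (p $ c * ?E j $$ (c, d) * y $ d))"
    by (simp add: scalar_prod_mult_mat_vec[OF Psi_carrier py] sum_distrib_left)
  also have "\<dots> = (\<Sum>c<m * q. \<Sum>d<m * q. \<Sum>j<?r. w $ j * (p $ c * ?E j $$ (c, d) * y $ d))"
    by (subst sum.swap, rule sum.cong[OF refl], rule sum.swap)
  also have "\<dots> = (\<Sum>c<m * q. \<Sum>d<m * q. p $ c * (\<Sum>j<?r. w $ j * ?E j $$ (c, d)) * y $ d)"
    by (simp add: sum_distrib_left sum_distrib_right mult_ac)
  also have "\<dots> = (\<Sum>c<m * q. \<Sum>d<m * q. p $ c * Psi m q w $$ (c, d) * y $ d)"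
    by (intro sum.cong refl) (simp only: lessThan_iff Psi_linear_combination)
  also have "\<dots> = p \<bullet> (Psi m q w *\<^sub>v y)" by (simp add: scalar_prod_mult_mat_vec[OF Psi_carrier py])
  finally have 1: "(\<Sum>j<?r. w $ j * A_mat m q \<psi> S Z j $$ (a, b)) = p \<bullet> (Psi m q w *\<^sub>v y)" .
  have r: "Suc ?r = n_param q" by (simp add: n_param_def)
  have last: "A_mat m q \<psi> S Z ?r = C * C" by (simp add: A_mat_def C(3))
  have "(\<Sum>j<Suc ?r. w $ j * A_mat m q \<psi> S Z j $$ (a, b))
      = p \<bullet> (Psi m q w *\<^sub>v y) + last_param q w * (C * C) $$ (a, b)"
    unfolding sum.lessThan_Suc 1 last last_param_def ..
  also have "\<dots> = score_mat m q S Z w $$ (a, b)"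
  proof -
    have ZK: "Z * Psi m q w * Z\<^sup>T \<in> carrier_mat k k" using Z Psi_carrier by auto
    have "score_mat m q S Z w = C * (Z * Psi m q w * Z\<^sup>T) * C + C * (last_param q w \<cdot>\<^sub>m 1\<^sub>m k) * C"
      using Z C(1) ZK unfolding score_mat_def C_def[symmetric]
      by (simp add: mult_add_distrib_mat[of _ k k _ k] add_mult_distrib_mat[of _ k k _ _ k])
    also have "C * (last_param q w \<cdot>\<^sub>m 1\<^sub>m k) * C = last_param q w \<cdot>\<^sub>m (C * C)"
      using C(1) by (simp add: mult_smult_distrib[of _ k k _ k] mult_smult_assoc_mat[of _ k k _ k])
    also have "C * (Z * Psi m q w * Z\<^sup>T) * C = C * Z * Psi m q w * Z\<^sup>T * C"
      using Z C(1) Psi_carrier[of m q w] by (simp add: mult_mat_assoc_dim carrier_matD[OF C(1)])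
    finally have "score_mat m q S Z w = C * Z * Psi m q w * Z\<^sup>T * C + last_param q w \<cdot>\<^sub>m (C * C)" .
    moreover have "(C * Z * Psi m q w * Z\<^sup>T * C) $$ (a, b) = p \<bullet> (Psi m q w *\<^sub>v y)"
    proof -
      have "C * Z * Psi m q w * Z\<^sup>T * C \<in> carrier_mat k k" using Z C(1) Psi_carrier by auto
      from ent[OF this] show ?thesis using Kp[OF Psi_carrier] by simp
    qed
    ultimately show ?thesis using ab C(1) by simp
  qed
  finally show ?thesis unfolding r .
qed

lemma score_mat_symmetric:
  assumes q: "0 < q" and Z: "Z \<in> carrier_mat k (m * q)"
    and C: "inv_sqrt S \<in> carrier_mat k k" "(inv_sqrt S)\<^sup>T = inv_sqrt S"
  shows "score_mat m q S Z w \<in> carrier_mat k k" "(score_mat m q S Z w)\<^sup>T = score_mat m q S Z w"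
proof -
  let ?M = "Z * Psi m q w * Z\<^sup>T + last_param q w \<cdot>\<^sub>m 1\<^sub>m (dim_row Z)"
  have ZK: "Z * Psi m q w * Z\<^sup>T \<in> carrier_mat k k" using Z Psi_carrier by auto
  have M: "?M \<in> carrier_mat k k" using Z ZK by auto
  show "score_mat m q S Z w \<in> carrier_mat k k" using C(1) M by (auto simp: score_mat_def)
  have "?M\<^sup>T = (Z * Psi m q w * Z\<^sup>T)\<^sup>T + (last_param q w \<cdot>\<^sub>m 1\<^sub>m (dim_row Z))\<^sup>T"
    using Z ZK by (intro transpose_add[of _ k k]) auto
  also have "(Z * Psi m q w * Z\<^sup>T)\<^sup>T = Z * Psi m q w * Z\<^sup>T"
    using Z Psi_carrier[of m q w] Psi_symmetric[OF q] by (intro transpose_congruence) auto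
  also have "(last_param q w \<cdot>\<^sub>m 1\<^sub>m (dim_row Z))\<^sup>T = last_param q w \<cdot>\<^sub>m 1\<^sub>m (dim_row Z)"
    by (auto intro!: eq_matI)
  finally have "?M\<^sup>T = ?M" .
  thus "(score_mat m q S Z w)\<^sup>T = score_mat m q S Z w"
    unfolding score_mat_def
    by (intro transpose_congruence[of ?M "inv_sqrt S", unfolded C(2)])
      (simp_all only: carrier_matD[OF M] carrier_matD[OF C(1)])
qed

lemma var_score_combination:
  assumes w: "w \<in> carrier_vec r" and A: "\<And>j. j < r \<Longrightarrow> A j \<in> carrier_mat k k" and B: "B \<in> carrier_mat k k"
    and AB: "\<And>a b. a < k \<Longrightarrow> b < k \<Longrightarrow> (\<Sum>j<r. w $ j * A j $$ (a, b)) = B $$ (a, b)"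
    and R: "R \<in> carrier_vec k"
  shows "w \<bullet> var_score r A R = (R \<bullet> (B *\<^sub>v R) - mat_trace B) / 2"
proof -
  have "(\<Sum>j<r. w $ j * (R \<bullet> (A j *\<^sub>v R))) = (\<Sum>j<r. \<Sum>a<k. \<Sum>b<k. w $ j * (R $ a * A j $$ (a, b) * R $ b))"
    by (intro sum.cong refl) (simp add: scalar_prod_mult_mat_vec[OF A R R] sum_distrib_left)
  also have "\<dots> = (\<Sum>a<k. \<Sum>b<k. \<Sum>j<r. w $ j * (R $ a * A j $$ (a, b) * R $ b))"
    by (subst sum.swap, rule sum.cong[OF refl], rule sum.swap)
  also have "\<dots> = (\<Sum>a<k. \<Sum>b<k. R $ a * (\<Sum>j<r. w $ j * A j $$ (a, b)) * R $ b)"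
    by (simp add: sum_distrib_left sum_distrib_right mult_ac)
  also have "\<dots> = R \<bullet> (B *\<^sub>v R)" by (simp add: AB scalar_prod_mult_mat_vec[OF B R R])
  finally have 1: "(\<Sum>j<r. w $ j * (R \<bullet> (A j *\<^sub>v R))) = R \<bullet> (B *\<^sub>v R)" .
  have "(\<Sum>j<r. w $ j * mat_trace (A j)) = (\<Sum>j<r. \<Sum>a<k. w $ j * A j $$ (a, a))"
    using A by (intro sum.cong refl) (auto simp: mat_trace_def sum_distrib_left)
  also have "\<dots> = (\<Sum>a<k. \<Sum>j<r. w $ j * A j $$ (a, a))" by (rule sum.swap)
  also have "\<dots> = mat_trace B" using B by (simp add: AB mat_trace_def)
  finally have 2: "(\<Sum>j<r. w $ j * mat_trace (A j)) = mat_trace B" .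
  have "w \<bullet> var_score r A R = (\<Sum>j<r. w $ j * ((R \<bullet> (A j *\<^sub>v R) - mat_trace (A j)) / 2))"
    using w by (simp add: var_score_def scalar_prod_def lessThan_atLeast0)
  also have "\<dots> = ((\<Sum>j<r. w $ j * (R \<bullet> (A j *\<^sub>v R))) - (\<Sum>j<r. w $ j * mat_trace (A j))) / 2"
    by (simp add: sum_subtractf right_diff_distrib flip: sum_divide_distrib)
  finally show ?thesis unfolding 1 2 .
qed

text \<open>The information is half the Gram matrix of the \<open>A j\<close> under the trace inner
  product.\<close>

lemma var_info_combination:
  assumes w: "w \<in> carrier_vec r" and A: "\<And>j. j < r \<Longrightarrow> A j \<in> carrier_mat k k"
    and B: "B \<in> carrier_mat k k" "B\<^sup>T = B"
    and AB: "\<And>a b. a < k \<Longrightarrow> b < k \<Longrightarrow> (\<Sum>j<r. w $ j * A j $$ (a, b)) = B $$ (a, b)"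
  shows "w \<bullet> (var_info r A *\<^sub>v w) = frob2 B / 2"
proof -
  have tr: "mat_trace (A i * A j) = (\<Sum>a<k. \<Sum>b<k. A i $$ (a, b) * A j $$ (b, a))" if "i < r" "j < r" for i j
    using that by (intro mat_trace_mult A)
  have "frob2 B = mat_trace (B * B)" by (rule mat_trace_square[OF B, symmetric])
  also have "\<dots> = (\<Sum>a<k. \<Sum>b<k. B $$ (a, b) * B $$ (b, a))" by (rule mat_trace_mult[OF B(1) B(1)])
  also have "\<dots> = (\<Sum>a<k. \<Sum>b<k. (\<Sum>i<r. w $ i * A i $$ (a, b)) * (\<Sum>j<r. w $ j * A j $$ (b, a)))"
    by (intro sum.cong refl) (simp add: AB)
  also have "\<dots> = (\<Sum>a<k. \<Sum>b<k. \<Sum>i<r. \<Sum>j<r. w $ i * w $ j * (A i $$ (a, b) * A j $$ (b, a)))"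
    by (simp add: sum_product mult_ac)
  also have "\<dots> = (\<Sum>a<k. \<Sum>i<r. \<Sum>j<r. \<Sum>b<k. w $ i * w $ j * (A i $$ (a, b) * A j $$ (b, a)))"
    by (rule sum.cong[OF refl], subst sum.swap, rule sum.cong[OF refl], rule sum.swap)
  also have "\<dots> = (\<Sum>i<r. \<Sum>j<r. \<Sum>a<k. \<Sum>b<k. w $ i * w $ j * (A i $$ (a, b) * A j $$ (b, a)))"
    by (subst sum.swap, rule sum.cong[OF refl], rule sum.swap)
  also have "\<dots> = (\<Sum>i<r. \<Sum>j<r. w $ i * w $ j * mat_trace (A i * A j))"
    by (intro sum.cong refl) (simp add: tr sum_distrib_left)
  finally have "frob2 B = (\<Sum>i<r. \<Sum>j<r. w $ i * w $ j * mat_trace (A i * A j))" .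
  moreover have "var_info r A \<in> carrier_mat r r" by (simp add: var_info_def)
  ultimately show ?thesis
    using scalar_prod_mult_mat_vec[of "var_info r A" r r w w] w
    by (simp add: var_info_def sum_divide_distrib mult_ac)
qed

lemma var_info_symmetric:
  assumes A: "\<And>j. j < r \<Longrightarrow> A j \<in> carrier_mat k k"
  shows "(var_info r A)\<^sup>T = var_info r A"
  by (rule eq_matI) (auto simp: var_info_def intro!: mat_trace_comm[OF A A])

lemma A_mat_carrier:
  assumes Z: "Z \<in> carrier_mat k (m * q)"
    and C: "inv_sqrt S \<in> carrier_mat k k" "inv_sqrt S * inv_sqrt S = mat_inv S"
    and \<psi>: "\<psi> \<in> carrier_vec (n_param q)"
  shows "A_mat m q \<psi> S Z j \<in> carrier_mat k k"
  using Z C(1) Psi_carrier \<psi> by (auto simp: A_mat_def partial_Psi simp flip: C(2))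

section \<open>Normal laws and the law of the stacked residual\<close>

lemma char_normal_law:
  assumes "0 \<le> v"
  shows "char (normal_law 0 v) t = of_real (exp (- (v * t\<^sup>2) / 2))"
proof (cases "v = 0")
  case True
  thus ?thesis by (simp add: normal_law_def char_def integral_return)
next
  case False
  define \<sigma> where "\<sigma> = sqrt v"
  have \<sigma>: "0 < \<sigma>" "\<sigma>\<^sup>2 = v" using False assms by (auto simp: \<sigma>_def)
  have "char (normal_law 0 v) t = (CLINT x|density lborel (normal_density 0 \<sigma>). iexp (t * x))"
    using False by (simp add: normal_law_def char_def \<sigma>_def)
  also have "\<dots> = (CLINT x|lborel. normal_density 0 \<sigma> x *\<^sub>R iexp (t * x))"
    by (subst integral_density) (auto simp: normal_density_nonneg)
  also have "\<dots> = \<bar>\<sigma>\<bar> *\<^sub>R (CLINT x|lborel. normal_density 0 \<sigma> (0 + \<sigma> * x) *\<^sub>R iexp (t * (0 + \<sigma> * x)))"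
    using \<sigma>(1) by (intro lborel_integral_real_affine) auto
  also have "\<dots> = of_real \<sigma> * (CLINT x|lborel. normal_density 0 \<sigma> (\<sigma> * x) *\<^sub>R iexp (t * (\<sigma> * x)))"
    using \<sigma>(1) by (simp add: scaleR_conv_of_real)
  also have "\<dots> = (CLINT x|lborel. of_real \<sigma> * normal_density 0 \<sigma> (\<sigma> * x) *\<^sub>R iexp (t * (\<sigma> * x)))"
    by (rule integral_mult_right_zero[symmetric])
  also have "\<dots> = (CLINT x|lborel. std_normal_density x *\<^sub>R iexp ((t * \<sigma>) * x))"
  proof -
    have nd: "\<sigma> * normal_density 0 \<sigma> (\<sigma> * x) = std_normal_density x" for x
      using \<sigma>(1) by (simp add: normal_density_def real_sqrt_mult power_mult_distrib)
    have "of_real \<sigma> * (a *\<^sub>R z) = (\<sigma> * a) *\<^sub>R z" for a and z :: complex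
      by (simp add: scaleR_conv_of_real)
    thus ?thesis by (simp only: nd mult.assoc)
  qed
  also have "\<dots> = char std_normal_distribution (t * \<sigma>)"
    unfolding char_def by (subst integral_density) (auto simp: normal_density_nonneg)
  finally show ?thesis by (simp add: char_std_normal_distribution power_mult_distrib \<sigma>(2) mult.commute)
qed

lemma space_vec_borel: "space (vec_borel d) = carrier_vec d"
  by (simp add: vec_borel_def)

lemma scalar_prod_measurable:
  assumes a: "a \<in> carrier_vec d"
  shows "(\<lambda>x. a \<bullet> x) \<in> borel_measurable (vec_borel d)"
proof -
  have "(\<lambda>x. \<lambda>i\<in>{..<d}. x $ i) \<in> measurable (vec_borel d) (Pi\<^sub>M {..<d} (\<lambda>_. borel :: real measure))"
    unfolding vec_borel_def by (intro measurable_vimage_algebra1) (auto simp: space_PiM)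
  hence "(\<lambda>x. (\<lambda>i\<in>{..<d}. x $ i) i) \<in> borel_measurable (vec_borel d)" if "i < d" for i
    by (rule measurable_compose) (use that in \<open>auto intro!: measurable_component_singleton\<close>)
  hence "(\<lambda>x. x $ i) \<in> borel_measurable (vec_borel d)" if "i < d" for i
    using that by (simp cong: measurable_cong)
  hence "(\<lambda>x. \<Sum>i<d. a $ i * x $ i) \<in> borel_measurable (vec_borel d)"
    by (intro borel_measurable_sum borel_measurable_times) auto
  also have "?this \<longleftrightarrow> ?thesis"
    by (intro measurable_cong) (auto simp: space_vec_borel scalar_prod_def lessThan_atLeast0)
  finally show ?thesis .
qed

text \<open>Frequency 1 suffices, since any other frequency can be absorbed into the arbitrary
  vector \<open>a\<close>.\<close>

lemma multivariate_normal_char: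
  assumes N: "multivariate_normal M d x (0\<^sub>v d) S" and a: "a \<in> carrier_vec d"
  shows "char (distr M borel (\<lambda>\<omega>. a \<bullet> x \<omega>)) 1 = of_real (exp (- (a \<bullet> (S *\<^sub>v a)) / 2))"
proof -
  have "0 \<le> a \<bullet> (S *\<^sub>v a)"
    using N a psd_matD(2)[of S a] by (auto simp: multivariate_normal_def)
  moreover have "distr M borel (\<lambda>\<omega>. a \<bullet> x \<omega>) = normal_law (a \<bullet> 0\<^sub>v d) (a \<bullet> (S *\<^sub>v a))"
    using N a unfolding multivariate_normal_def by blast
  ultimately show ?thesis using a by (simp add: char_normal_law)
qed

lemma block_diag_carrier:
  assumes "\<And>i. i < m \<Longrightarrow> Z i \<in> carrier_mat (ns i) q"
  shows "block_diag m Z \<in> carrier_mat (\<Sum>i<m. ns i) (m * q)"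
proof -
  have "dim_row (Z i) = ns i \<and> dim_col (Z i) = q" if "i < m" for i using assms[OF that] by auto
  thus ?thesis by (intro carrier_matI) (simp_all add: dim_block_diag)
qed

lemma block_diag_singular_values:
  assumes Z: "\<And>i. i < m \<Longrightarrow> Z i \<in> carrier_mat (ns i) q"
    and eig: "\<And>i. i < m \<Longrightarrow> a \<le> eig_min ((Z i)\<^sup>T * Z i) \<and> eig_max ((Z i)\<^sup>T * Z i) \<le> b"
    and x: "x \<in> carrier_vec (m * q)"
  shows "a * (x \<bullet> x) \<le> (block_diag m Z *\<^sub>v x) \<bullet> (block_diag m Z *\<^sub>v x)"
    "(block_diag m Z *\<^sub>v x) \<bullet> (block_diag m Z *\<^sub>v x) \<le> b * (x \<bullet> x)"
proof -
  obtain y where y: "x = stack_vec m y" "\<And>i. i < m \<Longrightarrow> y i \<in> carrier_vec q"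
    using carrier_vec_mult_stack[OF x] by metis
  have dimZ: "dim_row (Z i) = ns i" "dim_col (Z i) = q" if "i < m" for i using Z[OF that] by auto
  have "block_diag m Z *\<^sub>v x = stack_vec m (\<lambda>i. Z i *\<^sub>v y i)"
    unfolding y(1) using y(2) dimZ by (intro block_diag_mult_stack_vec) auto
  hence eq: "(block_diag m Z *\<^sub>v x) \<bullet> (block_diag m Z *\<^sub>v x) = (\<Sum>i<m. (Z i *\<^sub>v y i) \<bullet> (Z i *\<^sub>v y i))"
    by (simp add: stack_vec_scalar_prod)
  have xx: "x \<bullet> x = (\<Sum>i<m. y i \<bullet> y i)" by (simp add: y(1) stack_vec_scalar_prod)
  have b: "a * (y i \<bullet> y i) \<le> (Z i *\<^sub>v y i) \<bullet> (Z i *\<^sub>v y i)"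
    "(Z i *\<^sub>v y i) \<bullet> (Z i *\<^sub>v y i) \<le> b * (y i \<bullet> y i)" if i: "i < m" for i
  proof -
    let ?W = "(Z i)\<^sup>T * Z i"
    have W: "?W \<in> carrier_mat q q" "?W\<^sup>T = ?W" using Z[OF i] by (auto simp: transpose_mult_dim)
    have "y i \<bullet> (?W *\<^sub>v y i) = (Z i *\<^sub>v y i) \<bullet> (Z i *\<^sub>v y i)"
      using Z[OF i] y(2)[OF i] by (simp add: mult_mat_vec_assoc_dim scalar_prod_transpose_dim)
    moreover have "a * (y i \<bullet> y i) \<le> eig_min ?W * (y i \<bullet> y i)" "eig_max ?W * (y i \<bullet> y i) \<le> b * (y i \<bullet> y i)"
      using eig[OF i] by (auto intro!: mult_right_mono scalar_prod_real_nonneg)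
    ultimately show "a * (y i \<bullet> y i) \<le> (Z i *\<^sub>v y i) \<bullet> (Z i *\<^sub>v y i)"
      "(Z i *\<^sub>v y i) \<bullet> (Z i *\<^sub>v y i) \<le> b * (y i \<bullet> y i)"
      using eig_min_max_bounds[OF W y(2)[OF i]] by linarith+
  qed
  show "a * (x \<bullet> x) \<le> (block_diag m Z *\<^sub>v x) \<bullet> (block_diag m Z *\<^sub>v x)"
    "(block_diag m Z *\<^sub>v x) \<bullet> (block_diag m Z *\<^sub>v x) \<le> b * (x \<bullet> x)"
    unfolding eq xx sum_distrib_left using b by (auto intro!: sum_mono)
qed

lemma Sigma_mat_mult:
  assumes Z: "Z \<in> carrier_mat n (m * q)" and x: "x \<in> carrier_vec n"
  shows "Sigma_mat m q Z \<psi> *\<^sub>v x = Z *\<^sub>v (Psi m q \<psi> *\<^sub>v (Z\<^sup>T *\<^sub>v x)) + last_param q \<psi> \<cdot>\<^sub>v x"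
proof -
  have "Z * Psi m q \<psi> * Z\<^sup>T \<in> carrier_mat n n" using Z Psi_carrier by auto
  thus ?thesis using Z x Psi_carrier[of m q \<psi>]
    by (simp add: Sigma_mat_def add_mult_distrib_mat_vec[of _ n n] smult_one_mult_mat_vec mult_mat_vec_assoc_dim)
qed

text \<open>The lower bound drops the positive semidefinite part. In the upper bound the Frobenius
  norm of one block stands in for its largest eigenvalue, because it is controlled by the Euclidean
  norm of the parameter.\<close>

lemma Sigma_mat_bounds:
  assumes Z: "Z \<in> carrier_mat n (m * q)" and q: "0 < q" and \<psi>: "\<psi> \<in> param_set q" and c: "0 \<le> c"
    and hi: "\<And>x. x \<in> carrier_vec (m * q) \<Longrightarrow> (Z *\<^sub>v x) \<bullet> (Z *\<^sub>v x) \<le> c * (x \<bullet> x)"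
  shows "Sigma_mat m q Z \<psi> \<in> carrier_mat n n" "(Sigma_mat m q Z \<psi>)\<^sup>T = Sigma_mat m q Z \<psi>"
    "\<And>x. x \<in> carrier_vec n \<Longrightarrow> last_param q \<psi> * (x \<bullet> x) \<le> x \<bullet> (Sigma_mat m q Z \<psi> *\<^sub>v x)"
    "\<And>x. x \<in> carrier_vec n \<Longrightarrow> x \<bullet> (Sigma_mat m q Z \<psi> *\<^sub>v x)
      \<le> (last_param q \<psi> + c * sqrt (frob2 (Psi1 q \<psi>))) * (x \<bullet> x)"
proof -
  let ?S = "Sigma_mat m q Z \<psi>" and ?r = "last_param q \<psi>" and ?f = "frob2 (Psi1 q \<psi>)"
  have psd: "psd_mat (Psi1 q \<psi>)" using \<psi> by (simp add: param_set_def)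
  have ZPZ: "Z * Psi m q \<psi> * Z\<^sup>T \<in> carrier_mat n n" using Z Psi_carrier by auto
  show "?S \<in> carrier_mat n n" using Z ZPZ by (auto simp: Sigma_mat_def)
  have "?S\<^sup>T = (Z * Psi m q \<psi> * Z\<^sup>T)\<^sup>T + (?r \<cdot>\<^sub>m 1\<^sub>m (dim_row Z))\<^sup>T"
    unfolding Sigma_mat_def using Z ZPZ by (intro transpose_add[of _ n n]) auto
  also have "(Z * Psi m q \<psi> * Z\<^sup>T)\<^sup>T = Z * Psi m q \<psi> * Z\<^sup>T"
    using Z Psi_carrier[of m q \<psi>] Psi_symmetric[OF q] by (intro transpose_congruence) auto
  also have "(?r \<cdot>\<^sub>m 1\<^sub>m (dim_row Z))\<^sup>T = ?r \<cdot>\<^sub>m 1\<^sub>m (dim_row Z)"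
    by (auto intro!: eq_matI)
  finally show "?S\<^sup>T = ?S" by (simp add: Sigma_mat_def)
  fix x :: "real vec" assume x: "x \<in> carrier_vec n"
  define y where "y = Z\<^sup>T *\<^sub>v x"
  have y: "y \<in> carrier_vec (m * q)" using Z by (intro carrier_vecI) (auto simp: y_def)
  have Py: "Psi m q \<psi> *\<^sub>v y \<in> carrier_vec (m * q)" using Psi_carrier[of m q \<psi>] by (intro carrier_vecI) auto
  have ZPy: "Z *\<^sub>v (Psi m q \<psi> *\<^sub>v y) \<in> carrier_vec n" using Z by (intro carrier_vecI) auto
  have "x \<bullet> (?S *\<^sub>v x) = x \<bullet> (Z *\<^sub>v (Psi m q \<psi> *\<^sub>v y)) + x \<bullet> (?r \<cdot>\<^sub>v x)"
    unfolding Sigma_mat_mult[OF Z x] y_def[symmetric] using x ZPy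
    by (intro scalar_prod_add_distrib[of _ n]) auto
  also have "x \<bullet> (Z *\<^sub>v (Psi m q \<psi> *\<^sub>v y)) = y \<bullet> (Psi m q \<psi> *\<^sub>v y)"
    using Z x Py Psi_carrier[of m q \<psi>] scalar_prod_transpose_dim[of x Z "Psi m q \<psi> *\<^sub>v y"] by (simp add: y_def)
  finally have eq: "x \<bullet> (?S *\<^sub>v x) = y \<bullet> (Psi m q \<psi> *\<^sub>v y) + ?r * (x \<bullet> x)" using x by simp
  show "?r * (x \<bullet> x) \<le> x \<bullet> (?S *\<^sub>v x)" using Psi_psd[OF q psd y] by (simp add: eq)
  have yx: "y \<bullet> y \<le> c * (x \<bullet> x)"
    unfolding y_def by (rule transpose_mult_vec_norm_le[OF Z x c hi])
  have "(y \<bullet> (Psi m q \<psi> *\<^sub>v y))\<^sup>2 \<le> (y \<bullet> y) * ((Psi m q \<psi> *\<^sub>v y) \<bullet> (Psi m q \<psi> *\<^sub>v y))"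
    by (rule scalar_prod_Cauchy_Schwarz[OF y Py])
  also have "\<dots> \<le> (y \<bullet> y) * (?f * (y \<bullet> y))"
    by (intro mult_left_mono Psi_op_bound q y scalar_prod_real_nonneg)
  also have "\<dots> = (sqrt ?f * (y \<bullet> y))\<^sup>2" using frob2_nonneg by (simp add: power_mult_distrib power2_eq_square)
  finally have "y \<bullet> (Psi m q \<psi> *\<^sub>v y) \<le> sqrt ?f * (y \<bullet> y)"
    by (rule power2_le_imp_le) (auto intro!: mult_nonneg_nonneg simp: frob2_nonneg scalar_prod_real_nonneg)
  also have "\<dots> \<le> sqrt ?f * (c * (x \<bullet> x))" by (intro mult_left_mono yx) (auto simp: frob2_nonneg)
  finally show "x \<bullet> (?S *\<^sub>v x) \<le> (?r + c * sqrt ?f) * (x \<bullet> x)" by (simp add: eq algebra_simps)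
qed

text \<open>All later use of the model goes through these four facts. A linear form of
  \<open>\<xi>\<close> splits into linear forms of the \<open>2 * m\<close> independent vectors
  \<open>U i\<close> and \<open>E i\<close>, so its characteristic function is a product of
  univariate normal ones.\<close>

lemma cluster_model_residual:
  assumes model: "cluster_model M m ns p q X Z \<beta> \<psi> U E Y"
  defines "S \<equiv> Sigma_mat m q (block_diag m Z) \<psi>"
    and "\<xi> \<equiv> \<lambda>\<omega>. stack_vec m (\<lambda>i. Z i *\<^sub>v U i \<omega> + E i \<omega>)"
  shows "\<And>\<omega>. \<omega> \<in> space M \<Longrightarrow> \<xi> \<omega> \<in> carrier_vec (\<Sum>i<m. ns i)"
    "\<And>\<omega>. \<omega> \<in> space M \<Longrightarrow> stack_vec m (\<lambda>i. Y i \<omega>) = stack_mat p m X *\<^sub>v \<beta> + \<xi> \<omega>"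
    "\<And>d. d \<in> carrier_vec (\<Sum>i<m. ns i) \<Longrightarrow> (\<lambda>\<omega>. d \<bullet> \<xi> \<omega>) \<in> borel_measurable M"
    "\<And>d. d \<in> carrier_vec (\<Sum>i<m. ns i) \<Longrightarrow>
      (\<integral>\<omega>. iexp (d \<bullet> \<xi> \<omega>) \<partial>M) = of_real (exp (- (d \<bullet> (S *\<^sub>v d)) / 2))"
proof -
  interpret prob_space M using model by (simp add: cluster_model_def)
  let ?n = "\<Sum>i<m. ns i" and ?Z = "block_diag m Z" and ?r = "last_param q \<psi>"
  have q: "0 < q" and \<beta>: "\<beta> \<in> carrier_vec p" using model by (auto simp: cluster_model_def)
  have XZ: "X i \<in> carrier_mat (ns i) p" "Z i \<in> carrier_mat (ns i) q" if "i < m" for i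
    using model that by (auto simp: cluster_model_def)
  have dimZ: "dim_row (Z i) = ns i" "dim_col (Z i) = q" and dimX: "dim_row (X i) = ns i" "dim_col (X i) = p" if "i < m" for i
    using XZ[OF that] by auto
  have N: "multivariate_normal M q (U i) (0\<^sub>v q) (Psi1 q \<psi>)"
    "multivariate_normal M (ns i) (E i) (0\<^sub>v (ns i)) (?r \<cdot>\<^sub>m 1\<^sub>m (ns i))" if "i < m" for i
    using model that by (auto simp: cluster_model_def)
  have Um: "U i \<in> measurable M (vec_borel q)" and Em: "E i \<in> measurable M (vec_borel (ns i))" if "i < m" for i
    using N[OF that] by (auto simp: multivariate_normal_def)
  have UE: "U i \<omega> \<in> carrier_vec q" "E i \<omega> \<in> carrier_vec (ns i)" if "i < m" "\<omega> \<in> space M" for i \<omega>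
    using measurable_space[OF Um[OF that(1)] that(2)] measurable_space[OF Em[OF that(1)] that(2)]
    by (auto simp: space_vec_borel)
  have dimUE: "dim_vec (U i \<omega>) = q" "dim_vec (E i \<omega>) = ns i" if "i < m" "\<omega> \<in> space M" for i \<omega>
    using UE[OF that] by auto
  show "\<xi> \<omega> \<in> carrier_vec ?n" if "\<omega> \<in> space M" for \<omega>
    unfolding \<xi>_def using dimUE that by (intro stack_vec_carrier carrier_vecI) auto
  show "stack_vec m (\<lambda>i. Y i \<omega>) = stack_mat p m X *\<^sub>v \<beta> + \<xi> \<omega>" if \<omega>: "\<omega> \<in> space M" for \<omega>
  proof -
    have "stack_mat p m X *\<^sub>v \<beta> + \<xi> \<omega> = stack_vec m (\<lambda>i. X i *\<^sub>v \<beta> + (Z i *\<^sub>v U i \<omega> + E i \<omega>))"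
      unfolding \<xi>_def using \<beta> dimX dimZ dimUE \<omega>
      by (subst stack_mat_mult_vec) (auto intro!: stack_vec_add)
    also have "\<dots> = stack_vec m (\<lambda>i. Y i \<omega>)"
    proof (rule stack_vec_cong)
      fix i assume i: "i < m"
      have c: "X i *\<^sub>v \<beta> \<in> carrier_vec (ns i)" "Z i *\<^sub>v U i \<omega> \<in> carrier_vec (ns i)"
        using dimX[OF i] dimZ[OF i] by (auto intro!: carrier_vecI)
      have "Y i \<omega> = X i *\<^sub>v \<beta> + Z i *\<^sub>v U i \<omega> + E i \<omega>"
        using model i \<omega> by (auto simp: cluster_model_def)
      thus "X i *\<^sub>v \<beta> + (Z i *\<^sub>v U i \<omega> + E i \<omega>) = Y i \<omega>"
        using assoc_add_vec[OF c UE(2)[OF i \<omega>]] by simp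
    qed
    finally show ?thesis by simp
  qed
  fix d :: "real vec" assume d: "d \<in> carrier_vec ?n"
  obtain y where y: "d = stack_vec m y" "\<And>i. i < m \<Longrightarrow> y i \<in> carrier_vec (ns i)"
    using stack_vec_exists[OF d] by metis
  have dimy: "dim_vec (y i) = ns i" if "i < m" for i using y(2)[OF that] by simp
  \<comment> \<open>The coefficient of \<open>U i\<close> in the linear form, found by moving
    \<open>Z i\<close> across the scalar product.\<close>
  define a where "a i = (Z i)\<^sup>T *\<^sub>v y i" for i
  have a: "a i \<in> carrier_vec q" if "i < m" for i
    using dimZ[OF that] by (auto simp: a_def intro!: carrier_vecI)
  \<comment> \<open>One deterministic linear form for each member of the joint family; composing
    with these measurable maps preserves independence.\<close>
  define F where "F = case_sum (\<lambda>i (v :: real vec). a i \<bullet> v) (\<lambda>i v. y i \<bullet> v)"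
  let ?I = "{..<m} <+> {..<m}"
  have indep: "indep_vars (\<lambda>_. borel) (\<lambda>k \<omega>. F k (case_sum U E k \<omega>)) ?I"
  proof -
    have 1: "indep_vars (case_sum (\<lambda>i. vec_borel q) (\<lambda>i. vec_borel (ns i))) (case_sum U E) ?I"
      using model by (simp add: cluster_model_def)
    have "F k \<in> borel_measurable (case_sum (\<lambda>i. vec_borel q) (\<lambda>i. vec_borel (ns i)) k)" if "k \<in> ?I" for k
      using that a y(2) by (auto simp: F_def intro!: scalar_prod_measurable)
    from indep_vars_compose2[OF 1 this] show ?thesis .
  qed
  have dec: "d \<bullet> \<xi> \<omega> = (\<Sum>k\<in>?I. F k (case_sum U E k \<omega>))" if \<omega>: "\<omega> \<in> space M" for \<omega>
  proof -
    have "d \<bullet> \<xi> \<omega> = (\<Sum>i<m. y i \<bullet> (Z i *\<^sub>v U i \<omega> + E i \<omega>))"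
      unfolding y(1) \<xi>_def using dimy dimUE \<omega> by (intro stack_vec_scalar_prod) auto
    also have "\<dots> = (\<Sum>i<m. a i \<bullet> U i \<omega> + y i \<bullet> E i \<omega>)"
    proof (intro sum.cong refl)
      fix i assume "i \<in> {..<m}"
      hence i: "i < m" by simp
      have "y i \<bullet> (Z i *\<^sub>v U i \<omega> + E i \<omega>) = y i \<bullet> (Z i *\<^sub>v U i \<omega>) + y i \<bullet> E i \<omega>"
        using y(2)[OF i] dimZ[OF i] UE(2)[OF i \<omega>]
        by (intro scalar_prod_add_distrib[of _ "ns i"]) (auto intro!: carrier_vecI)
      also have "y i \<bullet> (Z i *\<^sub>v U i \<omega>) = a i \<bullet> U i \<omega>"
        using dimy[OF i] dimZ[OF i] dimUE(1)[OF i \<omega>] by (simp add: a_def scalar_prod_transpose_dim)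
      finally show "y i \<bullet> (Z i *\<^sub>v U i \<omega> + E i \<omega>) = a i \<bullet> U i \<omega> + y i \<bullet> E i \<omega>" .
    qed
    also have "\<dots> = (\<Sum>k\<in>?I. F k (case_sum U E k \<omega>))"
      by (simp add: sum.Plus F_def sum.distrib)
    finally show ?thesis .
  qed
  have rv: "(\<lambda>\<omega>. F k (case_sum U E k \<omega>)) \<in> borel_measurable M" if "k \<in> ?I" for k
    using indep that by (auto simp: indep_vars_def)
  have "(\<lambda>\<omega>. \<Sum>k\<in>?I. F k (case_sum U E k \<omega>)) \<in> borel_measurable M"
    by (intro borel_measurable_sum rv)
  thus meas: "(\<lambda>\<omega>. d \<bullet> \<xi> \<omega>) \<in> borel_measurable M"
    using dec by (simp cong: measurable_cong)
  have "(\<integral>\<omega>. iexp (d \<bullet> \<xi> \<omega>) \<partial>M) = (\<integral>\<omega>. iexp (\<Sum>k\<in>?I. F k (case_sum U E k \<omega>)) \<partial>M)"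
    by (intro Bochner_Integration.integral_cong refl) (simp add: dec)
  also have "\<dots> = char (distr M borel (\<lambda>\<omega>. \<Sum>k\<in>?I. F k (case_sum U E k \<omega>))) 1"
    unfolding char_def by (subst integral_distr) (auto intro!: borel_measurable_sum rv)
  also have "\<dots> = (\<Prod>k\<in>?I. char (distr M borel (\<lambda>\<omega>. F k (case_sum U E k \<omega>))) 1)"
    by (rule char_distr_sum[OF indep])
  also have "\<dots> = (\<Prod>i<m. char (distr M borel (\<lambda>\<omega>. a i \<bullet> U i \<omega>)) 1) *
      (\<Prod>i<m. char (distr M borel (\<lambda>\<omega>. y i \<bullet> E i \<omega>)) 1)"
    by (simp add: prod.Plus F_def)
  also have "\<dots> = (\<Prod>i<m. of_real (exp (- (a i \<bullet> (Psi1 q \<psi> *\<^sub>v a i)) / 2))) *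
      (\<Prod>i<m. of_real (exp (- (y i \<bullet> ((?r \<cdot>\<^sub>m 1\<^sub>m (ns i)) *\<^sub>v y i)) / 2)))"
    using multivariate_normal_char[OF N(1) a] multivariate_normal_char[OF N(2) y(2)] by simp
  also have "\<dots> = of_real (exp (- (\<Sum>i<m. a i \<bullet> (Psi1 q \<psi> *\<^sub>v a i) + ?r * (y i \<bullet> y i)) / 2))"
  proof -
    have "- (\<Sum>i<m. u i + v i) / 2 = (\<Sum>i<m. - u i / 2 + - v i / 2)" for u v :: "nat \<Rightarrow> real"
      by (simp add: sum.distrib sum_negf sum_subtractf add_divide_distrib flip: sum_divide_distrib)
    hence "complex_of_real (exp (- (\<Sum>i<m. u i + v i) / 2))
        = (\<Prod>i<m. of_real (exp (- u i / 2))) * (\<Prod>i<m. of_real (exp (- v i / 2)))" for u v :: "nat \<Rightarrow> real"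
      by (simp only: exp_sum finite_lessThan exp_add prod.distrib of_real_prod of_real_mult)
    thus ?thesis using y(2) by (simp only: lessThan_iff) (simp add: smult_one_mult_mat_vec)
  qed
  also have "(\<Sum>i<m. a i \<bullet> (Psi1 q \<psi> *\<^sub>v a i) + ?r * (y i \<bullet> y i)) = d \<bullet> (S *\<^sub>v d)"
  proof -
    have Z: "?Z \<in> carrier_mat ?n (m * q)" by (rule block_diag_carrier) (rule XZ)
    have "?Z\<^sup>T *\<^sub>v d = stack_vec m a"
      unfolding block_diag_transpose y(1) a_def using dimy dimZ by (intro block_diag_mult_stack_vec) auto
    hence "Psi m q \<psi> *\<^sub>v (?Z\<^sup>T *\<^sub>v d) = stack_vec m (\<lambda>i. Psi1 q \<psi> *\<^sub>v a i)"
      unfolding Psi_block_diag[OF q] using a by (subst block_diag_mult_stack_vec[symmetric]) (auto simp: Psi1_def)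
    hence "?Z *\<^sub>v (Psi m q \<psi> *\<^sub>v (?Z\<^sup>T *\<^sub>v d)) = stack_vec m (\<lambda>i. Z i *\<^sub>v (Psi1 q \<psi> *\<^sub>v a i))"
      using dimZ by (subst block_diag_mult_stack_vec[symmetric]) (auto simp: Psi1_def)
    hence "S *\<^sub>v d = stack_vec m (\<lambda>i. Z i *\<^sub>v (Psi1 q \<psi> *\<^sub>v a i)) + stack_vec m (\<lambda>i. ?r \<cdot>\<^sub>v y i)"
      unfolding S_def Sigma_mat_mult[OF Z d] by (simp add: y(1) stack_vec_smult)
    also have "\<dots> = stack_vec m (\<lambda>i. Z i *\<^sub>v (Psi1 q \<psi> *\<^sub>v a i) + ?r \<cdot>\<^sub>v y i)"
      using dimZ dimy by (intro stack_vec_add) auto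
    finally have "d \<bullet> (S *\<^sub>v d) = (\<Sum>i<m. y i \<bullet> (Z i *\<^sub>v (Psi1 q \<psi> *\<^sub>v a i) + ?r \<cdot>\<^sub>v y i))"
      unfolding y(1) using dimZ dimy by (simp add: stack_vec_scalar_prod)
    also have "\<dots> = (\<Sum>i<m. a i \<bullet> (Psi1 q \<psi> *\<^sub>v a i) + ?r * (y i \<bullet> y i))"
    proof (intro sum.cong refl)
      fix i assume "i \<in> {..<m}"
      hence i: "i < m" by simp
      have "y i \<bullet> (Z i *\<^sub>v (Psi1 q \<psi> *\<^sub>v a i) + ?r \<cdot>\<^sub>v y i)
          = y i \<bullet> (Z i *\<^sub>v (Psi1 q \<psi> *\<^sub>v a i)) + y i \<bullet> (?r \<cdot>\<^sub>v y i)"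
        using y(2)[OF i] dimZ[OF i] by (intro scalar_prod_add_distrib[of _ "ns i"]) (auto intro!: carrier_vecI)
      also have "y i \<bullet> (Z i *\<^sub>v (Psi1 q \<psi> *\<^sub>v a i)) = a i \<bullet> (Psi1 q \<psi> *\<^sub>v a i)"
        using dimy[OF i] dimZ[OF i] scalar_prod_transpose_dim[of "y i" "Z i" "Psi1 q \<psi> *\<^sub>v a i"]
        by (simp add: a_def Psi1_def)
      finally show "y i \<bullet> (Z i *\<^sub>v (Psi1 q \<psi> *\<^sub>v a i) + ?r \<cdot>\<^sub>v y i) = a i \<bullet> (Psi1 q \<psi> *\<^sub>v a i) + ?r * (y i \<bullet> y i)"
        by simp
    qed
    finally show ?thesis by simp
  qed
  finally show "(\<integral>\<omega>. iexp (d \<bullet> \<xi> \<omega>) \<partial>M) = of_real (exp (- (d \<bullet> (S *\<^sub>v d)) / 2))" .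
qed

subsection \<open>The score statistics\<close>

lemma mat_trace_spectral:
  fixes P :: "real mat"
  assumes P: "P \<in> carrier_mat n n" "P\<^sup>T * P = 1\<^sub>m n"
  shows "mat_trace (P * mat_diag n d * P\<^sup>T) = (\<Sum>i<n. d i)"
    and "frob2 (P * mat_diag n d * P\<^sup>T) = (\<Sum>i<n. (d i)\<^sup>2)"
proof -
  have D: "mat_diag n e \<in> carrier_mat n n" for e :: "nat \<Rightarrow> real" by simp
  have tr: "mat_trace (P * mat_diag n e * P\<^sup>T) = (\<Sum>i<n. e i)" for e
  proof -
    have "mat_trace (P * mat_diag n e * P\<^sup>T) = mat_trace (P\<^sup>T * (P * mat_diag n e))"
      using P(1) D by (intro mat_trace_comm[of _ n n]) auto
    also have "P\<^sup>T * (P * mat_diag n e) = P\<^sup>T * P * mat_diag n e"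
      using P(1) by (simp add: mult_mat_assoc_dim carrier_matD[OF D])
    finally show ?thesis using P(2) by (simp add: left_mult_one_mat[OF D]) (simp add: mat_trace_def mat_diag_def)
  qed
  show "mat_trace (P * mat_diag n d * P\<^sup>T) = (\<Sum>i<n. d i)" by (rule tr)
  let ?B = "P * mat_diag n d * P\<^sup>T"
  have "(mat_diag n d)\<^sup>T = mat_diag n d" by (auto simp: mat_diag_def intro!: eq_matI)
  hence "?B\<^sup>T = ?B" using P(1) by (intro transpose_congruence) (auto simp: carrier_matD[OF D])
  hence "frob2 ?B = mat_trace (?B * ?B)"
    using P(1) by (intro mat_trace_square[symmetric, of _ n]) auto
  also have "?B * ?B = P * (mat_diag n d * (P\<^sup>T * P) * mat_diag n d) * P\<^sup>T"
    using P(1) by (simp add: mult_mat_assoc_dim carrier_matD[OF D] del: mat_diag_diag)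
  also have "mat_diag n d * (P\<^sup>T * P) * mat_diag n d = mat_diag n (\<lambda>i. (d i)\<^sup>2)"
    unfolding P(2) by (simp add: right_mult_one_mat[OF D] power2_eq_square)
  finally show "frob2 ?B = (\<Sum>i<n. (d i)\<^sup>2)" by (simp only: tr)
qed

text \<open>The assumption on \<open>G\<close> says that it whitens the compressed residual, so
  \<open>R\<close> and every rotation of it have the characteristic function of a standard normal
  vector. In an eigenbasis of \<open>B\<close> the statistic becomes a sum of quadratic polynomials
  in single coordinates. Both statistics are instances: the unrestricted one with \<open>V\<close>
  the identity, the restricted one with \<open>l\<close> zero.\<close>

lemma (in prob_space) gaussian_quadratic_char_bound:
  fixes \<xi> :: "'a \<Rightarrow> real vec" and S V B :: "real mat" and l :: "real vec"
  assumes C: "quadratic_char_constant C"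
    and \<xi>: "\<And>\<omega>. \<omega> \<in> space M \<Longrightarrow> \<xi> \<omega> \<in> carrier_vec n"
      "\<And>d. d \<in> carrier_vec n \<Longrightarrow> (\<lambda>\<omega>. d \<bullet> \<xi> \<omega>) \<in> borel_measurable M"
      "\<And>d. d \<in> carrier_vec n \<Longrightarrow> (\<integral>\<omega>. iexp (d \<bullet> \<xi> \<omega>) \<partial>M) = of_real (exp (- (d \<bullet> (S *\<^sub>v d)) / 2))"
    and S: "S \<in> carrier_mat n n" and V: "V \<in> carrier_mat n k"
    and G: "G \<in> carrier_mat k k" "G\<^sup>T = G" "G * (V\<^sup>T * S * V * G) = 1\<^sub>m k"
    and l: "l \<in> carrier_vec k" and B: "B \<in> carrier_mat k k" "B\<^sup>T = B"
    and unit: "l \<bullet> l + frob2 B / 2 = 1"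
    and e: "0 \<le> e" "\<And>x. x \<in> carrier_vec k \<Longrightarrow> (B *\<^sub>v x) \<bullet> (B *\<^sub>v x) \<le> e\<^sup>2 * (x \<bullet> x)"
  defines "R \<equiv> \<lambda>\<omega>. G *\<^sub>v (V\<^sup>T *\<^sub>v \<xi> \<omega>)"
  defines "T \<equiv> \<lambda>\<omega>. l \<bullet> R \<omega> + (R \<omega> \<bullet> (B *\<^sub>v R \<omega>) - mat_trace B) / 2"
  shows "T \<in> borel_measurable M"
    and "\<bar>t\<bar> * e \<le> 1 \<Longrightarrow> cmod (char (distr M borel T) t - exp (- (t\<^sup>2) / 2)) \<le> 2 * C * \<bar>t\<bar> ^ 3 * e"
proof -
  obtain P d where P: "P \<in> carrier_mat k k" "P\<^sup>T * P = 1\<^sub>m k" "P * P\<^sup>T = 1\<^sub>m k"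
    and BP: "B = P * mat_diag k d * P\<^sup>T"
    using spectral_decomposition'[OF B] by metis
  define x where "x j \<omega> = (P\<^sup>T *\<^sub>v R \<omega>) $ j" for j \<omega>
  have dim\<xi>: "dim_vec (\<xi> \<omega>) = n" if "\<omega> \<in> space M" for \<omega> using \<xi>(1)[OF that] by simp
  have Rc: "R \<omega> \<in> carrier_vec k" for \<omega> using G(1) by (intro carrier_vecI) (auto simp: R_def)
  have PR: "P\<^sup>T *\<^sub>v R \<omega> \<in> carrier_vec k" for \<omega> using P(1) by (intro carrier_vecI) auto
  \<comment> \<open>Linear forms of the rotated vector are linear forms of \<open>\<xi>\<close>,
    whose measurability and characteristic functions are what the hypotheses provide.\<close>
  have lin: "b \<bullet> (P\<^sup>T *\<^sub>v R \<omega>) = (V *\<^sub>v (G *\<^sub>v (P *\<^sub>v b))) \<bullet> \<xi> \<omega>"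
    if b: "b \<in> carrier_vec k" and \<omega>: "\<omega> \<in> space M" for b \<omega>
    using P(1) G(1,2) V dim\<xi>[OF \<omega>] b by (simp add: R_def scalar_prod_transpose_dim)
  have Vc: "V *\<^sub>v (G *\<^sub>v (P *\<^sub>v b)) \<in> carrier_vec n" for b using V by (intro carrier_vecI) auto
  have xm: "x j \<in> borel_measurable M" if j: "j < k" for j
  proof -
    have "x j \<omega> = (V *\<^sub>v (G *\<^sub>v (P *\<^sub>v unit_vec k j))) \<bullet> \<xi> \<omega>" if "\<omega> \<in> space M" for \<omega>
      using lin[of "unit_vec k j" \<omega>] that j PR[of \<omega>] by (simp add: x_def scalar_prod_left_unit[of _ k])
    thus ?thesis using \<xi>(2)[OF Vc] by (simp cong: measurable_cong)
  qed
  have xchar: "(\<integral>\<omega>. iexp (\<Sum>j<k. a j * x j \<omega>) \<partial>M) = of_real (exp (- (\<Sum>j<k. (a j)\<^sup>2) / 2))" for a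
  proof -
    define b where "b = vec k a"
    have b: "b \<in> carrier_vec k" by (simp add: b_def)
    define w where "w = V *\<^sub>v (G *\<^sub>v (P *\<^sub>v b))"
    have "(\<integral>\<omega>. iexp (\<Sum>j<k. a j * x j \<omega>) \<partial>M) = (\<integral>\<omega>. iexp (w \<bullet> \<xi> \<omega>) \<partial>M)"
    proof (intro Bochner_Integration.integral_cong refl)
      fix \<omega> assume "\<omega> \<in> space M"
      from lin[OF b this] have "(\<Sum>j<k. a j * x j \<omega>) = w \<bullet> \<xi> \<omega>"
        using P(1) by (simp add: x_def w_def b_def scalar_prod_def lessThan_atLeast0)
      thus "iexp (\<Sum>j<k. a j * x j \<omega>) = iexp (w \<bullet> \<xi> \<omega>)" by simp
    qed
    also have "\<dots> = of_real (exp (- (w \<bullet> (S *\<^sub>v w)) / 2))" unfolding w_def by (rule \<xi>(3)[OF Vc])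
    also have "w \<bullet> (S *\<^sub>v w) = b \<bullet> b"
    proof -
      let ?y = "P *\<^sub>v b"
      have y: "?y \<in> carrier_vec k" using P(1) by (intro carrier_vecI) auto
      have "w \<bullet> (S *\<^sub>v w) = (G *\<^sub>v ?y) \<bullet> (V\<^sup>T *\<^sub>v (S *\<^sub>v w))"
        using scalar_prod_transpose_dim[of "G *\<^sub>v ?y" "V\<^sup>T" "S *\<^sub>v w"] V G(1) S by (simp add: w_def)
      also have "\<dots> = ?y \<bullet> (G *\<^sub>v (V\<^sup>T *\<^sub>v (S *\<^sub>v w)))"
        using scalar_prod_transpose_dim[of ?y G "V\<^sup>T *\<^sub>v (S *\<^sub>v w)"] V G(1,2) P(1) by simp
      also have "G *\<^sub>v (V\<^sup>T *\<^sub>v (S *\<^sub>v w)) = (G * (V\<^sup>T * S * V * G)) *\<^sub>v ?y"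
        using V G(1) S P(1) b by (simp add: w_def mult_mat_vec_assoc_dim)
      also have "?y \<bullet> ((G * (V\<^sup>T * S * V * G)) *\<^sub>v ?y) = ?y \<bullet> ?y" unfolding G(3) using y by simp
      also have "\<dots> = (P\<^sup>T *\<^sub>v ?y) \<bullet> b" using P(1) b by (intro scalar_prod_transpose_dim) auto
      also have "P\<^sup>T *\<^sub>v ?y = (P\<^sup>T * P) *\<^sub>v b" using P(1) b by (simp add: mult_mat_vec_assoc_dim)
      also have "\<dots> = b" unfolding P(2) using b by simp
      finally show ?thesis .
    qed
    also have "b \<bullet> b = (\<Sum>j<k. (a j)\<^sup>2)"
      by (simp add: b_def scalar_prod_def lessThan_atLeast0 power2_eq_square)
    finally show ?thesis .
  qed
  define lc where "lc j = (P\<^sup>T *\<^sub>v l) $ j" for j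
  \<comment> \<open>Written as the sum of the eigenvalues, the trace centers each squared coordinate
    at its mean 1.\<close>
  have T: "T \<omega> = (\<Sum>j<k. lc j * x j \<omega> + d j * (((x j \<omega>)\<^sup>2 - 1) / 2))" for \<omega>
  proof -
    have "l \<bullet> R \<omega> = ((P * P\<^sup>T) *\<^sub>v l) \<bullet> R \<omega>" unfolding P(3) using l by simp
    also have "\<dots> = R \<omega> \<bullet> (P *\<^sub>v (P\<^sup>T *\<^sub>v l))"
      using P(1) l Rc[of \<omega>] by (subst comm_scalar_prod[of _ k]) (auto intro!: carrier_vecI simp: mult_mat_vec_assoc_dim)
    also have "\<dots> = (P\<^sup>T *\<^sub>v R \<omega>) \<bullet> (P\<^sup>T *\<^sub>v l)"
      using P(1) Rc[of \<omega>] by (intro scalar_prod_transpose_dim) auto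
    also have "\<dots> = (\<Sum>j<k. lc j * x j \<omega>)"
      using P(1) by (simp add: lc_def x_def scalar_prod_def lessThan_atLeast0 mult.commute)
    finally have 1: "l \<bullet> R \<omega> = (\<Sum>j<k. lc j * x j \<omega>)" .
    have 2: "R \<omega> \<bullet> (B *\<^sub>v R \<omega>) = (\<Sum>j<k. d j * (x j \<omega>)\<^sup>2)"
      unfolding BP x_def by (rule scalar_prod_spectral[OF P(1) Rc])
    have 3: "mat_trace B = (\<Sum>j<k. d j)" unfolding BP by (rule mat_trace_spectral[OF P(1,2)])
    show ?thesis
      unfolding T_def 1 2 3
      by (simp add: sum.distrib sum_subtractf right_diff_distrib flip: sum_divide_distrib)
  qed
  have Tm: "(\<lambda>\<omega>. \<Sum>j<k. lc j * x j \<omega> + d j * (((x j \<omega>)\<^sup>2 - 1) / 2)) \<in> borel_measurable M"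
    using xm by (intro borel_measurable_sum borel_measurable_add borel_measurable_times borel_measurable_divide
        borel_measurable_diff borel_measurable_power borel_measurable_const) auto
  show Tmeas: "T \<in> borel_measurable M" using Tm by (simp add: T[abs_def])
  assume te: "\<bar>t\<bar> * e \<le> 1"
  have "char (distr M borel T) t = (\<integral>\<omega>. iexp (t * T \<omega>) \<partial>M)"
    unfolding char_def using Tmeas by (subst integral_distr) auto
  also have "\<dots> = (\<integral>\<omega>. iexp (t * (\<Sum>j<k. lc j * x j \<omega> + d j * (((x j \<omega>)\<^sup>2 - 1) / 2))) \<partial>M)"
    by (simp only: T)
  also have "cmod (\<dots> - exp (- (t\<^sup>2) / 2)) \<le> 2 * C * \<bar>t\<bar> ^ 3 * e"
  proof (rule quadratic_form_char_bound[OF C xm xchar _ _ e(1) te])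
    have "(\<Sum>j<k. (lc j)\<^sup>2) = l \<bullet> l"
      unfolding lc_def by (rule spectral_weights_sum[OF P(1,3) l])
    moreover have "frob2 B = (\<Sum>j<k. (d j)\<^sup>2)" unfolding BP by (rule mat_trace_spectral[OF P(1,2)])
    ultimately show "(\<Sum>j<k. (lc j)\<^sup>2) + (\<Sum>j<k. (d j)\<^sup>2) / 2 = 1" using unit by simp
    fix j assume j: "j < k"
    \<comment> \<open>The operator bound at a unit eigenvector bounds the eigenvalue.\<close>
    have "(d j)\<^sup>2 = (d j \<cdot>\<^sub>v col P j) \<bullet> (d j \<cdot>\<^sub>v col P j)"
      using spectral_eigenvector(2)[OF P(1,2) j] by (simp add: power2_eq_square)
    also have "\<dots> \<le> e\<^sup>2 * (col P j \<bullet> col P j)"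
      using e(2)[of "col P j"] P(1) spectral_eigenvector(1)[OF P(1,2) j, of d]
      by (auto simp: BP intro!: carrier_vecI)
    also have "\<dots> = e\<^sup>2" using spectral_eigenvector(2)[OF P(1,2) j] by simp
    finally show "\<bar>d j\<bar> \<le> e" using e(1) by (simp add: abs_le_square_iff[symmetric])
  qed auto
  finally show "cmod (char (distr M borel T) t - exp (- (t\<^sup>2) / 2)) \<le> 2 * C * \<bar>t\<bar> ^ 3 * e" .
qed

text \<open>For \<open>A\<close> the information and \<open>s\<close> the score, this passes from a
  direction \<open>u\<close> of the standardized score to the direction \<open>w\<close> of the raw
  score; unit length of \<open>u\<close> becomes unit variance along \<open>w\<close>.\<close>

lemma inv_sqrt_standardization:
  fixes A :: "real mat" and u s :: "real vec"
  assumes A: "A \<in> carrier_mat n n" "A\<^sup>T = A"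
    and pos: "\<And>x. x \<in> carrier_vec n \<Longrightarrow> x \<noteq> 0\<^sub>v n \<Longrightarrow> 0 < x \<bullet> (A *\<^sub>v x)"
    and u: "u \<in> carrier_vec n" and s: "s \<in> carrier_vec n"
  defines "w \<equiv> inv_sqrt A *\<^sub>v u"
  shows "w \<in> carrier_vec n" "u \<bullet> (inv_sqrt A *\<^sub>v s) = w \<bullet> s" "w \<bullet> (A *\<^sub>v w) = u \<bullet> u"
proof -
  note G = inv_sqrt[OF A pos]
  let ?G = "inv_sqrt A"
  show w: "w \<in> carrier_vec n" using G(1) by (intro carrier_vecI) (auto simp: w_def)
  have eq: "u \<bullet> (?G *\<^sub>v y) = w \<bullet> y" if "y \<in> carrier_vec n" for y
    using scalar_prod_transpose_dim[of u ?G y] G(1,2) u that by (simp add: w_def)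
  show "u \<bullet> (?G *\<^sub>v s) = w \<bullet> s" by (rule eq[OF s])
  have "w \<bullet> (A *\<^sub>v w) = u \<bullet> (?G *\<^sub>v (A *\<^sub>v w))"
    using A(1) by (intro eq[symmetric] carrier_vecI) auto
  also have "?G *\<^sub>v (A *\<^sub>v w) = (?G * (A * ?G)) *\<^sub>v u"
    using A(1) G(1) u by (simp add: w_def mult_mat_vec_assoc_dim)
  also have "\<dots> = u" using u by (simp add: G(4))
  finally show "w \<bullet> (A *\<^sub>v w) = u \<bullet> u" .
qed

lemma four_block_diag_mult_vec:
  fixes A D :: "real mat"
  assumes "A \<in> carrier_mat a a" "D \<in> carrier_mat d d" "x \<in> carrier_vec a" "y \<in> carrier_vec d"
  shows "four_block_mat A (0\<^sub>m a d) (0\<^sub>m d a) D *\<^sub>v (x @\<^sub>v y) = (A *\<^sub>v x) @\<^sub>v (D *\<^sub>v y)"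
  using assms
  by (subst four_block_mat_mult_vec[of _ a a _ d _ d]) (auto intro!: arg_cong2[where f = append_vec] eq_vecI)

lemma stack_mat_carrier:
  assumes "\<And>i. i < m \<Longrightarrow> X i \<in> carrier_mat (ns i) p"
  shows "stack_mat p m X \<in> carrier_mat (\<Sum>i<m. ns i) p"
proof -
  have "length (concat (map (\<lambda>i. rows (X i)) [0..<m])) = (\<Sum>i<m. dim_row (X i))"
    by (simp add: length_concat comp_def interv_sum_list_conv_sum_set_nat atLeast0LessThan)
  also have "\<dots> = (\<Sum>i<m. ns i)" using assms by (intro sum.cong) auto
  finally show ?thesis
    using mat_of_rows_carrier(1)[of p "concat (map (\<lambda>i. rows (X i)) [0..<m])"] by (simp add: stack_mat_def)
qed

text \<open>Levy continuity needs only the limit at each fixed frequency, and for fixed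
  \<open>t\<close> the restriction \<open>\<bar>t\<bar> * e m \<le> 1\<close> holds
  eventually.\<close>

lemma weak_conv_std_normalI:
  fixes M :: "nat \<Rightarrow> 'a measure" and f :: "nat \<Rightarrow> 'a \<Rightarrow> real" and C :: real
  assumes "\<forall>\<^sub>F m in sequentially. prob_space (M m) \<and> f m \<in> borel_measurable (M m) \<and>
      (\<forall>t. \<bar>t\<bar> * e m \<le> 1 \<longrightarrow> cmod (char (distr (M m) borel (f m)) t - exp (- (t\<^sup>2) / 2)) \<le> 2 * C * \<bar>t\<bar> ^ 3 * e m)"
    and e: "e \<longlonglongrightarrow> 0"
  shows "weak_conv_m (\<lambda>m. distr (M m) borel (f m)) std_normal_distribution"
proof -
  let ?D = "\<lambda>m. distr (M m) borel (f m)"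
  obtain m0 where m0: "\<And>m. m \<ge> m0 \<Longrightarrow> prob_space (M m)" "\<And>m. m \<ge> m0 \<Longrightarrow> f m \<in> borel_measurable (M m)"
    "\<And>m t. m \<ge> m0 \<Longrightarrow> \<bar>t\<bar> * e m \<le> 1 \<Longrightarrow> cmod (char (?D m) t - exp (- (t\<^sup>2) / 2)) \<le> 2 * C * \<bar>t\<bar> ^ 3 * e m"
    using assms(1) unfolding eventually_sequentially by blast
  \<comment> \<open>Levy continuity asks for a probability law at every index, while the hypothesis
    speaks only of large \<open>m\<close>; the limit law fills the gap.\<close>
  define D where "D m = (if m0 \<le> m then ?D m else std_normal_distribution)" for m
  have ev: "\<forall>\<^sub>F m in sequentially. D m = ?D m"
    using eventually_ge_at_top[of m0] by eventually_elim (simp add: D_def)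
  have "weak_conv_m D std_normal_distribution"
  proof (rule levy_continuity)
    show "real_distribution (D m)" for m
      using m0(1,2)[of m] real_dist_normal_dist
      by (auto simp: D_def real_distribution_def real_distribution_axioms_def intro!: prob_space.prob_space_distr)
    show "real_distribution std_normal_distribution" by (rule real_dist_normal_dist)
    fix t
    have lim: "(\<lambda>m. 2 * C * \<bar>t\<bar> ^ 3 * e m) \<longlonglongrightarrow> 0" "(\<lambda>m. \<bar>t\<bar> * e m) \<longlonglongrightarrow> 0"
      by (rule tendsto_mult_right_zero[OF e])+
    have "\<forall>\<^sub>F m in sequentially. \<bar>t\<bar> * e m < 1" by (rule order_tendstoD(2)[OF lim(2)]) simp
    hence "\<forall>\<^sub>F m in sequentially. cmod (char (D m) t - exp (- (t\<^sup>2) / 2)) \<le> 2 * C * \<bar>t\<bar> ^ 3 * e m"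
      using eventually_ge_at_top[of m0]
    proof eventually_elim
      case (elim m)
      thus ?case using m0(3)[of m t] by (simp add: D_def)
    qed
    from Lim_null_comparison[OF this lim(1)]
    have "(\<lambda>m. char (D m) t - exp (- (t\<^sup>2) / 2)) \<longlonglongrightarrow> 0" .
    from Lim_null[THEN iffD2, OF this]
    show "(\<lambda>m. char (D m) t) \<longlonglongrightarrow> char std_normal_distribution t"
      by (simp add: char_std_normal_distribution)
  qed
  moreover have "((\<lambda>m. cdf (D m) x) \<longlonglongrightarrow> l) = ((\<lambda>m. cdf (?D m) x) \<longlonglongrightarrow> l)" for x l
    by (rule filterlim_cong[OF refl refl]) (use ev in \<open>auto elim!: eventually_mono\<close>)
  ultimately show ?thesis by (simp add: weak_conv_m_def weak_conv_def)
qed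

section \<open>Estimates for a fixed number of clusters\<close>

locale cluster_setup =
  fixes M :: "'a measure" and m :: nat and ns :: "nat \<Rightarrow> nat" and p q :: nat
    and X Z :: "nat \<Rightarrow> real mat" and \<beta> \<psi> :: "real vec" and U E Y :: "nat \<Rightarrow> 'a \<Rightarrow> real vec"
    and c1 c2 :: real
  assumes m: "1 \<le> m"
    and model: "cluster_model M m ns p q X Z \<beta> \<psi> U E Y"
    and c1: "1 < c1" and c2: "1 < c2"
    and nbar: "c1 \<le> real (\<Sum>i<m. ns i) / real m / real q"
    and eig: "\<And>i. i < m \<Longrightarrow> inverse c2 \<le> eig_min ((Z i)\<^sup>T * Z i) \<and> eig_max ((Z i)\<^sup>T * Z i) \<le> c2"
begin

abbreviation "n \<equiv> \<Sum>i<m. ns i"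
abbreviation "Zb \<equiv> block_diag m Z"
abbreviation "Xb \<equiv> stack_mat p m X"
abbreviation "S \<equiv> Sigma_mat m q Zb \<psi>"
abbreviation "r \<equiv> n_param q"
abbreviation "y \<omega> \<equiv> stack_vec m (\<lambda>i. Y i \<omega>)"

definition "\<xi> \<omega> = stack_vec m (\<lambda>i. Z i *\<^sub>v U i \<omega> + E i \<omega>)"
text \<open>An upper bound for the eigenvalues of the covariance matrix \<open>S\<close>, as
  \<open>Shi\<close> shows.\<close>

definition "\<sigma> = last_param q \<psi> + c2 * sqrt (frob2 (Psi1 q \<psi>))"
text \<open>The constant of \<open>compressed_information_bounds\<close> at
  \<open>c = c2\<close>.\<close>

definition "L = 4 * c2^4 * (c1 + 1) / (c1 - 1)"

text \<open>Bounds the operator norm of every unit-variance score direction.\<close>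

definition "rate = sqrt (2 * L / m) * (\<sigma> / last_param q \<psi>)"

lemma q: "0 < q" and \<psi>: "\<psi> \<in> param_set q" "\<psi> \<in> carrier_vec r" and \<beta>: "\<beta> \<in> carrier_vec p"
  and last: "0 < last_param q \<psi>"
  using model by (auto simp: cluster_model_def param_set_def)

lemma prob: "prob_space M"
  using model by (simp add: cluster_model_def)

lemma XZ: "i < m \<Longrightarrow> X i \<in> carrier_mat (ns i) p" "i < m \<Longrightarrow> Z i \<in> carrier_mat (ns i) q"
  using model by (auto simp: cluster_model_def)

lemma Zb: "Zb \<in> carrier_mat n (m * q)"
  by (rule block_diag_carrier) (rule XZ)

lemma Xb: "Xb \<in> carrier_mat n p"
  by (rule stack_mat_carrier) (rule XZ)

lemma Zlo: "x \<in> carrier_vec (m * q) \<Longrightarrow> inverse c2 * (x \<bullet> x) \<le> (Zb *\<^sub>v x) \<bullet> (Zb *\<^sub>v x)"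
  and Zhi: "x \<in> carrier_vec (m * q) \<Longrightarrow> (Zb *\<^sub>v x) \<bullet> (Zb *\<^sub>v x) \<le> c2 * (x \<bullet> x)"
  by (rule block_diag_singular_values[of m Z ns q], use XZ eig in auto)+

lemma S: "S \<in> carrier_mat n n" "S\<^sup>T = S"
  and Slo: "x \<in> carrier_vec n \<Longrightarrow> last_param q \<psi> * (x \<bullet> x) \<le> x \<bullet> (S *\<^sub>v x)"
  and Shi: "x \<in> carrier_vec n \<Longrightarrow> x \<bullet> (S *\<^sub>v x) \<le> \<sigma> * (x \<bullet> x)"
proof -
  have "0 \<le> c2" using c2 by simp
  note b = Sigma_mat_bounds[OF Zb q \<psi>(1) this Zhi]
  show "S \<in> carrier_mat n n" "S\<^sup>T = S" using b(1,2) by blast+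
  show "last_param q \<psi> * (x \<bullet> x) \<le> x \<bullet> (S *\<^sub>v x)" "x \<bullet> (S *\<^sub>v x) \<le> \<sigma> * (x \<bullet> x)"
    if "x \<in> carrier_vec n" using b(3,4) that unfolding \<sigma>_def by blast+
qed

lemma \<sigma>: "0 < \<sigma>"
  unfolding \<sigma>_def using last c2 by (intro add_pos_nonneg mult_nonneg_nonneg) (auto simp: frob2_nonneg)

lemma L: "0 < L"
  using c1 c2 by (simp add: L_def)

lemma rate_nonneg: "0 \<le> rate"
  using \<sigma> L last by (simp add: rate_def)

lemma residual:
  "\<omega> \<in> space M \<Longrightarrow> \<xi> \<omega> \<in> carrier_vec n"
  "\<omega> \<in> space M \<Longrightarrow> y \<omega> = Xb *\<^sub>v \<beta> + \<xi> \<omega>"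
  "d \<in> carrier_vec n \<Longrightarrow> (\<lambda>\<omega>. d \<bullet> \<xi> \<omega>) \<in> borel_measurable M"
  "d \<in> carrier_vec n \<Longrightarrow> (\<integral>\<omega>. iexp (d \<bullet> \<xi> \<omega>) \<partial>M) = of_real (exp (- (d \<bullet> (S *\<^sub>v d)) / 2))"
  using cluster_model_residual[OF model] unfolding \<xi>_def by blast+

text \<open>Specializes the matrix bounds to the actual parameter, at once for both statistics. The
  threshold 2 on \<open>frob2 (B w)\<close> is what unit variance permits, because the quadratic
  part of the score has variance \<open>frob2 (B w) / 2\<close>.\<close>

lemma compressed_score:
  assumes V: "V \<in> carrier_mat n k" "V\<^sup>T * V = 1\<^sub>m k"
    and nk: "8 * c2^4 * (real n - real k) \<le> (c1 - 1) / (c1 + 1) * m"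
  defines "T \<equiv> V\<^sup>T * S * V"
  defines "A \<equiv> A_mat m q \<psi> T (V\<^sup>T * Zb)" and "B \<equiv> score_mat m q T (V\<^sup>T * Zb)"
  shows "T \<in> carrier_mat k k" "T\<^sup>T = T"
    and "\<And>x. x \<in> carrier_vec k \<Longrightarrow> x \<noteq> 0\<^sub>v k \<Longrightarrow> 0 < x \<bullet> (T *\<^sub>v x)"
    and "\<And>w. B w \<in> carrier_mat k k" "\<And>w. (B w)\<^sup>T = B w"
    and "\<And>w. w \<in> carrier_vec r \<Longrightarrow> w \<noteq> 0\<^sub>v r \<Longrightarrow> 0 < frob2 (B w)"
    and "\<And>w x. frob2 (B w) \<le> 2 \<Longrightarrow> x \<in> carrier_vec k \<Longrightarrow> (B w *\<^sub>v x) \<bullet> (B w *\<^sub>v x) \<le> rate\<^sup>2 * (x \<bullet> x)"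
    and "var_info r A \<in> carrier_mat r r" "(var_info r A)\<^sup>T = var_info r A"
    and "\<And>w. w \<in> carrier_vec r \<Longrightarrow> w \<bullet> (var_info r A *\<^sub>v w) = frob2 (B w) / 2"
    and "\<And>w R. w \<in> carrier_vec r \<Longrightarrow> R \<in> carrier_vec k \<Longrightarrow>
      w \<bullet> var_score r A R = (R \<bullet> (B w *\<^sub>v R) - mat_trace (B w)) / 2"
proof -
  show T: "T \<in> carrier_mat k k" using S(1) V(1) by (auto simp: T_def)
  show TT: "T\<^sup>T = T" using S V(1) transpose_congruence[of S "V\<^sup>T"] by (simp add: T_def)
  show Tpos: "0 < x \<bullet> (T *\<^sub>v x)" if x: "x \<in> carrier_vec k" "x \<noteq> 0\<^sub>v k" for x
  proof -
    have Vx: "V *\<^sub>v x \<in> carrier_vec n" using V(1) by (intro carrier_vecI) auto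
    have "0 < last_param q \<psi> * (x \<bullet> x)" using last scalar_prod_real_pos[OF x] by simp
    also have "\<dots> \<le> x \<bullet> (T *\<^sub>v x)"
      using Slo[OF Vx] congruence_bounds[OF S V x(1)] by (simp add: T_def)
    finally show ?thesis .
  qed
  note G = inv_sqrt[OF T TT Tpos]
  have VZ: "V\<^sup>T * Zb \<in> carrier_mat k (m * q)" using V(1) Zb by auto
  show B: "B w \<in> carrier_mat k k" "(B w)\<^sup>T = B w" for w
    unfolding B_def using score_mat_symmetric[OF q VZ G(1,2)] by auto
  have Ac: "A j \<in> carrier_mat k k" for j
    unfolding A_def by (rule A_mat_carrier[OF VZ G(1,3) \<psi>(2)])
  have AB: "(\<Sum>j<r. w $ j * A j $$ (a, b)) = B w $$ (a, b)" if "a < k" "b < k" for w a b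
    unfolding A_def B_def by (rule score_mat_index[OF \<psi>(2) VZ G(1-3) that])
  \<comment> \<open>The score matrix of the compressed design is built from the compression of the
    full matrix: the identity term survives because \<open>V^T V\<close> is the identity.\<close>
  have Beq: "B w = inv_sqrt T * (V\<^sup>T * (Zb * Psi m q w * Zb\<^sup>T + last_param q w \<cdot>\<^sub>m 1\<^sub>m n) * V) * inv_sqrt T" for w
  proof -
    let ?K = "Zb * Psi m q w * Zb\<^sup>T" and ?\<kappa> = "last_param q w"
    have K: "?K \<in> carrier_mat n n" using Zb Psi_carrier by auto
    have "V\<^sup>T * (?K + ?\<kappa> \<cdot>\<^sub>m 1\<^sub>m n) * V = V\<^sup>T * ?K * V + V\<^sup>T * (?\<kappa> \<cdot>\<^sub>m 1\<^sub>m n) * V"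
      using V(1) K by (simp add: mult_add_distrib_mat[of _ k n _ n] add_mult_distrib_mat[of _ k n _ _ k])
    also have "V\<^sup>T * (?\<kappa> \<cdot>\<^sub>m 1\<^sub>m n) * V = ?\<kappa> \<cdot>\<^sub>m 1\<^sub>m k"
      using V by (simp add: mult_smult_distrib[of _ k n _ n] mult_smult_assoc_mat[of _ k n _ k] right_mult_one_mat[of _ k n])
    also have "V\<^sup>T * ?K * V = V\<^sup>T * Zb * Psi m q w * (V\<^sup>T * Zb)\<^sup>T"
      using V(1) Zb Psi_carrier[of m q w] by (simp add: transpose_mult_dim mult_mat_assoc_dim)
    finally show ?thesis using V(1) by (simp add: B_def score_mat_def)
  qed
  have N: "c1 * real (m * q) \<le> real n"
    using nbar m q by (simp add: field_simps)
  have m0: "0 < m" using m by simp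
  have low: "2 * (c2\<^sup>2 * frob2 (Psi1 q w) + (last_param q w)\<^sup>2) \<le> L * \<sigma>\<^sup>2 / m * frob2 (B w)" for w
    unfolding Beq L_def T_def
    by (rule compressed_information_bounds(1)[OF Zb Psi_carrier Psi_symmetric[OF q] c2 _ _ c1 N refl m0 q
          frob2_Psi[OF q] frob2_nonneg _ S last less_imp_le[OF \<sigma>] _ _ V nk])
      (auto intro: Zlo Zhi Psi_op_bound[OF q] Slo Shi)
  have op: "(B w *\<^sub>v x) \<bullet> (B w *\<^sub>v x) \<le> L * (\<sigma> / last_param q \<psi>)\<^sup>2 / m * frob2 (B w) * (x \<bullet> x)"
    if "x \<in> carrier_vec k" for w x
    unfolding Beq L_def T_def
    by (rule compressed_information_bounds(2)[OF Zb Psi_carrier Psi_symmetric[OF q] c2 _ _ c1 N refl m0 q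
          frob2_Psi[OF q] frob2_nonneg _ S last less_imp_le[OF \<sigma>] _ _ V nk])
      (auto intro: Zlo Zhi Psi_op_bound[OF q] Slo Shi that)
  show "0 < frob2 (B w)" if w: "w \<in> carrier_vec r" "w \<noteq> 0\<^sub>v r" for w
  proof (rule ccontr)
    assume "\<not> 0 < frob2 (B w)"
    hence "frob2 (B w) = 0" using frob2_nonneg[of "B w"] by linarith
    hence "c2\<^sup>2 * frob2 (Psi1 q w) + (last_param q w)\<^sup>2 \<le> 0" using low[of w] by simp
    moreover have "0 \<le> c2\<^sup>2 * frob2 (Psi1 q w)" by (simp add: frob2_nonneg)
    ultimately have "c2\<^sup>2 * frob2 (Psi1 q w) = 0" "(last_param q w)\<^sup>2 = 0"
      using zero_le_power2[of "last_param q w"] by linarith+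
    hence "frob2 (Psi1 q w) = 0" "last_param q w = 0" using c2 by auto
    from Psi1_eq_0D[OF w(1) this] w(2) show False by simp
  qed
  show "(B w *\<^sub>v x) \<bullet> (B w *\<^sub>v x) \<le> rate\<^sup>2 * (x \<bullet> x)" if "frob2 (B w) \<le> 2" and x: "x \<in> carrier_vec k" for w x
  proof -
    have "(B w *\<^sub>v x) \<bullet> (B w *\<^sub>v x) \<le> L * (\<sigma> / last_param q \<psi>)\<^sup>2 / m * frob2 (B w) * (x \<bullet> x)"
      by (rule op[OF x])
    also have "\<dots> \<le> L * (\<sigma> / last_param q \<psi>)\<^sup>2 / m * 2 * (x \<bullet> x)"
      using L that(1) by (intro mult_right_mono mult_left_mono scalar_prod_real_nonneg) auto
    \<comment> \<open>The definition of \<open>rate\<close> is read off here, with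
      \<open>frob2 (B w)\<close> replaced by its bound 2.\<close>
    also have "\<dots> = rate\<^sup>2 * (x \<bullet> x)" unfolding rate_def power_mult_distrib using L by simp
    finally show ?thesis .
  qed
  show "var_info r A \<in> carrier_mat r r" by (simp add: var_info_def)
  show "(var_info r A)\<^sup>T = var_info r A" by (rule var_info_symmetric[OF Ac])
  show "w \<bullet> (var_info r A *\<^sub>v w) = frob2 (B w) / 2" if "w \<in> carrier_vec r" for w
    by (rule var_info_combination[OF that Ac B AB])
  show "w \<bullet> var_score r A R = (R \<bullet> (B w *\<^sub>v R) - mat_trace (B w)) / 2"
    if "w \<in> carrier_vec r" "R \<in> carrier_vec k" for w R
    by (rule var_score_combination[OF that(1) Ac B(1) AB that(2)])
qed

end

context cluster_setup
begin

text \<open>\<open>V^T\<close> annihilates the mean, so there is no linear term and the whole unit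
  variance lies in the quadratic part.\<close>

lemma restricted_char_bound:
  assumes C: "quadratic_char_constant C"
    and V: "null_basis Xb V" and pm: "8 * c2^4 * real p \<le> (c1 - 1) / (c1 + 1) * m"
    and v: "v \<in> unit_sphere r"
  defines "W \<equiv> \<lambda>\<omega>. v \<bullet> std_restricted_score m q V Zb \<psi> (y \<omega>)"
  shows "W \<in> borel_measurable M"
    "\<bar>t\<bar> * rate \<le> 1 \<Longrightarrow> cmod (char (distr M borel W) t - exp (- (t\<^sup>2) / 2)) \<le> 2 * C * \<bar>t\<bar> ^ 3 * rate"
proof -
  interpret prob_space M by (rule prob)
  define k where "k = dim_col V"
  have V: "V \<in> carrier_mat n k" "V\<^sup>T * V = 1\<^sub>m k" and VX: "V\<^sup>T * Xb = 0\<^sub>m k p" and k: "k = n - p"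
    using V Xb by (auto simp: null_basis_def k_def)
  \<comment> \<open>The subtraction in \<open>k = n - p\<close> is truncated, so only this
    inequality is read off; it has the direction that \<open>nk\<close> needs.\<close>
  have "n \<le> k + p" using k by simp
  hence "real n \<le> real (k + p)" by (rule of_nat_mono)
  hence "8 * c2^4 * (real n - real k) \<le> 8 * c2^4 * real p"
    by (intro mult_left_mono) auto
  hence nk: "8 * c2^4 * (real n - real k) \<le> (c1 - 1) / (c1 + 1) * m" using pm by linarith
  define T where "T = V\<^sup>T * S * V"
  define A where "A = A_mat m q \<psi> T (V\<^sup>T * Zb)"
  define B where "B = score_mat m q T (V\<^sup>T * Zb)"
  note cs = compressed_score[OF V nk, folded T_def, folded A_def B_def]
  note G = inv_sqrt[OF cs(1,2) cs(3)]
  define I where "I = var_info r A"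
  have I: "I \<in> carrier_mat r r" "I\<^sup>T = I" using cs(8,9) by (auto simp: I_def)
  have Ipos: "0 < w \<bullet> (I *\<^sub>v w)" if "w \<in> carrier_vec r" "w \<noteq> 0\<^sub>v r" for w
    using cs(6)[OF that] cs(10)[OF that(1)] by (simp add: I_def)
  have v: "v \<in> carrier_vec r" "v \<bullet> v = 1" using v by (auto simp: unit_sphere_def vec_norm_def)
  define w where "w = inv_sqrt I *\<^sub>v v"
  note std = inv_sqrt_standardization[OF I Ipos v(1), folded w_def]
  \<comment> \<open>The zero vector merely fills the place of the score, on which this conclusion
    does not depend.\<close>
  have w: "w \<in> carrier_vec r" by (rule std(1)[of "0\<^sub>v r"]) auto
  have Bw: "frob2 (B w) / 2 = 1"
    using std(3)[of "0\<^sub>v r"] cs(10)[OF w] v(2) by (simp add: I_def)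
  define R where "R \<omega> = inv_sqrt T *\<^sub>v (V\<^sup>T *\<^sub>v \<xi> \<omega>)" for \<omega>
  have Rc: "R \<omega> \<in> carrier_vec k" for \<omega> using G(1) by (intro carrier_vecI) (auto simp: R_def)
  have W: "W \<omega> = 0\<^sub>v k \<bullet> R \<omega> + (R \<omega> \<bullet> (B w *\<^sub>v R \<omega>) - mat_trace (B w)) / 2" if \<omega>: "\<omega> \<in> space M" for \<omega>
  proof -
    have X\<beta>: "Xb *\<^sub>v \<beta> \<in> carrier_vec n" using Xb by (intro carrier_vecI) auto
    have "V\<^sup>T *\<^sub>v y \<omega> = V\<^sup>T *\<^sub>v (Xb *\<^sub>v \<beta>) + V\<^sup>T *\<^sub>v \<xi> \<omega>"
      unfolding residual(2)[OF \<omega>] using V(1) X\<beta> residual(1)[OF \<omega>]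
      by (intro mult_add_distrib_mat_vec[of _ k n]) auto
    also have "V\<^sup>T *\<^sub>v (Xb *\<^sub>v \<beta>) = (V\<^sup>T * Xb) *\<^sub>v \<beta>"
      using V(1) Xb \<beta> by (simp add: mult_mat_vec_assoc_dim)
    also have "\<dots> + V\<^sup>T *\<^sub>v \<xi> \<omega> = V\<^sup>T *\<^sub>v \<xi> \<omega>"
      unfolding VX using \<beta> V(1) by (intro eq_vecI) (auto simp: scalar_prod_def)
    finally have Vy: "V\<^sup>T *\<^sub>v y \<omega> = V\<^sup>T *\<^sub>v \<xi> \<omega>" .
    have "W \<omega> = v \<bullet> (inv_sqrt I *\<^sub>v var_score r A (R \<omega>))"
      by (simp add: W_def std_restricted_score_def restricted_info_def restricted_score_def Let_def Vy
          R_def I_def A_def T_def)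
    also have "\<dots> = w \<bullet> var_score r A (R \<omega>)"
      by (rule std(2)) (auto simp: var_score_def)
    also have "\<dots> = (R \<omega> \<bullet> (B w *\<^sub>v R \<omega>) - mat_trace (B w)) / 2" by (rule cs(11)[OF w Rc])
    finally show ?thesis using Rc[of \<omega>] by simp
  qed
  have G3: "inv_sqrt T * (V\<^sup>T * S * V * inv_sqrt T) = 1\<^sub>m k" using G(4) by (simp add: T_def)
  have l: "(0\<^sub>v k :: real vec) \<in> carrier_vec k" "0\<^sub>v k \<bullet> 0\<^sub>v k + frob2 (B w) / 2 = 1" using Bw by auto
  have op: "(B w *\<^sub>v x) \<bullet> (B w *\<^sub>v x) \<le> rate\<^sup>2 * (x \<bullet> x)" if "x \<in> carrier_vec k" for x
    using cs(7)[of w x] Bw that by simp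
  note gq = gaussian_quadratic_char_bound[OF C residual(1) residual(3) residual(4) S(1) V(1) G(1,2) G3 l(1) cs(4,5) l(2)
      rate_nonneg op, folded R_def]
  let ?Q = "\<lambda>\<omega>. 0\<^sub>v k \<bullet> R \<omega> + (R \<omega> \<bullet> (B w *\<^sub>v R \<omega>) - mat_trace (B w)) / 2"
  have Qm: "?Q \<in> borel_measurable M" by (rule gq(1))
  show "W \<in> borel_measurable M" using Qm W by (simp cong: measurable_cong)
  have eq: "distr M borel W = distr M borel ?Q" by (intro distr_cong) (auto simp: W)
  show "cmod (char (distr M borel W) t - exp (- (t\<^sup>2) / 2)) \<le> 2 * C * \<bar>t\<bar> ^ 3 * rate" if "\<bar>t\<bar> * rate \<le> 1"
    unfolding eq by (rule gq(2)) (use that in auto)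
qed

text \<open>The raw direction splits into a part for the regression coefficients, which yields the
  linear form \<open>l\<close>, and a part for the variance parameters, which yields the matrix
  \<open>B b\<close>. As the information is block-diagonal, the variances of the two parts add up to
  1.\<close>

lemma std_score_char_bound:
  assumes C: "quadratic_char_constant C"
    and rank: "full_column_rank Xb"
    and u: "u \<in> unit_sphere (r + p)"
  defines "W \<equiv> \<lambda>\<omega>. u \<bullet> std_score m q Xb Zb \<beta> \<psi> (y \<omega>)"
  shows "W \<in> borel_measurable M"
    "\<bar>t\<bar> * rate \<le> 1 \<Longrightarrow> cmod (char (distr M borel W) t - exp (- (t\<^sup>2) / 2)) \<le> 2 * C * \<bar>t\<bar> ^ 3 * rate"
proof -
  interpret prob_space M by (rule prob)
  \<comment> \<open>Without compression the loss term \<open>n - k\<close> is 0, so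
    \<open>compressed_score\<close> applies whatever the size of \<open>p\<close>.\<close>
  define V :: "real mat" where "V = 1\<^sub>m n"
  have V: "V \<in> carrier_mat n n" "V\<^sup>T * V = 1\<^sub>m n" by (auto simp: V_def)
  have nk: "8 * c2^4 * (real n - real n) \<le> (c1 - 1) / (c1 + 1) * m" using c1 by simp
  have T: "V\<^sup>T * S * V = S" and VZ: "V\<^sup>T * Zb = Zb"
    using S(1) Zb by (simp_all add: V_def left_mult_one_mat[OF S(1)] left_mult_one_mat[OF Zb] right_mult_one_mat[OF S(1)])
  define A where "A = A_mat m q \<psi> S Zb"
  define B where "B = score_mat m q S Zb"
  note cs = compressed_score[OF V nk, unfolded T VZ, folded A_def B_def]
  note G = inv_sqrt[OF cs(1,2) cs(3)]
  define Gs where "Gs = inv_sqrt S"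
  note G = G[folded Gs_def]
  have SGG: "S * Gs * Gs = 1\<^sub>m n" using G(5) by simp
  define F1 where "F1 = Xb\<^sup>T * mat_inv S * Xb"
  define F2 where "F2 = var_info r A"
  define F where "F = four_block_mat F1 (0\<^sub>m p r) (0\<^sub>m r p) F2"
  have mi: "mat_inv S \<in> carrier_mat n n" using G(1,3) by (metis mult_carrier_mat)
  have F1: "F1 \<in> carrier_mat p p" using Xb mi by (auto simp: F1_def)
  have F2: "F2 \<in> carrier_mat r r" "F2\<^sup>T = F2" using cs(8,9) by (auto simp: F2_def)
  have F: "F \<in> carrier_mat (p + r) (p + r)" using four_block_carrier_mat[OF F1 F2(1)] by (simp add: F_def)
  have Feq: "fisher_info m q Xb Zb \<psi> = F"
  proof -
    have "fisher_info m q Xb Zb \<psi> = diag_block_mat [F1, F2]"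
      by (simp only: fisher_info_def Let_def F1_def F2_def A_def)
    also have "\<dots> = F"
      using F1 F2(1) unfolding F_def
      by (subst diag_block_mat.simps(2), unfold diag_block_mat_singleton Let_def) simp
    finally show ?thesis .
  qed
  have F1T: "F1\<^sup>T = F1"
    using transpose_congruence[of "mat_inv S" "Xb\<^sup>T"] transpose_mult_dim[of Gs Gs] G(1-3) Xb mi
    by (simp add: F1_def)
  have FT: "F\<^sup>T = F"
    unfolding F_def using F1 F2 F1T by (subst transpose_four_block_mat[of _ p p _ r _ r]) auto
  have F1q: "x \<bullet> (F1 *\<^sub>v x) = (Gs *\<^sub>v (Xb *\<^sub>v x)) \<bullet> (Gs *\<^sub>v (Xb *\<^sub>v x))" if x: "x \<in> carrier_vec p" for x
  proof -
    have "F1 *\<^sub>v x = Xb\<^sup>T *\<^sub>v (Gs *\<^sub>v (Gs *\<^sub>v (Xb *\<^sub>v x)))"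
      using Xb x G(1) mi by (simp add: F1_def mult_mat_vec_assoc_dim flip: G(3))
    hence "x \<bullet> (F1 *\<^sub>v x) = (Xb *\<^sub>v x) \<bullet> (Gs *\<^sub>v (Gs *\<^sub>v (Xb *\<^sub>v x)))"
      using scalar_prod_transpose_dim[of x "Xb\<^sup>T" "Gs *\<^sub>v (Gs *\<^sub>v (Xb *\<^sub>v x))"] Xb x G(1) by simp
    also have "\<dots> = (Gs *\<^sub>v (Xb *\<^sub>v x)) \<bullet> (Gs *\<^sub>v (Xb *\<^sub>v x))"
      using scalar_prod_transpose_dim[of "Xb *\<^sub>v x" Gs "Gs *\<^sub>v (Xb *\<^sub>v x)"] Xb G(1,2) by simp
    finally show ?thesis .
  qed
  have F1pos: "0 < x \<bullet> (F1 *\<^sub>v x)" if x: "x \<in> carrier_vec p" "x \<noteq> 0\<^sub>v p" for x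
  proof -
    have Xx: "Xb *\<^sub>v x \<in> carrier_vec n" using Xb by (intro carrier_vecI) auto
    have GX: "Gs *\<^sub>v (Xb *\<^sub>v x) \<in> carrier_vec n" using G(1) by (intro carrier_vecI) auto
    have "Gs *\<^sub>v (Xb *\<^sub>v x) \<noteq> 0\<^sub>v n"
    proof
      assume 0: "Gs *\<^sub>v (Xb *\<^sub>v x) = 0\<^sub>v n"
      \<comment> \<open>\<open>S * Gs\<close> undoes \<open>Gs\<close>, so a null vector of the
        whitened design is one of the design itself, where the rank condition applies.\<close>
      have "Xb *\<^sub>v x = (S * Gs * Gs) *\<^sub>v (Xb *\<^sub>v x)" unfolding SGG using Xx by simp
      also have "\<dots> = S *\<^sub>v (Gs *\<^sub>v (Gs *\<^sub>v (Xb *\<^sub>v x)))"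
        using S(1) G(1) Xb by (simp add: mult_mat_vec_assoc_dim)
      also have "\<dots> = 0\<^sub>v n" unfolding 0 using S(1) G(1) by (auto intro!: eq_vecI simp: scalar_prod_def)
      finally have "x = 0\<^sub>v p" by (rule full_column_rank_inj[OF Xb rank x(1)])
      with x show False by simp
    qed
    from scalar_prod_real_pos[OF GX this] show ?thesis by (simp add: F1q[OF x(1)])
  qed
  have Fq: "(a @\<^sub>v b) \<bullet> (F *\<^sub>v (a @\<^sub>v b)) = a \<bullet> (F1 *\<^sub>v a) + b \<bullet> (F2 *\<^sub>v b)"
    if "a \<in> carrier_vec p" "b \<in> carrier_vec r" for a b
    unfolding F_def four_block_diag_mult_vec[OF F1 F2(1) that] using that F1 F2(1)
    by (intro scalar_prod_append) (auto intro!: carrier_vecI)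
  have F2q: "b \<bullet> (F2 *\<^sub>v b) = frob2 (B b) / 2" if "b \<in> carrier_vec r" for b
    using cs(10)[OF that] by (simp add: F2_def)
  have split: "vec_first x p @\<^sub>v vec_last x r = x" if "x \<in> carrier_vec (p + r)" for x :: "real vec"
    using vec_first_last_append[OF that] .
  have Fpos: "0 < x \<bullet> (F *\<^sub>v x)" if x: "x \<in> carrier_vec (p + r)" "x \<noteq> 0\<^sub>v (p + r)" for x
  proof -
    let ?a = "vec_first x p" and ?b = "vec_last x r"
    have ab: "?a \<in> carrier_vec p" "?b \<in> carrier_vec r" by auto
    have "?a \<noteq> 0\<^sub>v p \<or> ?b \<noteq> 0\<^sub>v r"
    proof (rule ccontr)
      assume "\<not> ?thesis"
      hence "x = 0\<^sub>v p @\<^sub>v 0\<^sub>v r" using split[OF x(1)] by simp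
      also have "\<dots> = 0\<^sub>v (p + r)" by (intro eq_vecI) auto
      finally show False using x(2) by simp
    qed
    moreover have "0 \<le> ?a \<bullet> (F1 *\<^sub>v ?a)" by (simp add: F1q[OF ab(1)] scalar_prod_real_nonneg)
    moreover have "0 \<le> ?b \<bullet> (F2 *\<^sub>v ?b)" by (simp add: F2q[OF ab(2)] frob2_nonneg)
    moreover have "0 < ?b \<bullet> (F2 *\<^sub>v ?b)" if "?b \<noteq> 0\<^sub>v r" using cs(6)[OF ab(2) that] F2q[OF ab(2)] by simp
    ultimately have "0 < ?a \<bullet> (F1 *\<^sub>v ?a) + ?b \<bullet> (F2 *\<^sub>v ?b)"
      using F1pos[OF ab(1)] by (metis add_pos_nonneg add_nonneg_pos)
    thus ?thesis using Fq[OF ab] split[OF x(1)] by simp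
  qed
  have u: "u \<in> carrier_vec (p + r)" "u \<bullet> u = 1" using u by (auto simp: unit_sphere_def vec_norm_def add.commute)
  define w where "w = inv_sqrt F *\<^sub>v u"
  note std = inv_sqrt_standardization[OF F FT Fpos u(1), folded w_def]
  have w: "w \<in> carrier_vec (p + r)" by (rule std(1)[of "0\<^sub>v (p + r)"]) auto
  define a where "a = vec_first w p"
  define b where "b = vec_last w r"
  have ab: "a \<in> carrier_vec p" "b \<in> carrier_vec r" and wab: "w = a @\<^sub>v b"
    using split[OF w] by (auto simp: a_def b_def)
  \<comment> \<open>The whitened image of the regression part; its squared length is the form of
    \<open>F1\<close> at \<open>a\<close>.\<close>
  define l where "l = Gs *\<^sub>v (Xb *\<^sub>v a)"
  have l: "l \<in> carrier_vec n" using G(1) by (intro carrier_vecI) (auto simp: l_def)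
  have unit: "l \<bullet> l + frob2 (B b) / 2 = 1"
    using std(3)[of "0\<^sub>v (p + r)"] u(2) unfolding wab Fq[OF ab] F1q[OF ab(1)] F2q[OF ab(2)] by (simp add: l_def)
  hence Bb: "frob2 (B b) \<le> 2" using scalar_prod_real_nonneg[of l] by linarith
  define R where "R \<omega> = Gs *\<^sub>v (V\<^sup>T *\<^sub>v \<xi> \<omega>)" for \<omega>
  have Rc: "R \<omega> \<in> carrier_vec n" for \<omega> using G(1) by (intro carrier_vecI) (auto simp: R_def)
  have W: "W \<omega> = l \<bullet> R \<omega> + (R \<omega> \<bullet> (B b *\<^sub>v R \<omega>) - mat_trace (B b)) / 2" if \<omega>: "\<omega> \<in> space M" for \<omega>
  proof -
    have X\<beta>: "Xb *\<^sub>v \<beta> \<in> carrier_vec n" using Xb by (intro carrier_vecI) auto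
    have res: "y \<omega> - Xb *\<^sub>v \<beta> = V\<^sup>T *\<^sub>v \<xi> \<omega>"
      unfolding residual(2)[OF \<omega>] V_def using X\<beta> Xb residual(1)[OF \<omega>] by (intro eq_vecI) auto
    have sc: "score m q Xb Zb \<beta> \<psi> (y \<omega>) = (Xb\<^sup>T *\<^sub>v (Gs *\<^sub>v R \<omega>)) @\<^sub>v var_score r A (R \<omega>)"
      by (simp add: score_def Let_def res R_def Gs_def A_def)
    have c: "Xb\<^sup>T *\<^sub>v (Gs *\<^sub>v R \<omega>) \<in> carrier_vec p" "var_score r A (R \<omega>) \<in> carrier_vec r"
      using Xb by (auto intro!: carrier_vecI simp: var_score_def)
    have "W \<omega> = w \<bullet> ((Xb\<^sup>T *\<^sub>v (Gs *\<^sub>v R \<omega>)) @\<^sub>v var_score r A (R \<omega>))"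
      unfolding W_def std_score_def Feq sc using c by (intro std(2)) auto
    also have "\<dots> = a \<bullet> (Xb\<^sup>T *\<^sub>v (Gs *\<^sub>v R \<omega>)) + b \<bullet> var_score r A (R \<omega>)"
      unfolding wab by (rule scalar_prod_append[OF ab c])
    also have "b \<bullet> var_score r A (R \<omega>) = (R \<omega> \<bullet> (B b *\<^sub>v R \<omega>) - mat_trace (B b)) / 2"
      by (rule cs(11)[OF ab(2) Rc])
    also have "a \<bullet> (Xb\<^sup>T *\<^sub>v (Gs *\<^sub>v R \<omega>)) = l \<bullet> R \<omega>"
      using scalar_prod_transpose_dim[of a "Xb\<^sup>T" "Gs *\<^sub>v R \<omega>"]
        scalar_prod_transpose_dim[of "Xb *\<^sub>v a" Gs "R \<omega>"] Xb G(1,2) ab(1) Rc[of \<omega>]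
      by (simp add: l_def)
    finally show ?thesis .
  qed
  have G3: "Gs * (V\<^sup>T * S * V * Gs) = 1\<^sub>m n" using G(4) by (simp add: T)
  have op: "(B b *\<^sub>v x) \<bullet> (B b *\<^sub>v x) \<le> rate\<^sup>2 * (x \<bullet> x)" if "x \<in> carrier_vec n" for x
    using cs(7)[OF Bb that] .
  note gq = gaussian_quadratic_char_bound[OF C residual(1) residual(3) residual(4) S(1) V(1) G(1,2) G3 l cs(4,5) unit
      rate_nonneg op, folded R_def]
  let ?Q = "\<lambda>\<omega>. l \<bullet> R \<omega> + (R \<omega> \<bullet> (B b *\<^sub>v R \<omega>) - mat_trace (B b)) / 2"
  have Qm: "?Q \<in> borel_measurable M" by (rule gq(1))
  show "W \<in> borel_measurable M" using Qm W by (simp cong: measurable_cong)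
  have eq: "distr M borel W = distr M borel ?Q" by (intro distr_cong) (auto simp: W)
  show "cmod (char (distr M borel W) t - exp (- (t\<^sup>2) / 2)) \<le> 2 * C * \<bar>t\<bar> ^ 3 * rate" if "\<bar>t\<bar> * rate \<le> 1"
    unfolding eq by (rule gq(2)) (use that in auto)
qed

text \<open>Separates \<open>1 / sqrt m\<close> from the ratio that the growth condition
  controls.\<close>

lemma rate_le:
  "rate \<le> sqrt (2 * L) * (1 / sqrt m + c2 * sqrt 2 * (vec_norm \<psi> / last_param q \<psi> / sqrt m))"
proof -
  have "sqrt (frob2 (Psi1 q \<psi>)) \<le> sqrt 2 * vec_norm \<psi>"
    using real_sqrt_le_mono[OF frob2_Psi1_le[OF \<psi>(2)]] by (simp add: vec_norm_def real_sqrt_mult)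
  hence "\<sigma> \<le> last_param q \<psi> + c2 * (sqrt 2 * vec_norm \<psi>)"
    unfolding \<sigma>_def using c2 by (intro add_left_mono mult_left_mono) auto
  hence "\<sigma> / last_param q \<psi> \<le> 1 + c2 * sqrt 2 * (vec_norm \<psi> / last_param q \<psi>)"
    using last by (simp add: field_simps)
  hence "rate \<le> sqrt (2 * L / m) * (1 + c2 * sqrt 2 * (vec_norm \<psi> / last_param q \<psi>))"
    unfolding rate_def using L by (intro mult_left_mono) auto
  also have "\<dots> = sqrt (2 * L) * (1 / sqrt m + c2 * sqrt 2 * (vec_norm \<psi> / last_param q \<psi> / sqrt m))"
    unfolding real_sqrt_divide by (simp add: divide_inverse algebra_simps)
  finally show ?thesis .
qed

end

section \<open>Passage to the limit in the number of clusters\<close>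

theorem corollary2:
  fixes M :: "nat \<Rightarrow> 'a measure"
    and ns :: "nat \<Rightarrow> nat \<Rightarrow> nat"
    and p q :: "nat \<Rightarrow> nat"
    and X Z :: "nat \<Rightarrow> nat \<Rightarrow> real mat"
    and \<beta> \<psi> :: "nat \<Rightarrow> real vec"
    and U E Y :: "nat \<Rightarrow> nat \<Rightarrow> 'a \<Rightarrow> real vec"
    and c1 c2 :: real
  assumes model: "\<And>m. m \<ge> 1 \<Longrightarrow>
      cluster_model (M m) m (ns m) (p m) (q m) (X m) (Z m) (\<beta> m) (\<psi> m) (U m) (E m) (Y m)"
    and c1: "c1 > 1"
    and c2: "c2 > 1"
    and i: "\<And>m. m \<ge> 1 \<Longrightarrow> (real (\<Sum>i<m. ns m i) / real m) / real (q m) \<ge> c1"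
    and ii: "\<And>m i. m \<ge> 1 \<Longrightarrow> i < m \<Longrightarrow>
      inverse c2 \<le> eig_min ((Z m i)\<^sup>T * Z m i) \<and>
      eig_min ((Z m i)\<^sup>T * Z m i) \<le> eig_max ((Z m i)\<^sup>T * Z m i) \<and>
      eig_max ((Z m i)\<^sup>T * Z m i) \<le> c2"
    and iv: "\<And>m. m \<ge> 1 \<Longrightarrow> full_column_rank (stack_mat (p m) m (X m))"
    and v: "(\<lambda>m. vec_norm (\<psi> m) / last_param (q m) (\<psi> m)) \<in> o(\<lambda>m. real m powr (1 / 2))"
  shows "(\<forall>u. (\<forall>m\<ge>1. u m \<in> unit_sphere (n_param (q m) + p m)) \<longrightarrow>
        weak_conv_m
          (\<lambda>m. distr (M m) borel (\<lambda>\<omega>. u m \<bullet>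
             std_score m (q m) (stack_mat (p m) m (X m)) (block_diag m (Z m)) (\<beta> m) (\<psi> m)
               (stack_vec m (\<lambda>i. Y m i \<omega>))))
          std_normal_distribution)
    \<and> ((\<lambda>m. real (p m) / real m) \<longlonglongrightarrow> 0 \<longrightarrow>
        (\<forall>V v. (\<forall>m\<ge>1. null_basis (stack_mat (p m) m (X m)) (V m)) \<longrightarrow>
               (\<forall>m\<ge>1. v m \<in> unit_sphere (n_param (q m))) \<longrightarrow>
          weak_conv_m
            (\<lambda>m. distr (M m) borel (\<lambda>\<omega>. v m \<bullet>
               std_restricted_score m (q m) (V m) (block_diag m (Z m)) (\<psi> m)
                 (stack_vec m (\<lambda>i. Y m i \<omega>))))
            std_normal_distribution))"
proof -
  obtain C where C: "quadratic_char_constant C"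
    by (rule std_normal_quadratic_char_bound)
  have locale_m: "cluster_setup (M m) m (ns m) (p m) (q m) (X m) (Z m) (\<beta> m) (\<psi> m) (U m) (E m) (Y m) c1 c2"
    if "1 \<le> m" for m
    using that model[OF that] c1 c2 i[OF that] ii[OF that] by unfold_locales auto
  define e where "e m = cluster_setup.rate m (q m) (\<psi> m) c1 c2" for m
  define L where "L = cluster_setup.L c1 c2"
  have e0: "0 \<le> e m" and e_le: "e m \<le> sqrt (2 * L) * (1 / sqrt m + c2 * sqrt 2 *
      (vec_norm (\<psi> m) / last_param (q m) (\<psi> m) / sqrt m))" if "1 \<le> m" for m
    using cluster_setup.rate_nonneg[OF locale_m[OF that]] cluster_setup.rate_le[OF locale_m[OF that]]
    by (simp_all add: e_def L_def)
  have e: "e \<longlonglongrightarrow> 0"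
  proof -
    have "(\<lambda>m. vec_norm (\<psi> m) / last_param (q m) (\<psi> m) / (real m powr (1 / 2))) \<longlonglongrightarrow> 0"
      by (rule smalloD_tendsto[OF v])
    hence "(\<lambda>m. vec_norm (\<psi> m) / last_param (q m) (\<psi> m) / sqrt m) \<longlonglongrightarrow> 0"
      by (simp add: powr_half_sqrt)
    moreover have "(\<lambda>m. 1 / sqrt (real m)) \<longlonglongrightarrow> 0" by real_asymp
    ultimately have "(\<lambda>m. sqrt (2 * L) * (1 / sqrt m + c2 * sqrt 2 *
        (vec_norm (\<psi> m) / last_param (q m) (\<psi> m) / sqrt m))) \<longlonglongrightarrow> sqrt (2 * L) * (0 + c2 * sqrt 2 * 0)"
      by (intro tendsto_intros)
    hence "(\<lambda>m. sqrt (2 * L) * (1 / sqrt m + c2 * sqrt 2 *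
        (vec_norm (\<psi> m) / last_param (q m) (\<psi> m) / sqrt m))) \<longlonglongrightarrow> 0" by simp
    moreover have "\<forall>\<^sub>F m in sequentially. 0 \<le> e m"
      using eventually_ge_at_top[of 1] by eventually_elim (rule e0)
    moreover have "\<forall>\<^sub>F m in sequentially. e m \<le> sqrt (2 * L) * (1 / sqrt m + c2 * sqrt 2 *
        (vec_norm (\<psi> m) / last_param (q m) (\<psi> m) / sqrt m))"
      using eventually_ge_at_top[of 1] by eventually_elim (rule e_le)
    ultimately show ?thesis
      using real_tendsto_sandwich[of "\<lambda>_. 0" e sequentially _ 0] by simp
  qed
  show ?thesis
  proof (intro conjI allI impI)
    fix u assume u: "\<forall>m\<ge>1. u m \<in> unit_sphere (n_param (q m) + p m)"
    let ?W = "\<lambda>m \<omega>. u m \<bullet> std_score m (q m) (stack_mat (p m) m (X m)) (block_diag m (Z m)) (\<beta> m) (\<psi> m)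
      (stack_vec m (\<lambda>i. Y m i \<omega>))"
    show "weak_conv_m (\<lambda>m. distr (M m) borel (?W m)) std_normal_distribution"
    proof (rule weak_conv_std_normalI[OF _ e])
      show "\<forall>\<^sub>F m in sequentially. prob_space (M m) \<and> ?W m \<in> borel_measurable (M m) \<and>
          (\<forall>t. \<bar>t\<bar> * e m \<le> 1 \<longrightarrow>
            cmod (char (distr (M m) borel (?W m)) t - exp (- (t\<^sup>2) / 2)) \<le> 2 * C * \<bar>t\<bar> ^ 3 * e m)"
        using eventually_ge_at_top[of 1]
      proof eventually_elim
        case (elim m)
        note b = cluster_setup.std_score_char_bound[OF locale_m[OF elim] C iv[OF elim] u[rule_format, OF elim], folded e_def]
        show ?case using cluster_setup.prob[OF locale_m[OF elim]] b by blast
      qed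
    qed
  next
    fix V v
    assume pm: "(\<lambda>m. real (p m) / real m) \<longlonglongrightarrow> 0"
      and V: "\<forall>m\<ge>1. null_basis (stack_mat (p m) m (X m)) (V m)"
      and v: "\<forall>m\<ge>1. v m \<in> unit_sphere (n_param (q m))"
    \<comment> \<open>Chosen so that \<open>p m / m < \<delta>\<close> yields the size condition in
      \<open>restricted_char_bound\<close>. The convergence of this ratio to 0 provides it for all
      large \<open>m\<close>, which is enough for a weak limit.\<close>
    define \<delta> where "\<delta> = (c1 - 1) / (c1 + 1) / (8 * c2^4)"
    have "0 < \<delta>" using c1 c2 by (simp add: \<delta>_def)
    from order_tendstoD(2)[OF pm this]
    have small: "\<forall>\<^sub>F m in sequentially. real (p m) / real m < \<delta>" .
    let ?W = "\<lambda>m \<omega>. v m \<bullet> std_restricted_score m (q m) (V m) (block_diag m (Z m)) (\<psi> m)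
      (stack_vec m (\<lambda>i. Y m i \<omega>))"
    show "weak_conv_m (\<lambda>m. distr (M m) borel (?W m)) std_normal_distribution"
    proof (rule weak_conv_std_normalI[OF _ e])
      show "\<forall>\<^sub>F m in sequentially. prob_space (M m) \<and> ?W m \<in> borel_measurable (M m) \<and>
          (\<forall>t. \<bar>t\<bar> * e m \<le> 1 \<longrightarrow>
            cmod (char (distr (M m) borel (?W m)) t - exp (- (t\<^sup>2) / 2)) \<le> 2 * C * \<bar>t\<bar> ^ 3 * e m)"
        using eventually_ge_at_top[of 1] small
      proof eventually_elim
        case (elim m)
        have "real (p m) \<le> \<delta> * m" using elim by (simp add: divide_less_eq)
        hence "8 * c2^4 * real (p m) \<le> 8 * c2^4 * (\<delta> * m)" by (intro mult_left_mono) auto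
        also have "\<dots> = (c1 - 1) / (c1 + 1) * m" using c2 by (simp add: \<delta>_def)
        finally have "8 * c2^4 * real (p m) \<le> (c1 - 1) / (c1 + 1) * m" .
        note b = cluster_setup.restricted_char_bound[OF locale_m[OF elim(1)] C V[rule_format, OF elim(1)] this
            v[rule_format, OF elim(1)], folded e_def]
        show ?case using cluster_setup.prob[OF locale_m[OF elim(1)]] b by blast
      qed
    qed
  qed
qed

end
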